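(* Let $R$ be an infinite countable integral domain and let $n\ge 2$. Then $\beta^{(2)}_i(\mathrm{SL}_n(R))=0$ for every $i\in\{0,\ldots,n-2\}$.
   Context: $\mathrm{SL}_n(R)$ is regarded as a discrete group. $\beta^{(2)}_i(\Gamma)\in[0,\infty]$ denotes the $i$-th $L^2$-Betti number of a countable discrete group $\Gamma$: $\beta^{(2)}_i(\Gamma)=\dim_{L(\Gamma)}H_i(\Gamma,L(\Gamma))$, where $L(\Gamma)$ is the group von Neumann algebra and $\dim_{L(\Gamma)}$ is Lück's dimension function on arbitrary $L(\Gamma)$-modules ($\dim_{L(\Gamma)}M$ is the supremum of the von Neumann dimensions of finitely generated projective submodules of $M$, where the von Neumann dimension is computed with the canonical trace). *)

theory Defs
  imports
    "HOL-Analysis.Infinite_Sum"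
    "HOL-Library.Extended_Real"
    "HOL-Algebra.AbelCoset"
    "HOL-Algebra.Module"
    "Jordan_Normal_Form.Determinant"
begin

section \<open>Left modules over a (not necessarily commutative) ring\<close>

text \<open>
  The records of HOL-Algebra are used for rings and modules, but the locale for modules there
  requires a commutative ring, so it is not applicable to group von Neumann algebras; all modules
  below are left modules.  The locale \<open>submodule\<close> of HOL-Algebra makes no such assumption and
  is used as is.  The fields \<open>mult\<close> and \<open>one\<close> of a module record are never used.
\<close>

definition module_iso ::
    "('r, 'c) ring_scheme \<Rightarrow> ('r, 'm, 'd) module_scheme \<Rightarrow> ('r, 'n, 'e) module_scheme \<Rightarrow> ('m \<Rightarrow> 'n) set"
  where "module_iso R M N =
    {f. bij_betw f (carrier M) (carrier N)
      \<and> (\<forall>x\<in>carrier M. \<forall>y\<in>carrier M. f (x \<oplus>\<^bsub>M\<^esub> y) = f x \<oplus>\<^bsub>N\<^esub> f y)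
      \<and> (\<forall>a\<in>carrier R. \<forall>x\<in>carrier M. f (a \<odot>\<^bsub>M\<^esub> x) = a \<odot>\<^bsub>N\<^esub> f x)}"

definition module_isomorphic ::
    "('r, 'c) ring_scheme \<Rightarrow> ('r, 'm, 'd) module_scheme \<Rightarrow> ('r, 'n, 'e) module_scheme \<Rightarrow> bool"
  where "module_isomorphic R M N \<longleftrightarrow> module_iso R M N \<noteq> {}"

definition quotient_module :: "('r, 'm, 'd) module_scheme \<Rightarrow> 'm set \<Rightarrow> ('r, 'm set) module"
  where "quotient_module M B =
    \<lparr>carrier = a_rcosets\<^bsub>M\<^esub> B, mult = undefined, one = undefined,
     zero = B, add = (<+>\<^bsub>M\<^esub>),
     module.smult = (\<lambda>a X. B <+>\<^bsub>M\<^esub> ((\<lambda>x. a \<odot>\<^bsub>M\<^esub> x) ` X))\<rparr>"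

definition regular_module :: "('r, 'c) ring_scheme \<Rightarrow> ('r, 'r) module"
  where "regular_module R =
    \<lparr>carrier = carrier R, mult = mult R, one = one R, zero = zero R, add = add R, module.smult = mult R\<rparr>"

definition free_module :: "('r, 'c) ring_scheme \<Rightarrow> nat \<Rightarrow> ('r, nat \<Rightarrow> 'r) module"
  where "free_module R k =
    \<lparr>carrier = {..<k} \<rightarrow>\<^sub>E carrier R, mult = undefined, one = undefined,
     zero = (\<lambda>i\<in>{..<k}. \<zero>\<^bsub>R\<^esub>),
     add = (\<lambda>x y. \<lambda>i\<in>{..<k}. x i \<oplus>\<^bsub>R\<^esub> y i),
     module.smult = (\<lambda>a x. \<lambda>i\<in>{..<k}. a \<otimes>\<^bsub>R\<^esub> x i)\<rparr>"

text \<open>Finitely generated projective: isomorphic to a direct summand of some \<open>R\<^sup>k\<close>.\<close>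

definition fg_projective :: "('r, 'c) ring_scheme \<Rightarrow> ('r, 'm, 'd) module_scheme \<Rightarrow> bool"
  where "fg_projective R M \<longleftrightarrow>
    (\<exists>k P Q. submodule P R (free_module R k) \<and> submodule Q R (free_module R k)
      \<and> P \<inter> Q = {\<zero>\<^bsub>free_module R k\<^esub>}
      \<and> P <+>\<^bsub>free_module R k\<^esub> Q = carrier (free_module R k)
      \<and> module_isomorphic R M ((free_module R k)\<lparr>carrier := P\<rparr>))"

text \<open>
  A \<open>k \<times> k\<close> matrix acts on row vectors from the right, so that it is a homomorphism of left modules.
\<close>

definition row_times_matrix ::
    "('r, 'c) ring_scheme \<Rightarrow> nat \<Rightarrow> (nat \<Rightarrow> nat \<Rightarrow> 'r) \<Rightarrow> (nat \<Rightarrow> 'r) \<Rightarrow> (nat \<Rightarrow> 'r)"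
  where "row_times_matrix R k A x = (\<lambda>j\<in>{..<k}. \<Oplus>\<^bsub>R\<^esub>i\<in>{..<k}. x i \<otimes>\<^bsub>R\<^esub> A i j)"

definition idempotent_matrix :: "('r, 'c) ring_scheme \<Rightarrow> nat \<Rightarrow> (nat \<Rightarrow> nat \<Rightarrow> 'r) \<Rightarrow> bool"
  where "idempotent_matrix R k A \<longleftrightarrow>
    (\<forall>i<k. \<forall>j<k. A i j \<in> carrier R) \<and>
    (\<forall>i<k. \<forall>j<k. (\<Oplus>\<^bsub>R\<^esub>l\<in>{..<k}. A i l \<otimes>\<^bsub>R\<^esub> A l j) = A i j)"

definition matrix_image_module ::
    "('r, 'c) ring_scheme \<Rightarrow> nat \<Rightarrow> (nat \<Rightarrow> nat \<Rightarrow> 'r) \<Rightarrow> ('r, nat \<Rightarrow> 'r) module"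
  where "matrix_image_module R k A =
    (free_module R k)\<lparr>carrier := row_times_matrix R k A ` carrier (free_module R k)\<rparr>"


section \<open>The group von Neumann algebra\<close>

definition ell2 :: "('g, 'x) monoid_scheme \<Rightarrow> ('g \<Rightarrow> complex) set"
  where "ell2 G = {f. (\<forall>x. x \<notin> carrier G \<longrightarrow> f x = 0) \<and> (\<lambda>x. (cmod (f x))\<^sup>2) summable_on carrier G}"

definition ell2_inner :: "('g, 'x) monoid_scheme \<Rightarrow> ('g \<Rightarrow> complex) \<Rightarrow> ('g \<Rightarrow> complex) \<Rightarrow> complex"
  where "ell2_inner G f h = (\<Sum>\<^sub>\<infinity>x\<in>carrier G. f x * cnj (h x))"

definition ell2_norm :: "('g, 'x) monoid_scheme \<Rightarrow> ('g \<Rightarrow> complex) \<Rightarrow> real"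
  where "ell2_norm G f = sqrt (\<Sum>\<^sub>\<infinity>x\<in>carrier G. (cmod (f x))\<^sup>2)"

definition left_translation :: "('g, 'x) monoid_scheme \<Rightarrow> 'g \<Rightarrow> ('g \<Rightarrow> complex) \<Rightarrow> ('g \<Rightarrow> complex)"
  where "left_translation G g f =
    (\<lambda>x. if x \<in> carrier G then f (inv\<^bsub>G\<^esub> g \<otimes>\<^bsub>G\<^esub> x) else 0)"

definition right_translation :: "('g, 'x) monoid_scheme \<Rightarrow> 'g \<Rightarrow> ('g \<Rightarrow> complex) \<Rightarrow> ('g \<Rightarrow> complex)"
  where "right_translation G g f =
    (\<lambda>x. if x \<in> carrier G then f (x \<otimes>\<^bsub>G\<^esub> g) else 0)"

text \<open>
  Operators on \<open>\<ell>\<^sup>2\<close> are functions that are \<open>undefined\<close> outside \<open>ell2 G\<close>, so that equality of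
  operators is equality on \<open>ell2 G\<close>.
\<close>

definition bounded_operators :: "('g, 'x) monoid_scheme \<Rightarrow> (('g \<Rightarrow> complex) \<Rightarrow> ('g \<Rightarrow> complex)) set"
  where "bounded_operators G =
    {T \<in> ell2 G \<rightarrow>\<^sub>E ell2 G.
      (\<forall>f\<in>ell2 G. \<forall>h\<in>ell2 G. T (\<lambda>x. f x + h x) = (\<lambda>x. T f x + T h x))
      \<and> (\<forall>c. \<forall>f\<in>ell2 G. T (\<lambda>x. c * f x) = (\<lambda>x. c * T f x))
      \<and> (\<exists>C. \<forall>f\<in>ell2 G. ell2_norm G (T f) \<le> C * ell2_norm G f)}"

text \<open>
  The group von Neumann algebra consists of the bounded operators on \<open>\<ell>\<^sup>2\<close> that are equivariant for
  one of the two regular representations.  Equivariance for the right one is required here,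
  so that the left translations belong to the algebra.
\<close>

definition group_vN_algebra ::
    "('g, 'x) monoid_scheme \<Rightarrow> (('g \<Rightarrow> complex) \<Rightarrow> ('g \<Rightarrow> complex)) ring"
  where "group_vN_algebra G =
    \<lparr>carrier = {T \<in> bounded_operators G. \<forall>g\<in>carrier G. \<forall>f\<in>ell2 G.
        T (right_translation G g f) = right_translation G g (T f)},
     mult = compose (ell2 G),
     one = (\<lambda>f\<in>ell2 G. f),
     zero = (\<lambda>f\<in>ell2 G. \<lambda>x. 0),
     add = (\<lambda>S T. \<lambda>f\<in>ell2 G. \<lambda>x. S f x + T f x)\<rparr>"

definition group_element_operator ::
    "('g, 'x) monoid_scheme \<Rightarrow> 'g \<Rightarrow> (('g \<Rightarrow> complex) \<Rightarrow> ('g \<Rightarrow> complex))"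
  where "group_element_operator G g = (\<lambda>f\<in>ell2 G. left_translation G g f)"

definition canonical_trace ::
    "('g, 'x) monoid_scheme \<Rightarrow> (('g \<Rightarrow> complex) \<Rightarrow> ('g \<Rightarrow> complex)) \<Rightarrow> complex"
  where "canonical_trace G T =
    (let \<delta> = (\<lambda>x. if x = \<one>\<^bsub>G\<^esub> then 1 else 0) in ell2_inner G (T \<delta>) \<delta>)"


section \<open>Lueck's dimension function\<close>

text \<open>
  The dimension of a finitely generated projective module is the trace of any idempotent matrix
  whose image is isomorphic to it; the trace of an idempotent matrix is a nonnegative real that
  depends only on the isomorphism class of the image.
\<close>

definition vN_dim_projective ::
    "('g, 'x) monoid_scheme \<Rightarrow> (('g \<Rightarrow> complex) \<Rightarrow> ('g \<Rightarrow> complex), 'm, 'd) module_scheme \<Rightarrow> real"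
  where "vN_dim_projective G P =
    (THE d. \<exists>k A. idempotent_matrix (group_vN_algebra G) k A
      \<and> module_isomorphic (group_vN_algebra G) P (matrix_image_module (group_vN_algebra G) k A)
      \<and> d = Re (\<Sum>i<k. canonical_trace G (A i i)))"

definition vN_dim ::
    "('g, 'x) monoid_scheme \<Rightarrow> (('g \<Rightarrow> complex) \<Rightarrow> ('g \<Rightarrow> complex), 'm, 'd) module_scheme \<Rightarrow> ereal"
  where "vN_dim G M =
    (SUP P \<in> {P. submodule P (group_vN_algebra G) M
                \<and> fg_projective (group_vN_algebra G) (M\<lparr>carrier := P\<rparr>)}.
      ereal (vN_dim_projective G (M\<lparr>carrier := P\<rparr>)))"


section \<open>Group homology by the bar complex\<close>

text \<open>
  For a right \<open>G\<close>-action \<open>act\<close> by endomorphisms on a left \<open>R\<close>-module \<open>M\<close>, this is the complex of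
  left \<open>R\<close>-modules \<open>M \<otimes>\<^bsub>\<int>G\<^esub> B\<^sub>n\<close> with \<open>B\<^sub>n\<close> the bar resolution.  The chain \<open>m \<otimes> [g\<^sub>1|\<dots>|g\<^sub>n]\<close> is
  represented by the function with value \<open>m\<close> at the list \<open>[g\<^sub>1, \<dots>, g\<^sub>n]\<close> and zero elsewhere.
\<close>

definition bar_chains ::
    "('g, 'x) monoid_scheme \<Rightarrow> ('r, 'm, 'd) module_scheme \<Rightarrow> nat \<Rightarrow> ('r, 'g list \<Rightarrow> 'm) module"
  where "bar_chains G M n =
    \<lparr>carrier = {c. (\<forall>s. c s \<in> carrier M)
        \<and> (\<forall>s. c s \<noteq> \<zero>\<^bsub>M\<^esub> \<longrightarrow> length s = n \<and> set s \<subseteq> carrier G)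
        \<and> finite {s. c s \<noteq> \<zero>\<^bsub>M\<^esub>}},
     mult = undefined, one = undefined,
     zero = (\<lambda>s. \<zero>\<^bsub>M\<^esub>),
     add = (\<lambda>c d s. c s \<oplus>\<^bsub>M\<^esub> d s),
     module.smult = (\<lambda>a c s. a \<odot>\<^bsub>M\<^esub> c s)\<rparr>"

definition bar_face :: "('g, 'x) monoid_scheme \<Rightarrow> nat \<Rightarrow> 'g list \<Rightarrow> 'g list"
  where "bar_face G j s =
    (if j = 0 then tl s
     else if j = length s then butlast s
     else take (j - 1) s @ (s ! (j - 1) \<otimes>\<^bsub>G\<^esub> s ! j) # drop (j + 1) s)"

text \<open>
  \<open>\<partial>(m[g\<^sub>1|\<dots>|g\<^sub>n]) = m g\<^sub>1[g\<^sub>2|\<dots>|g\<^sub>n]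
     + (\<Sum>0<j<n. (-1)\<^sup>j m[g\<^sub>1|\<dots>|g\<^sub>j g\<^sub>j\<^sub>+\<^sub>1|\<dots>|g\<^sub>n]) + (-1)\<^sup>n m[g\<^sub>1|\<dots>|g\<^sub>n\<^sub>-\<^sub>1]\<close> for \<open>n \<ge> 1\<close>.
\<close>

definition bar_boundary ::
    "('g, 'x) monoid_scheme \<Rightarrow> ('r, 'm, 'd) module_scheme \<Rightarrow> ('m \<Rightarrow> 'g \<Rightarrow> 'm) \<Rightarrow> nat
      \<Rightarrow> ('g list \<Rightarrow> 'm) \<Rightarrow> ('g list \<Rightarrow> 'm)"
  where "bar_boundary G M act n c =
    (\<lambda>t. \<Oplus>\<^bsub>M\<^esub>s\<in>{s. c s \<noteq> \<zero>\<^bsub>M\<^esub>}. \<Oplus>\<^bsub>M\<^esub>j\<in>{0..n}.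
       (if bar_face G j s = t
        then (let m = (if j = 0 then act (c s) (hd s) else c s)
              in if even j then m else \<ominus>\<^bsub>M\<^esub> m)
        else \<zero>\<^bsub>M\<^esub>))"

definition bar_cycles ::
    "('g, 'x) monoid_scheme \<Rightarrow> ('r, 'm, 'd) module_scheme \<Rightarrow> ('m \<Rightarrow> 'g \<Rightarrow> 'm) \<Rightarrow> nat
      \<Rightarrow> ('g list \<Rightarrow> 'm) set"
  where "bar_cycles G M act n =
    {c \<in> carrier (bar_chains G M n). n = 0 \<or> bar_boundary G M act n c = (\<lambda>t. \<zero>\<^bsub>M\<^esub>)}"

definition bar_boundaries ::
    "('g, 'x) monoid_scheme \<Rightarrow> ('r, 'm, 'd) module_scheme \<Rightarrow> ('m \<Rightarrow> 'g \<Rightarrow> 'm) \<Rightarrow> nat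
      \<Rightarrow> ('g list \<Rightarrow> 'm) set"
  where "bar_boundaries G M act n =
    bar_boundary G M act (Suc n) ` carrier (bar_chains G M (Suc n))"

definition group_homology ::
    "('g, 'x) monoid_scheme \<Rightarrow> ('r, 'm, 'd) module_scheme \<Rightarrow> ('m \<Rightarrow> 'g \<Rightarrow> 'm) \<Rightarrow> nat
      \<Rightarrow> ('r, ('g list \<Rightarrow> 'm) set) module"
  where "group_homology G M act n =
    quotient_module ((bar_chains G M n)\<lparr>carrier := bar_cycles G M act n\<rparr>)
      (bar_boundaries G M act n)"


section \<open>The \<open>L\<^sup>2\<close>-Betti numbers and the special linear group\<close>

definition l2_betti :: "('g, 'x) monoid_scheme \<Rightarrow> nat \<Rightarrow> ereal"
  where "l2_betti G i =
    vN_dim G (group_homology G (regular_module (group_vN_algebra G))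
      (\<lambda>T g. T \<otimes>\<^bsub>group_vN_algebra G\<^esub> group_element_operator G g) i)"

definition SL :: "nat \<Rightarrow> 'a::comm_ring_1 mat monoid"
  where "SL n = \<lparr>carrier = {A \<in> carrier_mat n n. det A = 1}, mult = (*), one = 1\<^sub>m n\<rparr>"

end

theory Submission
  imports
    Defs
    "HOL-Analysis.Inner_Product"
    "HOL-Library.Poly_Mapping"
begin

text \<open>
  Let \<open>L\<close> be the von Neumann algebra of a group \<open>G\<close> and \<open>\<delta>\<close> the unit vector at the identity.  Call a left
  \<open>L\<close>-module torsion if each of its elements is killed by contractions \<open>a \<in> L\<close> with \<open>\<parallel>a \<delta> - \<delta>\<parallel>\<close>
  arbitrarily small.  Torsion modules are closed under extensions, and a torsion module contains no
  nonzero submodule of a free module, so its dimension is \<open>0\<close>.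

  The Ore condition that makes this work is: for \<open>T, Y \<in> L\<close> with \<open>Y\<close> a contraction there are
  \<open>a, b \<in> L\<close> with \<open>a T = b Y\<close>, where \<open>a\<close> is a contraction about as close to \<open>1\<close> as \<open>Y\<close> is.  If the centre
  of a subgroup \<open>S\<close> is infinite, every \<open>L\<close>-valued cycle \<open>c\<close> of \<open>S\<close> is homologous to \<open>c w\<close> for each average
  \<open>w\<close> of central elements; as \<open>1 - w\<close> comes close to \<open>1\<close>, the Ore condition shows that the homology of
  \<open>S\<close> with coefficients in \<open>L\<close> is torsion.

  \<open>SL\<^sub>n(R)\<close> acts on the nonzero vectors of \<open>R\<^sup>n\<close>.  The stabiliser of at most \<open>n - 1\<close> such vectors has an
  infinite abelian normal subgroup of unipotent matrices.  Resolving a point by tuples of vectors,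
  and each tuple by tuples of cosets of its unipotent subgroup, leaves only stabilisers that are
  infinite and abelian, in all degrees up to \<open>n - 2\<close>.
\<close>

section \<open>Unipotent subgroups of the special linear group\<close>

text \<open>Every statement about homology holds only up to operators in \<open>near G e\<close>.
  They are contractions, so errors add under composition and each stage may cost a further factor.

  Central elements of a stabiliser act on the coefficients from the right, while the Ore condition
  multiplies from the left and a centre of a subgroup need not commute with the algebra. The two
  sides meet at \<delta>, where left and right averages agree, and operators of the algebra commute
  with right averages.

  A stabiliser of vectors may have a finite centre although its unipotent normal subgroup is
  infinite; fixing also a coset of that subgroup cuts the stabiliser down to it.

  The bound \<open>n - 2\<close> is linear algebra: degrees up to \<open>m\<close> involve tuples of
  up to \<open>m + 1\<close> vectors, and a nonzero functional vanishing on a tuple is certain only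
  for fewer than \<open>n\<close> vectors.\<close>

definition SL_X :: "nat \<Rightarrow> 'a::idom vec set" where "SL_X n = {v \<in> carrier_vec n. v \<noteq> 0\<^sub>v n}"

text \<open>Vectors act as functionals through the dot product. Over a domain the common kernel of
  these functionals is the saturation of the span of \<open>xs\<close>.\<close>

definition perp :: "nat \<Rightarrow> 'a::idom vec list \<Rightarrow> 'a vec set" where
  "perp n xs = {\<phi> \<in> carrier_vec n. \<forall>x\<in>set xs. \<phi> \<bullet> x = 0}"

text \<open>The matrices that are the identity on the span of \<open>xs\<close> and modulo the saturation of this span.\<close>

definition SL_U :: "nat \<Rightarrow> 'a::idom vec list \<Rightarrow> 'a mat set" where
  "SL_U n xs = {g \<in> carrier (SL n). (\<forall>x\<in>set xs. g *\<^sub>v x = x)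
     \<and> (\<forall>\<phi>\<in>perp n xs. \<forall>v\<in>carrier_vec n. \<phi> \<bullet> (g *\<^sub>v v) = \<phi> \<bullet> v)}"

lemma SL_simps: "carrier (SL n) = {A \<in> carrier_mat n n. det A = 1}" "mult (SL n) = (*)" "one (SL n) = 1\<^sub>m n"
  by (simp_all add: SL_def)

lemma SL_group: "group (SL n :: 'a::idom mat monoid)"
proof (rule groupI)
  fix x y z :: "'a mat"
  assume x: "x \<in> carrier (SL n)" and y: "y \<in> carrier (SL n)" and z: "z \<in> carrier (SL n)"
  show "x \<otimes>\<^bsub>SL n\<^esub> y \<in> carrier (SL n)" using x y det_mult[of x n y] mult_carrier_mat[of x n n y n] by (simp add: SL_simps)
  show "x \<otimes>\<^bsub>SL n\<^esub> y \<otimes>\<^bsub>SL n\<^esub> z = x \<otimes>\<^bsub>SL n\<^esub> (y \<otimes>\<^bsub>SL n\<^esub> z)"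
    using x y z by (simp add: SL_simps assoc_mult_mat[of _ n n _ n _ n])
next
  fix x :: "'a mat" assume x: "x \<in> carrier (SL n)"
  then have xc: "x \<in> carrier_mat n n" "det x = 1" by (simp_all add: SL_simps)
  have a: "adj_mat x \<in> carrier_mat n n" "adj_mat x * x = 1\<^sub>m n"
    using adj_mat[OF xc(1)] xc(2) by auto
  have "det (adj_mat x * x) = det (adj_mat x) * det x" by (rule det_mult[OF a(1) xc(1)])
  then have "det (adj_mat x) = 1" using a xc by simp
  then show "\<exists>y\<in>carrier (SL n). y \<otimes>\<^bsub>SL n\<^esub> x = \<one>\<^bsub>SL n\<^esub>"
    using a by (auto simp: SL_simps)
  show "\<one>\<^bsub>SL n\<^esub> \<otimes>\<^bsub>SL n\<^esub> x = x" using xc by (simp add: SL_simps)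
qed (simp add: SL_simps)

lemma SL_carrier: "g \<in> carrier (SL n) \<Longrightarrow> g \<in> carrier_mat n n" by (simp add: SL_simps)

lemma SL_act_mult: "g \<in> carrier (SL n) \<Longrightarrow> h \<in> carrier (SL n) \<Longrightarrow> v \<in> carrier_vec n \<Longrightarrow>
    (g \<otimes>\<^bsub>SL n\<^esub> h) *\<^sub>v v = g *\<^sub>v (h *\<^sub>v v)"
  by (auto simp: SL_simps intro: assoc_mult_mat_vec)

lemma SL_act_inv:
  fixes g :: "'a::idom mat"
  assumes "g \<in> carrier (SL n)" "v \<in> carrier_vec n"
  shows "inv\<^bsub>SL n\<^esub> g *\<^sub>v (g *\<^sub>v v) = v" "g *\<^sub>v (inv\<^bsub>SL n\<^esub> g *\<^sub>v v) = v"
proof -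
  interpret group "SL n :: 'a mat monoid" by (rule SL_group)
  have "inv\<^bsub>SL n\<^esub> g \<otimes>\<^bsub>SL n\<^esub> g = 1\<^sub>m n" "g \<otimes>\<^bsub>SL n\<^esub> inv\<^bsub>SL n\<^esub> g = 1\<^sub>m n"
    using assms(1) l_inv[OF assms(1)] r_inv[OF assms(1)] by (simp_all add: SL_simps)
  then show "inv\<^bsub>SL n\<^esub> g *\<^sub>v (g *\<^sub>v v) = v" "g *\<^sub>v (inv\<^bsub>SL n\<^esub> g *\<^sub>v v) = v"
    using assms SL_act_mult[of "inv\<^bsub>SL n\<^esub> g" n g v] SL_act_mult[of g n "inv\<^bsub>SL n\<^esub> g" v] by simp_all
qed

lemma SL_act_closed:
  fixes g :: "'a::idom mat"
  shows "g \<in> carrier (SL n) \<Longrightarrow> v \<in> SL_X n \<Longrightarrow> g *\<^sub>v v \<in> SL_X n"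
proof -
  assume g: "g \<in> carrier (SL n)" and v: "v \<in> SL_X n"
  interpret group "SL n :: 'a mat monoid" by (rule SL_group)
  have "g *\<^sub>v v \<noteq> 0\<^sub>v n"
  proof
    assume "g *\<^sub>v v = 0\<^sub>v n"
    then have "v = inv\<^bsub>SL n\<^esub> g *\<^sub>v 0\<^sub>v n" using SL_act_inv(1)[OF g, of v] v by (simp add: SL_X_def)
    also have "\<dots> = 0\<^sub>v n" using SL_carrier[OF inv_closed[OF g]] by auto
    finally show False using v by (simp add: SL_X_def)
  qed
  then show ?thesis using SL_carrier[OF g] v by (auto simp: SL_X_def)
qed

lemma SL_U_subgroup: assumes "set xs \<subseteq> carrier_vec n" shows "subgroup (SL_U n xs) (SL n :: 'a::idom mat monoid)"
proof -
  interpret group "SL n :: 'a mat monoid" by (rule SL_group)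
  have mv: "g *\<^sub>v v \<in> carrier_vec n" if "g \<in> carrier (SL n)" "v \<in> carrier_vec n" for g :: "'a mat" and v
    using SL_carrier[OF that(1)] that(2) by simp
  show ?thesis
  proof (rule subgroupI)
    show "SL_U n xs \<subseteq> carrier (SL n)" by (auto simp: SL_U_def)
    have "1\<^sub>m n \<in> SL_U n xs" using assms by (auto simp: SL_U_def SL_simps subset_iff)
    then show "SL_U n xs \<noteq> {}" by blast
  next
    fix g assume "g \<in> SL_U n xs"
    then have g: "g \<in> carrier (SL n)" "\<And>x. x \<in> set xs \<Longrightarrow> g *\<^sub>v x = x"
      "\<And>\<phi> v. \<phi> \<in> perp n xs \<Longrightarrow> v \<in> carrier_vec n \<Longrightarrow> \<phi> \<bullet> (g *\<^sub>v v) = \<phi> \<bullet> v"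
      by (auto simp: SL_U_def)
    have "inv\<^bsub>SL n\<^esub> g *\<^sub>v x = x" if "x \<in> set xs" for x
      using SL_act_inv(1)[OF g(1), of x] g(2)[OF that] that assms by auto
    moreover have "\<phi> \<bullet> (inv\<^bsub>SL n\<^esub> g *\<^sub>v v) = \<phi> \<bullet> v" if "\<phi> \<in> perp n xs" "v \<in> carrier_vec n" for \<phi> v
      using g(3)[OF that(1) mv[OF inv_closed[OF g(1)] that(2)]] SL_act_inv(2)[OF g(1) that(2)] by simp
    ultimately show "inv\<^bsub>SL n\<^esub> g \<in> SL_U n xs" using g(1) by (auto simp: SL_U_def)
  next
    fix g h assume g: "g \<in> SL_U n xs" and h: "h \<in> SL_U n xs"
    then have gh: "g \<in> carrier (SL n)" "h \<in> carrier (SL n)" by (auto simp: SL_U_def)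
    show "g \<otimes>\<^bsub>SL n\<^esub> h \<in> SL_U n xs"
      using g h gh assms mv[OF gh(2)] SL_act_mult[OF gh] by (auto simp: SL_U_def subset_iff)
  qed
qed

text \<open>The transpose of \<open>g\<close> carries functionals vanishing on the translated tuple
  to functionals vanishing on \<open>xs\<close>. For \<open>g\<close> fixing \<open>xs\<close>
  entrywise this is normality in the stabiliser.\<close>

lemma SL_U_conj:
  assumes g: "g \<in> carrier (SL n)" and xs: "set xs \<subseteq> carrier_vec n" and u: "u \<in> SL_U n xs"
  shows "g \<otimes>\<^bsub>SL n\<^esub> u \<otimes>\<^bsub>SL n\<^esub> inv\<^bsub>SL n\<^esub> g \<in> SL_U n (map (\<lambda>x. g *\<^sub>v x) xs)"
proof -
  interpret group "SL n :: 'a mat monoid" by (rule SL_group)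
  have uc: "u \<in> carrier (SL n)" using u by (auto simp: SL_U_def)
  have mv: "g *\<^sub>v v \<in> carrier_vec n" if "g \<in> carrier (SL n)" "v \<in> carrier_vec n" for g :: "'a mat" and v
    using SL_carrier[OF that(1)] that(2) by simp
  have act: "(g \<otimes>\<^bsub>SL n\<^esub> u \<otimes>\<^bsub>SL n\<^esub> inv\<^bsub>SL n\<^esub> g) *\<^sub>v v = g *\<^sub>v (u *\<^sub>v (inv\<^bsub>SL n\<^esub> g *\<^sub>v v))"
    if "v \<in> carrier_vec n" for v
    using that g uc by (simp add: SL_act_mult mv)
  have 1: "(g \<otimes>\<^bsub>SL n\<^esub> u \<otimes>\<^bsub>SL n\<^esub> inv\<^bsub>SL n\<^esub> g) *\<^sub>v (g *\<^sub>v x) = g *\<^sub>v x" if "x \<in> set xs" for x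
    using that xs u mv[OF g] by (subst act) (auto simp: SL_act_inv[OF g] SL_U_def)
  have 2: "\<phi> \<bullet> ((g \<otimes>\<^bsub>SL n\<^esub> u \<otimes>\<^bsub>SL n\<^esub> inv\<^bsub>SL n\<^esub> g) *\<^sub>v v) = \<phi> \<bullet> v"
    if p: "\<phi> \<in> perp n (map (\<lambda>x. g *\<^sub>v x) xs)" and v: "v \<in> carrier_vec n" for \<phi> v
  proof -
    let ?\<psi> = "transpose_mat g *\<^sub>v \<phi>"
    have pc: "\<phi> \<in> carrier_vec n" using p by (simp add: perp_def)
    have t: "?\<psi> \<bullet> w = \<phi> \<bullet> (g *\<^sub>v w)" if "w \<in> carrier_vec n" for w
      by (rule transpose_vec_mult_scalar[OF SL_carrier[OF g] that pc])
    have "?\<psi> \<in> perp n xs"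
      using p xs t SL_carrier[OF g] pc by (auto simp: perp_def subset_iff)
    then have "?\<psi> \<bullet> (u *\<^sub>v (inv\<^bsub>SL n\<^esub> g *\<^sub>v v)) = ?\<psi> \<bullet> (inv\<^bsub>SL n\<^esub> g *\<^sub>v v)"
      using u mv[OF inv_closed[OF g] v] by (auto simp: SL_U_def)
    then show ?thesis
      using v g uc mv by (simp add: act t SL_act_inv[OF g])
  qed
  show ?thesis using 1 2 g uc by (auto simp: SL_U_def)
qed

text \<open>\<open>(g - 1) (h - 1) = 0\<close>: the rows of \<open>g - 1\<close> annihilate
  \<open>xs\<close>, and \<open>h\<close> preserves the values of such functionals. Hence
  \<open>g h = g + h - 1\<close>, which is symmetric.\<close>

lemma SL_U_comm:
  assumes xs: "set xs \<subseteq> carrier_vec n" and g: "g \<in> SL_U n xs" and h: "h \<in> SL_U n xs"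
  shows "g \<otimes>\<^bsub>SL n\<^esub> h = h \<otimes>\<^bsub>SL n\<^esub> g"
proof -
  have key: "g * h = g + h - 1\<^sub>m n" if g: "g \<in> SL_U n xs" and h: "h \<in> SL_U n xs" for g h
  proof (rule eq_matI)
    have gc: "g \<in> carrier_mat n n" and hc: "h \<in> carrier_mat n n" using g h by (auto simp: SL_U_def SL_simps)
    show "dim_row (g * h) = dim_row (g + h - 1\<^sub>m n)" "dim_col (g * h) = dim_col (g + h - 1\<^sub>m n)"
      using gc hc by auto
    fix i j assume "i < dim_row (g + h - 1\<^sub>m n)" "j < dim_col (g + h - 1\<^sub>m n)"
    then have i: "i < n" and j: "j < n" using gc hc by auto
    let ?\<phi> = "row g i - unit_vec n i"
    have r: "row g i \<in> carrier_vec n" using gc i by auto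
    have "?\<phi> \<bullet> x = 0" if x: "x \<in> set xs" for x
    proof -
      have xc: "x \<in> carrier_vec n" using x xs by auto
      have "row g i \<bullet> x = (g *\<^sub>v x) $ i" using gc i by simp
      also have "\<dots> = x $ i" using g x by (simp add: SL_U_def)
      finally show ?thesis using xc i r by (simp add: minus_scalar_prod_distrib[of _ n])
    qed
    then have p: "?\<phi> \<in> perp n xs" using r by (simp add: perp_def)
    have cj: "h *\<^sub>v unit_vec n j = col h j" using hc j by (auto intro!: eq_vecI)
    have colc: "col h j \<in> carrier_vec n" using hc by auto
    have "?\<phi> \<bullet> col h j = ?\<phi> \<bullet> unit_vec n j"
    proof -
      have "?\<phi> \<bullet> (h *\<^sub>v unit_vec n j) = ?\<phi> \<bullet> unit_vec n j"
        using h p unit_vec_carrier[of n j] unfolding SL_U_def by blast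
      then show ?thesis by (simp only: cj)
    qed
    then have "row g i \<bullet> col h j - h $$ (i, j) = g $$ (i, j) - unit_vec n i $ j"
      using i j r colc gc hc by (simp add: minus_scalar_prod_distrib[of _ n])
    then show "(g * h) $$ (i, j) = (g + h - 1\<^sub>m n) $$ (i, j)"
      using i j gc hc by (auto simp: algebra_simps)
  qed
  have "g \<in> carrier_mat n n" "h \<in> carrier_mat n n" using g h by (auto simp: SL_U_def SL_simps)
  then show ?thesis unfolding SL_simps key[OF g h] key[OF h g] by (simp add: comm_add_mat[of g n n h])
qed

text \<open>Matrix determinant lemma without division: the block matrix with rows
  \<open>1, -W\<close> and \<open>F, 1\<close> is factored into block triangular matrices in two
  ways.\<close>

lemma det_one_plus_rank_one:
  fixes w \<phi> :: "'a::idom vec"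
  assumes w: "w \<in> carrier_vec n" and p: "\<phi> \<in> carrier_vec n"
  shows "det (1\<^sub>m n + mat n n (\<lambda>(i, j). w $ i * \<phi> $ j)) = 1 + \<phi> \<bullet> w"
proof -
  define W where "W = mat n 1 (\<lambda>(i, j). w $ i)"
  define F where "F = mat 1 n (\<lambda>(i, j). \<phi> $ j)"
  define D where "D = mat 1 1 (\<lambda>_. 1 + \<phi> \<bullet> w)"
  have c: "W \<in> carrier_mat n 1" "F \<in> carrier_mat 1 n" "D \<in> carrier_mat 1 1" "- W \<in> carrier_mat n 1"
    by (auto simp: W_def F_def D_def)
  have WF: "W * F = mat n n (\<lambda>(i, j). w $ i * \<phi> $ j)"
    by (rule eq_matI) (auto simp: W_def F_def scalar_prod_def)
  have FW: "F * (- W) + D = 1\<^sub>m 1"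
    using w p by (auto intro!: eq_matI simp: W_def F_def D_def scalar_prod_def sum_negf)
  let ?A = "four_block_mat (1\<^sub>m n + W * F) (- W) (0\<^sub>m 1 n) (1\<^sub>m 1)"
  let ?B = "four_block_mat (1\<^sub>m n) (0\<^sub>m n 1) F (1\<^sub>m 1)"
  let ?C = "four_block_mat (1\<^sub>m n) (- W) (0\<^sub>m 1 n) D"
  have WFc: "W * F \<in> carrier_mat n n" using c by simp
  have "?A * ?B = four_block_mat (1\<^sub>m n) (- W) F (1\<^sub>m 1)"
  proof -
    have "(1\<^sub>m n + W * F) * 1\<^sub>m n + (- W) * F = 1\<^sub>m n" using c WFc by (auto intro!: eq_matI simp: scalar_prod_def)
    then show ?thesis using c WFc by (subst mult_four_block_mat[of _ n n _ 1 _ 1]) auto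
  qed
  moreover have "?B * ?C = four_block_mat (1\<^sub>m n) (- W) F (1\<^sub>m 1)"
    using c FW by (subst mult_four_block_mat[of _ n n _ 1 _ 1]) auto
  ultimately have "det (?A * ?B) = det (?B * ?C)" by simp
  moreover have "?A \<in> carrier_mat (n + 1) (n + 1)" "?B \<in> carrier_mat (n + 1) (n + 1)" "?C \<in> carrier_mat (n + 1) (n + 1)"
    using c WFc by auto
  ultimately have "det ?A * det ?B = det ?B * det ?C" using det_mult by metis
  moreover have "det ?B = 1"
    using c by (subst det_four_block_mat_upper_right_zero[of _ n _ 1]) auto
  moreover have "det ?A = det (1\<^sub>m n + W * F)"
    using c WFc by (subst det_four_block_mat_lower_left_zero[of _ n _ 1]) auto
  moreover have "det ?C = det D"
    using c by (subst det_four_block_mat_lower_left_zero[of _ n _ 1]) auto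
  moreover have "det D = 1 + \<phi> \<bullet> w" by (simp add: D_def det_single)
  ultimately show ?thesis by (simp add: WF)
qed

text \<open>Padded by zero rows to a square matrix, the vectors leave the last row zero because
  \<open>length xs < n\<close>. The matrix is singular, hence has a nonzero kernel vector even over
  a domain.\<close>

lemma perp_nonzero:
  fixes xs :: "'a::idom vec list"
  assumes "length xs < n" and xs: "set xs \<subseteq> carrier_vec n"
  obtains \<phi> where "\<phi> \<in> perp n xs" "\<phi> \<noteq> 0\<^sub>v n"
proof -
  define M where "M = mat n n (\<lambda>(i, j). if i < length xs then xs ! i $ j else 0)"
  have M: "M \<in> carrier_mat n n" by (simp add: M_def)
  have n: "n - 1 < n" using assms by simp
  have "transpose_mat M *\<^sub>v unit_vec n (n - 1) = 0\<^sub>v n"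
  proof (rule eq_vecI)
    fix i assume "i < dim_vec (0\<^sub>v n)"
    then show "(transpose_mat M *\<^sub>v unit_vec n (n - 1)) $ i = 0\<^sub>v n $ i"
      using n assms M by (simp add: M_def)
  qed (use M in simp)
  moreover have "unit_vec n (n - 1) \<noteq> (0\<^sub>v n :: 'a vec)"
    using n by (metis index_unit_vec(1) index_zero_vec(1) zero_neq_one)
  ultimately have "det (transpose_mat M) = 0"
    using det_0_iff_vec_prod_zero[of "transpose_mat M" n] M by (meson transpose_carrier_mat unit_vec_carrier)
  then have "det M = 0" using det_transpose[OF M] by simp
  then obtain v where v: "v \<in> carrier_vec n" "v \<noteq> 0\<^sub>v n" "M *\<^sub>v v = 0\<^sub>v n"
    using det_0_iff_vec_prod_zero[OF M] by blast
  show ?thesis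
  proof (rule that)
    have "v \<bullet> x = 0" if x: "x \<in> set xs" for x
    proof -
      obtain i where i: "i < length xs" "x = xs ! i" using x by (auto simp: in_set_conv_nth)
      have xc: "x \<in> carrier_vec n" using x xs by auto
      have "row M i = x" using i xc assms by (auto simp: M_def)
      moreover have "(M *\<^sub>v v) $ i = row M i \<bullet> v" using i assms M by simp
      ultimately have "x \<bullet> v = 0" using v i assms by simp
      then show ?thesis using comm_scalar_prod[OF xc v(1)] by simp
    qed
    then show "v \<in> perp n xs" using v by (simp add: perp_def)
    show "v \<noteq> 0\<^sub>v n" by (rule v)
  qed
qed

text \<open>The transvections \<open>1 + r w \<phi>^T\<close> with \<open>w\<close> in
  \<open>xs\<close> and \<open>\<phi>\<close> in \<open>perp n xs\<close>: they move vectors only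
  along \<open>w\<close>, and their determinant is 1 because \<open>\<phi>\<close> kills
  \<open>w\<close>. An entry where \<open>w \<phi>^T\<close> is nonzero recovers
  \<open>r\<close>.\<close>

lemma SL_U_infinite:
  fixes xs :: "'a::idom vec list"
  assumes inf: "infinite (UNIV :: 'a set)" and xs: "set xs \<subseteq> SL_X n" "1 \<le> length xs" "length xs < n"
  shows "infinite (SL_U n xs)"
proof -
  have xc: "set xs \<subseteq> carrier_vec n" using xs by (auto simp: SL_X_def)
  obtain \<phi> where p: "\<phi> \<in> perp n xs" "\<phi> \<noteq> 0\<^sub>v n" using perp_nonzero[OF xs(3) xc] by blast
  have pc: "\<phi> \<in> carrier_vec n" using p by (simp add: perp_def)
  obtain w where w: "w \<in> set xs" using xs(2) by (cases xs) auto
  have wc: "w \<in> carrier_vec n" "w \<noteq> 0\<^sub>v n" using w xs by (auto simp: SL_X_def)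
  obtain a b where ab: "a < n" "w $ a \<noteq> 0" "b < n" "\<phi> $ b \<noteq> 0"
    using wc p(2) pc by (metis carrier_vecD eq_vecI index_zero_vec)
  define N where "N r = 1\<^sub>m n + mat n n (\<lambda>(i, j). (r \<cdot>\<^sub>v w) $ i * \<phi> $ j)" for r
  have Nc: "N r \<in> carrier_mat n n" for r by (simp add: N_def)
  have Nv: "N r *\<^sub>v v = v + (r * (\<phi> \<bullet> v)) \<cdot>\<^sub>v w" if v: "v \<in> carrier_vec n" for r v
  proof (rule eq_vecI)
    fix i assume "i < dim_vec (v + (r * (\<phi> \<bullet> v)) \<cdot>\<^sub>v w)"
    then have i: "i < n" using wc by simp
    have "row (mat n n (\<lambda>(i, j). (r \<cdot>\<^sub>v w) $ i * \<phi> $ j)) i \<bullet> v = r * (\<phi> \<bullet> v) * w $ i"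
      using i v wc pc by (simp add: scalar_prod_def sum_distrib_left sum_distrib_right mult.assoc mult.left_commute mult.commute)
    then show "(N r *\<^sub>v v) $ i = (v + (r * (\<phi> \<bullet> v)) \<cdot>\<^sub>v w) $ i"
      using i v wc by (simp add: N_def add_scalar_prod_distrib[of _ n])
  qed (use v wc Nc in \<open>auto simp: N_def\<close>)
  have pw: "\<psi> \<bullet> w = 0" if "\<psi> \<in> perp n xs" for \<psi> using that w by (simp add: perp_def)
  have "N r \<in> SL_U n xs" for r
  proof -
    have "det (N r) = 1 + \<phi> \<bullet> (r \<cdot>\<^sub>v w)"
      unfolding N_def by (rule det_one_plus_rank_one) (use wc pc in auto)
    then have "det (N r) = 1" using pw[OF p(1)] wc pc by simp
    moreover have "N r *\<^sub>v x = x" if "x \<in> set xs" for x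
    proof -
      have "x \<in> carrier_vec n" "\<phi> \<bullet> x = 0" using that xc p(1) by (auto simp: perp_def)
      moreover have "x + 0 \<cdot>\<^sub>v w = x" using \<open>x \<in> carrier_vec n\<close> wc by (intro eq_vecI) auto
      ultimately show ?thesis by (simp add: Nv)
    qed
    moreover have "\<psi> \<bullet> (N r *\<^sub>v v) = \<psi> \<bullet> v" if "\<psi> \<in> perp n xs" "v \<in> carrier_vec n" for \<psi> v
    proof -
      have "\<psi> \<in> carrier_vec n" using that by (simp add: perp_def)
      then show ?thesis
        using that wc pw[OF that(1)] by (simp add: Nv scalar_prod_add_distrib[of _ n])
    qed
    ultimately show ?thesis using Nc by (simp add: SL_U_def SL_simps)
  qed
  moreover have "inj N"
  proof (rule injI)
    fix r s assume "N r = N s"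
    then have "N r $$ (a, b) = N s $$ (a, b)" by simp
    then show "r = s" using ab wc by (simp add: N_def)
  qed
  ultimately show ?thesis
    using inf by (metis finite_subset image_subsetI finite_image_iff)
qed

no_notation scalar_prod (infix "\<bullet>" 70)
unbundle inner_syntax

section \<open>An Ore condition for operators on a Hilbert space\<close>

text \<open>A self-improving bound: the inequalities force \<open>a \<le> b\<close> or
  \<open>a = 0\<close>. It is used with \<open>a\<close> the norm of an approximant and
  \<open>b\<close> independent of the approximation.\<close>

lemma quad_bound: "g \<le> a * b \<Longrightarrow> a\<^sup>2 \<le> g \<Longrightarrow> 0 \<le> a \<Longrightarrow> 0 \<le> b \<Longrightarrow> g \<le> b\<^sup>2" for g a b :: real
proof -
  assume *: "g \<le> a * b" "a\<^sup>2 \<le> g" "0 \<le> a" "0 \<le> b"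
  then have "a * a \<le> a * b" by (simp add: power2_eq_square)
  then have "a \<le> b \<or> a = 0" using * by (metis mult_le_cancel_left_pos less_eq_real_def)
  then show "g \<le> b\<^sup>2"
  proof
    assume "a \<le> b" then have "a * b \<le> b * b" using * by (intro mult_right_mono) auto
    then show ?thesis using * by (simp add: power2_eq_square)
  next
    assume "a = 0" then show ?thesis using * by (auto intro: order_trans)
  qed
qed

text \<open>
  Put \<open>H = T' T + Y' Y \<le> 1\<close> and \<open>G\<^sub>k = (\<Sum>j<k. (1 - H)\<^sup>j)\<close>, an approximate inverse of \<open>H\<close>.  The operators
  \<open>T G\<^sub>k T'\<close> and \<open>T G\<^sub>k Y'\<close> converge strongly to \<open>R\<close> and \<open>S\<close>, and \<open>T G\<^sub>k H \<longlonglongrightarrow> T\<close> becomes \<open>R T + S Y = T\<close>.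
\<close>

locale contractive_column =
  fixes T T' Y Y' :: "'h::{real_inner,complete_space} \<Rightarrow> 'h"
  assumes T: "bounded_linear T" and T': "bounded_linear T'"
    and Y: "bounded_linear Y" and Y': "bounded_linear Y'"
    and adjT: "\<And>x y. T x \<bullet> y = x \<bullet> T' y" and adjY: "\<And>x y. Y x \<bullet> y = x \<bullet> Y' y"
    and contr: "\<And>x. (norm (T x))\<^sup>2 + (norm (Y x))\<^sup>2 \<le> (norm x)\<^sup>2"
begin

definition H where "H x = T' (T x) + Y' (Y x)"
definition P where "P x = x - H x"
definition pw where "pw j x = (P ^^ j) x"
definition G where "G k x = (\<Sum>j<k. pw j x)"
text \<open>The moments of the positive contraction \<open>P\<close> at \<open>x\<close>; their
  monotone decrease stands in for the spectral theorem.\<close>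

definition p where "p j x = pw j x \<bullet> x"

lemma pw_0 [simp]: "pw 0 x = x" and pw_Suc: "pw (Suc j) x = P (pw j x)"
  by (simp_all add: pw_def)

lemma H_linear: "bounded_linear H"
  unfolding H_def
  by (intro bounded_linear_add bounded_linear_compose[OF T' T] bounded_linear_compose[OF Y' Y])

lemma P_linear: "bounded_linear P"
  unfolding P_def by (intro bounded_linear_sub bounded_linear_ident H_linear)

lemma pw_linear: "bounded_linear (pw j)"
proof (induction j)
  case 0
  have "pw 0 = (\<lambda>x. x)" by auto
  then show ?case by (simp add: bounded_linear_ident)
next
  case (Suc j)
  have "pw (Suc j) = (\<lambda>x. P (pw j x))" by (auto simp: pw_Suc)
  then show ?case using bounded_linear_compose[OF P_linear Suc] by simp
qed

lemma G_linear: "bounded_linear (G k)"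
  unfolding G_def by (intro bounded_linear_sum pw_linear)

lemma H_sym: "H x \<bullet> y = x \<bullet> H y"
proof -
  have "T' (T x) \<bullet> y = T x \<bullet> T y" "Y' (Y x) \<bullet> y = Y x \<bullet> Y y"
    by (metis adjT inner_commute) (metis adjY inner_commute)
  moreover have "x \<bullet> T' (T y) = T x \<bullet> T y" "x \<bullet> Y' (Y y) = Y x \<bullet> Y y"
    by (simp_all add: adjT adjY)
  ultimately show ?thesis
    by (simp add: H_def inner_add_left inner_add_right)
qed

lemma P_sym: "P x \<bullet> y = x \<bullet> P y"
  by (simp add: P_def inner_diff_left inner_diff_right H_sym)

lemma pw_P: "pw j (P x) = P (pw j x)"
  by (induction j) (simp_all add: pw_Suc)

lemma pw_sym: "pw j x \<bullet> y = x \<bullet> pw j y"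
  by (induction j arbitrary: x y) (simp_all add: pw_Suc P_sym pw_P[symmetric])

lemma pw_add: "pw (a + b) x = pw a (pw b x)"
  by (simp add: pw_def funpow_add)

lemma pw_inner: "pw a x \<bullet> pw b x = p (a + b) x"
  by (metis add.commute p_def pw_add pw_sym)

lemma H_pw: "H (pw j x) = pw j x - pw (Suc j) x"
  by (simp add: pw_Suc P_def)

lemma HP: "H (P x) = P (H x)"
proof -
  interpret H: bounded_linear H by (rule H_linear)
  show ?thesis by (simp add: P_def H.diff)
qed

lemma H_inner: "H x \<bullet> x = (norm (T x))\<^sup>2 + (norm (Y x))\<^sup>2"
  unfolding H_def inner_add_left
  by (metis adjT adjY dot_square_norm inner_commute)

lemma H_nonneg: "0 \<le> H x \<bullet> x" by (simp add: H_inner)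

lemma P_nonneg: "0 \<le> P x \<bullet> x"
  using contr[of x] by (simp add: P_def inner_diff_left H_inner dot_square_norm)

text \<open>As \<open>P + H = 1\<close> and the two commute, \<open>H P = P H P + H P H\<close>, a
  sum of positive operators; no square root is taken.\<close>

lemma HP_nonneg: "0 \<le> H (P x) \<bullet> x"
proof -
  have "H (P x) \<bullet> x = H (P x) \<bullet> (P x + H x)" by (simp add: P_def)
  also have "\<dots> = H (P x) \<bullet> P x + P (H x) \<bullet> H x"
    by (simp add: inner_add_right HP)
  finally show ?thesis using H_nonneg[of "P x"] P_nonneg[of "H x"] by simp
qed

lemma p_nonneg: "0 \<le> p j x"
proof (cases "even j")
  case True
  then obtain m where "j = m + m" by (metis mult_2 evenE)
  then show ?thesis using pw_inner[of m x m] by (metis inner_ge_zero)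
next
  case False
  then obtain m where m: "j = Suc m + m" by (metis mult_2 oddE Suc_eq_plus1 add_Suc)
  then show ?thesis using pw_inner[of "Suc m" x m] P_nonneg[of "pw m x"] by (simp add: pw_Suc)
qed

lemma p_Suc_le: "p (Suc j) x \<le> p j x"
proof (cases "even j")
  case True
  then obtain m where m: "j = m + m" by (metis mult_2 evenE)
  have "p j x - p (Suc j) x = pw m x \<bullet> pw m x - pw (Suc m) x \<bullet> pw m x"
    using pw_inner[of m x m] pw_inner[of "Suc m" x m] m by simp
  also have "\<dots> = H (pw m x) \<bullet> pw m x" by (simp add: H_pw inner_diff_left)
  finally show ?thesis using H_nonneg[of "pw m x"] by simp
next
  case False
  then obtain m where m: "j = Suc m + m" by (metis mult_2 oddE Suc_eq_plus1 add_Suc)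
  have "p j x - p (Suc j) x = pw (Suc m) x \<bullet> pw m x - pw (Suc (Suc m)) x \<bullet> pw m x"
    using pw_inner[of "Suc m" x m] pw_inner[of "Suc (Suc m)" x m] m by simp
  also have "\<dots> = H (P (pw m x)) \<bullet> pw m x"
    by (simp only: inner_diff_left[symmetric] H_pw[symmetric]) (simp add: pw_Suc)
  finally show ?thesis using HP_nonneg[of "pw m x"] by simp
qed

lemma p_antimono: "i \<le> j \<Longrightarrow> p j x \<le> p i x"
  by (rule lift_Suc_antimono_le[where f="\<lambda>j. p j x"]) (auto intro: p_Suc_le)

lemma H_G: "H (\<Sum>j\<in>{l..<k}. pw j x) = pw l x - pw k x" if "l \<le> k"
proof -
  interpret H: bounded_linear H by (rule H_linear)
  have "(\<Sum>j\<in>{l..<k}. H (pw j x)) = (\<Sum>j\<in>{l..<k}. pw j x - pw (Suc j) x)" by (simp add: H_pw)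
  also have "\<dots> = pw l x - pw k x" using that sum_Suc_diff'[of l k "\<lambda>j. - pw j x"] by simp
  finally show ?thesis by (simp add: H.sum)
qed

lemma T_le_H: "(norm (T x))\<^sup>2 \<le> H x \<bullet> x" and Y_le_H: "(norm (Y x))\<^sup>2 \<le> H x \<bullet> x"
  by (simp_all add: H_inner)

lemma H_partial: assumes "l \<le> k"
  shows "H (\<Sum>j\<in>{l..<k}. pw j x) \<bullet> (\<Sum>j\<in>{l..<k}. pw j x) \<le> (\<Sum>j\<in>{l..<k}. p j x)"
proof -
  have "H (\<Sum>j\<in>{l..<k}. pw j x) \<bullet> (\<Sum>j\<in>{l..<k}. pw j x)
      = (\<Sum>j\<in>{l..<k}. p (l + j) x - p (k + j) x)"
    by (simp add: H_G[OF assms] inner_sum_right inner_diff_left pw_inner)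
  also have "\<dots> \<le> (\<Sum>j\<in>{l..<k}. p j x)"
  proof (rule sum_mono)
    fix j
    show "p (l + j) x - p (k + j) x \<le> p j x"
      using p_nonneg[of "k+j" x] p_antimono[of j "l+j" x] by simp
  qed
  finally show ?thesis .
qed

lemma G_diff: "l \<le> k \<Longrightarrow> G k x - G l x = (\<Sum>j\<in>{l..<k}. pw j x)"
  unfolding G_def lessThan_atLeast0 by (rule sum_diff_nat_ivl) auto

lemma T_G_diff: assumes "l \<le> k"
  shows "(norm (T (G k x) - T (G l x)))\<^sup>2 \<le> (\<Sum>j\<in>{l..<k}. p j x)"
proof -
  interpret T: bounded_linear T by (rule T)
  show ?thesis
    using T_le_H[of "G k x - G l x"] H_partial[OF assms, of x]
    by (simp add: G_diff[OF assms] T.diff[symmetric])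
qed

definition g where "g k x = (\<Sum>j<k. p j x)"

lemma G_inner: "G k x \<bullet> x = g k x" by (simp add: G_def g_def inner_sum_left p_def)

lemma T_G_le: "(norm (T (G k x)))\<^sup>2 \<le> g k x" and Y_G_le: "(norm (Y (G k x)))\<^sup>2 \<le> g k x"
proof -
  have "H (G k x) \<bullet> G k x \<le> g k x"
    using H_partial[of 0 k x] by (simp add: G_def g_def lessThan_atLeast0)
  then show "(norm (T (G k x)))\<^sup>2 \<le> g k x" "(norm (Y (G k x)))\<^sup>2 \<le> g k x"
    using T_le_H[of "G k x"] Y_le_H[of "G k x"] by auto
qed

text \<open>The \<open>G k\<close> may be unbounded as \<open>k\<close> grows, since
  \<open>H\<close> need not be invertible. But \<open>g k (T' v)\<close> is the pairing of
  \<open>T (G k (T' v))\<close> with \<open>v\<close> and also dominates the squared norm of that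
  vector, which bounds it uniformly.\<close>

lemma g_T': "g k (T' v) \<le> (norm v)\<^sup>2"
proof (rule quad_bound[OF _ T_G_le])
  have "g k (T' v) = T (G k (T' v)) \<bullet> v" by (simp add: G_inner[symmetric] adjT)
  then show "g k (T' v) \<le> norm (T (G k (T' v))) * norm v"
    by (simp add: norm_cauchy_schwarz)
qed auto

lemma g_Y': "g k (Y' v) \<le> (norm v)\<^sup>2"
proof (rule quad_bound[OF _ Y_G_le])
  have "g k (Y' v) = Y (G k (Y' v)) \<bullet> v" by (simp add: G_inner[symmetric] adjY)
  then show "g k (Y' v) \<le> norm (Y (G k (Y' v))) * norm v"
    by (simp add: norm_cauchy_schwarz)
qed auto

text \<open>The nonnegative terms \<open>p j u\<close> have bounded partial sums, and by
  \<open>T_G_diff\<close> the increments of these sums dominate the squared increments of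
  \<open>T (G k u)\<close>.\<close>

lemma T_G_convergent:
  assumes "\<And>k. g k u \<le> C" shows "convergent (\<lambda>k. T (G k u))"
proof -
  have "(\<Sum>j\<le>n. p j u) \<le> C" for n
    using assms[of "Suc n"] by (simp only: g_def lessThan_Suc_atMost)
  then have "summable (\<lambda>j. p j u)"
    by (rule bounded_imp_summable[rotated]) (rule p_nonneg)
  then have C: "Cauchy (\<lambda>k. g k u)"
    unfolding g_def by (rule LIMSEQ_imp_Cauchy[OF summable_LIMSEQ])
  have "Cauchy (\<lambda>k. T (G k u))"
  proof (rule metric_CauchyI)
    fix e :: real assume e: "0 < e"
    then obtain M where M: "\<And>m n. m \<ge> M \<Longrightarrow> n \<ge> M \<Longrightarrow> dist (g m u) (g n u) < e\<^sup>2"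
      using metric_CauchyD[OF C, of "e\<^sup>2"] by auto
    have *: "norm (T (G m u) - T (G n u)) < e" if "m \<ge> n" "n \<ge> M" for m n
    proof -
      have "(norm (T (G m u) - T (G n u)))\<^sup>2 \<le> g m u - g n u"
        using T_G_diff[OF that(1), of u] that
        by (simp add: g_def lessThan_atLeast0 sum_diff_nat_ivl)
      also have "\<dots> < e\<^sup>2" using M[of m n] that by (auto simp: dist_real_def)
      finally show ?thesis using e by (meson less_le not_less power2_le_imp_le power_mono norm_ge_zero)
    qed
    show "\<exists>M. \<forall>m\<ge>M. \<forall>n\<ge>M. dist (T (G m u)) (T (G n u)) < e"
      by (rule exI[of _ M]) (metis * dist_norm dist_commute nle_le)
  qed
  then show ?thesis by (rule Cauchy_convergent)
qed

definition R where "R v = lim (\<lambda>k. T (G k (T' v)))"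
definition S where "S v = lim (\<lambda>k. T (G k (Y' v)))"

lemma R_lim: "(\<lambda>k. T (G k (T' v))) \<longlonglongrightarrow> R v"
  unfolding R_def using T_G_convergent[OF g_T'] convergent_LIMSEQ_iff by blast

lemma S_lim: "(\<lambda>k. T (G k (Y' v))) \<longlonglongrightarrow> S v"
  unfolding S_def using T_G_convergent[OF g_Y'] convergent_LIMSEQ_iff by blast

lemma TGT'_linear: "bounded_linear (\<lambda>v. T (G k (T' v)))"
  by (rule bounded_linear_compose[OF T bounded_linear_compose[OF G_linear T']])

lemma TGY'_linear: "bounded_linear (\<lambda>v. T (G k (Y' v)))"
  by (rule bounded_linear_compose[OF T bounded_linear_compose[OF G_linear Y']])

lemma limit_bounded_linear:
  fixes F :: "nat \<Rightarrow> 'h \<Rightarrow> 'h"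
  assumes "\<And>k. bounded_linear (F k)" "\<And>v. (\<lambda>k. F k v) \<longlonglongrightarrow> L v" "\<And>k v. norm (F k v) \<le> norm v"
  shows "bounded_linear L" "norm (L v) \<le> norm v"
proof -
  show n: "norm (L v) \<le> norm v" for v
    by (rule LIMSEQ_le_const2[OF tendsto_norm[OF assms(2)]]) (use assms(3) in auto)
  have a: "L (x + y) = L x + L y" for x y
  proof (rule LIMSEQ_unique[OF assms(2)])
    have "(\<lambda>k. F k x + F k y) \<longlonglongrightarrow> L x + L y" by (intro tendsto_add assms)
    then show "(\<lambda>k. F k (x + y)) \<longlonglongrightarrow> L x + L y"
      by (simp add: bounded_linear.linear[OF assms(1)] linear_add)
  qed
  have s: "L (r *\<^sub>R x) = r *\<^sub>R L x" for r x
  proof (rule LIMSEQ_unique[OF assms(2)])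
    have "(\<lambda>k. r *\<^sub>R F k x) \<longlonglongrightarrow> r *\<^sub>R L x" by (intro tendsto_scaleR tendsto_const assms)
    then show "(\<lambda>k. F k (r *\<^sub>R x)) \<longlonglongrightarrow> r *\<^sub>R L x"
      by (simp add: bounded_linear.linear[OF assms(1)] linear_scale)
  qed
  show "bounded_linear L" by (rule bounded_linear_intro[of _ 1]) (use a s n in auto)
qed

lemma TGT'_norm: "norm (T (G k (T' v))) \<le> norm v"
  using order_trans[OF T_G_le g_T'] by (rule power2_le_imp_le) simp
lemma TGY'_norm: "norm (T (G k (Y' v))) \<le> norm v"
  using order_trans[OF T_G_le g_Y'] by (rule power2_le_imp_le) simp

lemmas R_linear = limit_bounded_linear(1)[OF TGT'_linear R_lim TGT'_norm]
  and R_norm = limit_bounded_linear(2)[OF TGT'_linear R_lim TGT'_norm]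
  and S_linear = limit_bounded_linear(1)[OF TGY'_linear S_lim TGY'_norm]

lemma R_inner_lim: "(\<lambda>k. g k (T' v)) \<longlonglongrightarrow> R v \<bullet> v"
proof -
  have "(\<lambda>k. T (G k (T' v)) \<bullet> v) \<longlonglongrightarrow> R v \<bullet> v" by (intro tendsto_inner R_lim tendsto_const)
  then show ?thesis by (simp add: adjT G_inner)
qed

text \<open>The limit of \<open>T_G_le\<close>. It makes \<open>1 - R\<close> a contraction and
  turns the trace bound on \<open>R\<close> into a bound on the norm of \<open>R d\<close>.\<close>

lemma R_square: "(norm (R v))\<^sup>2 \<le> R v \<bullet> v"
  by (rule LIMSEQ_le[OF tendsto_power[OF tendsto_norm[OF R_lim]] R_inner_lim]) (use T_G_le in auto)

lemma R_contr: "norm (v - R v) \<le> norm v"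
proof (rule power2_le_imp_le)
  have "(norm (v - R v))\<^sup>2 = (norm v)\<^sup>2 - 2 * (R v \<bullet> v) + (norm (R v))\<^sup>2"
    by (simp add: power2_norm_eq_inner inner_diff_left inner_diff_right inner_commute)
  moreover have "0 \<le> R v \<bullet> v" using R_square[of v] by (meson order_trans zero_le_power2)
  ultimately show "(norm (v - R v))\<^sup>2 \<le> (norm v)\<^sup>2" using R_square[of v] by linarith
qed simp

lemma p_convergent: "convergent (\<lambda>j. p j x)"
  by (rule decseq_convergent[where X="\<lambda>j. p j x" and B=0])
    (use p_nonneg p_antimono in \<open>auto simp: decseq_def convergent_def\<close>)

text \<open>The squared norm is at most the difference of the moments of order \<open>2 k\<close>
  and \<open>2 k + 1\<close>, and the moments converge.\<close>

lemma T_pw_tendsto: "(\<lambda>k. T (pw k x)) \<longlonglongrightarrow> 0"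
proof -
  obtain L where L: "(\<lambda>j. p j x) \<longlonglongrightarrow> L" using p_convergent convergent_def by blast
  have s: "strict_mono (\<lambda>k::nat. k + k)" "strict_mono (\<lambda>k::nat. Suc (k + k))"
    by (auto simp: strict_mono_def)
  have "(\<lambda>k. p (k + k) x - p (Suc (k + k)) x) \<longlonglongrightarrow> L - L"
    using LIMSEQ_subseq_LIMSEQ[OF L s(1)] LIMSEQ_subseq_LIMSEQ[OF L s(2)]
    by (intro tendsto_diff) (auto simp: o_def)
  moreover have "(norm (T (pw k x)))\<^sup>2 \<le> p (k + k) x - p (Suc (k + k)) x" for k
    using T_le_H[of "pw k x"] pw_inner[of k x k] pw_inner[of "Suc k" x k]
    by (simp add: H_pw inner_diff_left)
  ultimately have "(\<lambda>k. (norm (T (pw k x)))\<^sup>2) \<longlonglongrightarrow> 0"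
    by (intro tendsto_sandwich[of "\<lambda>_. 0" "\<lambda>k. (norm (T (pw k x)))\<^sup>2" _ "\<lambda>k. p (k + k) x - p (Suc (k + k)) x"]) auto
  then have "(\<lambda>k. sqrt ((norm (T (pw k x)))\<^sup>2)) \<longlonglongrightarrow> sqrt 0" by (intro tendsto_real_sqrt)
  then show ?thesis by (simp add: tendsto_norm_zero_iff)
qed

lemma Ore: "T v - R (T v) = S (Y v)"
proof -
  interpret T: bounded_linear T by (rule T)
  have "(\<lambda>k. T v - T (G k (T' (T v))) - T (G k (Y' (Y v)))) \<longlonglongrightarrow> T v - R (T v) - S (Y v)"
    by (intro tendsto_diff tendsto_const R_lim S_lim)
  \<comment> \<open>\<open>1 - G k H = P^k\<close> by telescoping, so the error of the
    \<open>k\<close>-th approximation is exactly \<open>T P^k\<close>.\<close>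
  moreover have "T v - T (G k (T' (T v))) - T (G k (Y' (Y v))) = T (pw k v)" for k
  proof -
    interpret Gk: bounded_linear "G k" by (rule G_linear)
    interpret H: bounded_linear H by (rule H_linear)
    have c: "G k (H v) = H (G k v)"
    proof -
      have "pw j (H v) = H (pw j v)" for j by (induction j) (simp_all add: pw_Suc HP)
      then show ?thesis by (simp add: G_def H.sum)
    qed
    have "T (G k (T' (T v))) + T (G k (Y' (Y v))) = T (G k (H v))"
      by (simp add: H_def Gk.add T.add)
    also have "G k (H v) = v - pw k v"
      unfolding c using H_G[of 0 k v] by (simp add: G_def lessThan_atLeast0)
    finally show ?thesis by (simp add: T.diff algebra_simps)
  qed
  ultimately have "(\<lambda>k. T (pw k v)) \<longlonglongrightarrow> T v - R (T v) - S (Y v)" by simp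
  from LIMSEQ_unique[OF this T_pw_tendsto] show ?thesis by simp
qed

text \<open>\<open>R\<close> and \<open>S\<close> are strong limits of words in the four operators.
  With \<open>U\<close> a right translation, multiplication by i or the restriction to the carrier,
  this puts them back into the algebra.\<close>

lemma commuting:
  assumes U: "bounded_linear U" and "\<And>x. T (U x) = U (T x)" "\<And>x. T' (U x) = U (T' x)"
    "\<And>x. Y (U x) = U (Y x)" "\<And>x. Y' (U x) = U (Y' x)"
  shows "R (U v) = U (R v)" "S (U v) = U (S v)"
proof -
  interpret U: bounded_linear U by (rule U)
  have "P (U x) = U (P x)" for x using assms by (simp add: P_def H_def U.diff U.add)
  then have "pw j (U x) = U (pw j x)" for j x by (induction j) (simp_all add: pw_Suc)
  then have G: "G k (U x) = U (G k x)" for k x by (simp add: G_def U.sum)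
  have "(\<lambda>k. U (T (G k (T' v)))) \<longlonglongrightarrow> U (R v)" "(\<lambda>k. U (T (G k (Y' v)))) \<longlonglongrightarrow> U (S v)"
    by (intro U.tendsto R_lim S_lim)+
  then have "(\<lambda>k. T (G k (T' (U v)))) \<longlonglongrightarrow> U (R v)" "(\<lambda>k. T (G k (Y' (U v)))) \<longlonglongrightarrow> U (S v)"
    by (simp_all add: G assms)
  then show "R (U v) = U (R v)" "S (U v) = U (S v)"
    using LIMSEQ_unique R_lim S_lim by blast+
qed

lemma G_commute: 
  assumes U: "bounded_linear U" and "\<And>x. T (U x) = U (T x)" "\<And>x. T' (U x) = U (T' x)"
    "\<And>x. Y (U x) = U (Y x)" "\<And>x. Y' (U x) = U (Y' x)"
  shows "G k (U v) = U (G k v)"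
proof -
  interpret U: bounded_linear U by (rule U)
  have "P (U x) = U (P x)" for x using assms by (simp add: P_def H_def U.diff U.add)
  then have "pw j (U x) = U (pw j x)" for j x by (induction j) (simp_all add: pw_Suc)
  then show ?thesis by (simp add: G_def U.sum)
qed

text \<open>With \<open>\<tau> A = A \<delta> \<bullet> \<delta>\<close> tracial on the operators involved: \<open>\<tau>(T G T') = \<tau>(G H) - \<tau>(Y G Y')\<close>,
  where \<open>G H \<le> 1\<close> and \<open>G \<ge> 1\<close>.\<close>

lemma R_trace:
  assumes tr: "\<And>k. T (G k (T' d)) \<bullet> d = G k (T' (T d)) \<bullet> d"
    "\<And>k. Y (G k (Y' d)) \<bullet> d = G k (Y' (Y d)) \<bullet> d" and d: "norm d = 1"
  shows "(norm (R d))\<^sup>2 \<le> 1 - (norm (Y' d))\<^sup>2"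
proof -
  have "g k (T' d) \<le> 1 - (norm (Y' d))\<^sup>2" if "k > 0" for k
  proof -
    interpret Gk: bounded_linear "G k" by (rule G_linear)
    interpret H: bounded_linear H by (rule H_linear)
    have c: "G k (H v) = H (G k v)" for v
    proof -
      have "pw j (H v) = H (pw j v)" for j by (induction j) (simp_all add: pw_Suc HP)
      then show ?thesis by (simp add: G_def H.sum)
    qed
    have "g k (T' d) + g k (Y' d) = G k (H d) \<bullet> d"
      using tr by (simp add: H_def Gk.add inner_add_left adjT adjY G_inner)
    also have "G k (H d) = d - pw k d"
      unfolding c using H_G[of 0 k d] by (simp add: G_def lessThan_atLeast0)
    also have "(d - pw k d) \<bullet> d = 1 - p k d"
      using d by (simp add: inner_diff_left p_def dot_square_norm)
    finally have "g k (T' d) + g k (Y' d) \<le> 1" using p_nonneg[of k d] by simp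
    \<comment> \<open>The term \<open>j = 0\<close> is present since \<open>k > 0\<close>, and the
      other moments are nonnegative: this is \<open>G k \<ge> 1\<close>.\<close>
    moreover have "(norm (Y' d))\<^sup>2 \<le> g k (Y' d)"
    proof -
      have "(norm (Y' d))\<^sup>2 = (\<Sum>j\<in>{0}. p j (Y' d))" by (simp add: p_def dot_square_norm)
      also have "\<dots> \<le> g k (Y' d)"
        unfolding g_def using that by (intro sum_mono2) (auto intro: p_nonneg)
      finally show ?thesis .
    qed
    ultimately show ?thesis by simp
  qed
  then have "R d \<bullet> d \<le> 1 - (norm (Y' d))\<^sup>2"
    by (intro LIMSEQ_le_const2[OF R_inner_lim]) (auto intro!: exI[of _ 1])
  then show ?thesis using R_square[of d] by simp
qed

end

section \<open>The Hilbert space of square-summable functions\<close>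

text \<open>
  The type consists of functions on the whole type \<open>'g\<close>; \<open>ell2 G\<close> corresponds to the \<open>f\<close> with
  \<open>restr (carrier G) f = f\<close>.
\<close>

typedef 'g l2 = "{f :: 'g \<Rightarrow> complex. (\<lambda>x. (cmod (f x))\<^sup>2) summable_on UNIV}"
  morphisms coord Abs_l2
  by (rule exI[of _ "\<lambda>_. 0"]) simp

lemma coord_summable: "(\<lambda>x. (cmod (coord f x))\<^sup>2) summable_on UNIV"
  using coord[of f] by simp

lemma l2_eqI: "(\<And>x. coord f x = coord h x) \<Longrightarrow> f = h"
  by (metis coord_inject ext)

lemma coord_Abs: "(\<lambda>x. (cmod (f x))\<^sup>2) summable_on UNIV \<Longrightarrow> coord (Abs_l2 f) = f"
  by (simp add: Abs_l2_inverse)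

lemma summable_on_bounded:
  fixes f :: "'g \<Rightarrow> real"
  assumes "\<And>x. 0 \<le> f x" "\<And>F. finite F \<Longrightarrow> sum f F \<le> C"
  shows "f summable_on UNIV"
  by (rule nonneg_bounded_partial_sums_imp_summable_on[where C=C])
    (use assms in \<open>auto intro: eventually_finite_subsets_at_top_weakI\<close>)

lemma cmod_add_sq: "(cmod (a + b))\<^sup>2 \<le> 2 * (cmod a)\<^sup>2 + 2 * (cmod b)\<^sup>2"
proof -
  have "(cmod (a + b))\<^sup>2 \<le> (cmod a + cmod b)\<^sup>2" by (intro power_mono norm_triangle_ineq) auto
  also have "\<dots> \<le> 2 * (cmod a)\<^sup>2 + 2 * (cmod b)\<^sup>2"
    using zero_le_power2[of "cmod a - cmod b"] by (simp add: power2_eq_square algebra_simps)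
  finally show ?thesis .
qed

lemma sq_summable_add:
  assumes "(\<lambda>x. (cmod (f x))\<^sup>2) summable_on UNIV" "(\<lambda>x. (cmod (h x))\<^sup>2) summable_on UNIV"
  shows "(\<lambda>x. (cmod (f x + h x))\<^sup>2) summable_on UNIV"
  by (rule summable_on_comparison_test[where f="\<lambda>x. 2 * (cmod (f x))\<^sup>2 + 2 * (cmod (h x))\<^sup>2"])
    (use assms cmod_add_sq in \<open>auto intro!: summable_on_add summable_on_cmult_right\<close>)

lemma sq_summable_mult:
  assumes "(\<lambda>x. (cmod (f x))\<^sup>2) summable_on UNIV"
  shows "(\<lambda>x. (cmod (c * f x))\<^sup>2) summable_on UNIV"
  using assms by (simp add: norm_mult power_mult_distrib summable_on_cmult_right)

lemma inner_bound: "\<bar>Re (a * cnj b)\<bar> \<le> (cmod a)\<^sup>2 + (cmod b)\<^sup>2"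
proof -
  have "\<bar>Re (a * cnj b)\<bar> \<le> cmod a * cmod b" by (metis abs_Re_le_cmod complex_mod_cnj norm_mult)
  also have "\<dots> \<le> (cmod a)\<^sup>2 + (cmod b)\<^sup>2"
  proof -
    have "2 * (cmod a * cmod b) \<le> (cmod a)\<^sup>2 + (cmod b)\<^sup>2"
      using sum_squares_bound[of "cmod a" "cmod b"] by (simp add: mult.assoc)
    moreover have "0 \<le> cmod a * cmod b" by simp
    ultimately show ?thesis by linarith
  qed
  finally show ?thesis .
qed

lemma inner_summable:
  assumes "(\<lambda>x. (cmod (f x))\<^sup>2) summable_on UNIV" "(\<lambda>x. (cmod (h x))\<^sup>2) summable_on UNIV"
  shows "(\<lambda>x. Re (f x * cnj (h x))) summable_on UNIV"
proof -
  have "(\<lambda>x. (cmod (f x))\<^sup>2 + (cmod (h x))\<^sup>2) summable_on UNIV"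
    using assms by (rule summable_on_add)
  then have "(\<lambda>x. \<bar>Re (f x * cnj (h x))\<bar>) summable_on UNIV"
    by (rule summable_on_comparison_test) (use inner_bound in auto)
  then show ?thesis using abs_summable_summable[of "\<lambda>x. Re (f x * cnj (h x))"] by simp
qed

instantiation l2 :: (type) real_vector
begin
definition "0 = Abs_l2 (\<lambda>_. 0)"
definition "f + h = Abs_l2 (\<lambda>x. coord f x + coord h x)"
definition "f - h = Abs_l2 (\<lambda>x. coord f x - coord h x)"
definition "- f = Abs_l2 (\<lambda>x. - coord f x)"
definition "r *\<^sub>R f = Abs_l2 (\<lambda>x. of_real r * coord f x)"
lemma coord_zero: "coord 0 x = 0"
  by (simp add: zero_l2_def coord_Abs)
lemma coord_add: "coord (f + h) x = coord f x + coord h x"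
  by (simp add: plus_l2_def coord_Abs sq_summable_add coord_summable)
lemma coord_uminus: "coord (- f) x = - coord f x"
  by (simp add: uminus_l2_def coord_Abs coord_summable)
lemma coord_diff: "coord (f - h) x = coord f x - coord h x"
  using sq_summable_add[of "coord f" "\<lambda>x. - coord h x"]
  by (simp add: minus_l2_def coord_Abs coord_summable)
lemma coord_scaleR: "coord (r *\<^sub>R f) x = of_real r * coord f x"
  unfolding scaleR_l2_def by (subst coord_Abs) (auto intro!: sq_summable_mult coord_summable)

lemmas coord_simps = coord_zero coord_add coord_uminus coord_diff coord_scaleR

instance
  by standard (auto intro!: l2_eqI simp: coord_simps algebra_simps)
end

text \<open>The real part of the hermitian product, so that the real Hilbert space argument applies.
  For operators commuting with \<open>imul\<close> both products give the same adjoint.\<close>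

instantiation l2 :: (type) real_inner
begin
definition "inner f h = (\<Sum>\<^sub>\<infinity>x. Re (coord f x * cnj (coord h x)))"
definition "norm (f::'a l2) = sqrt (inner f f)"
definition "sgn (f::'a l2) = f /\<^sub>R norm f"
definition "dist (f::'a l2) h = norm (f - h)"
definition [code del]: "uniformity = (INF e\<in>{0 <..}. principal {(x::'a l2, y). dist x y < e})"
definition [code del]: "open S = (\<forall>x\<in>S. \<forall>\<^sub>F (x', y) in uniformity. x' = x \<longrightarrow> y \<in> S)" for S :: "'a l2 set"

lemma coord_inner_summable: "(\<lambda>x. Re (coord f x * cnj (coord h x))) summable_on UNIV"
  by (intro inner_summable coord_summable)

lemma inner_self: "inner f f = (\<Sum>\<^sub>\<infinity>x. (cmod (coord f x))\<^sup>2)" for f :: "'a l2"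
  unfolding inner_l2_def by (simp only: complex_norm_square[symmetric] Re_complex_of_real)

instance
proof
  fix f h k :: "'a l2" and r s :: real
  show "sgn f = f /\<^sub>R norm f" by (simp add: sgn_l2_def)
  show "dist f h = norm (f - h)" by (simp add: dist_l2_def)
  show "uniformity = (INF e\<in>{0 <..}. principal {(x::'a l2, y). dist x y < e})"
    by (simp add: uniformity_l2_def)
  show "open U \<longleftrightarrow> (\<forall>x\<in>U. \<forall>\<^sub>F (x', y) in uniformity. x' = x \<longrightarrow> y \<in> U)" for U :: "'a l2 set"
    by (simp add: open_l2_def)
  show "inner f h = inner h f" unfolding inner_l2_def by (intro infsum_cong) (simp add: algebra_simps)
  show "inner (f + h) k = inner f k + inner h k"
    unfolding inner_l2_def
    by (subst infsum_add[symmetric])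
      (auto intro!: infsum_cong coord_inner_summable simp: coord_simps algebra_simps simp del: times_complex.simps)
  show "inner (r *\<^sub>R f) h = r * inner f h"
  proof -
    have "(\<lambda>x. Re (coord (r *\<^sub>R f) x * cnj (coord h x))) = (\<lambda>x. r * Re (coord f x * cnj (coord h x)))"
      by (auto simp: coord_simps algebra_simps)
    then show ?thesis by (simp only: inner_l2_def infsum_cmult_right')
  qed
  show "0 \<le> inner f f" unfolding inner_self by (intro infsum_nonneg) simp
  show "inner f f = 0 \<longleftrightarrow> f = 0"
  proof
    assume "inner f f = 0"
    then have "(cmod (coord f x))\<^sup>2 = 0" for x
      using nonneg_infsum_le_0D[OF _ coord_summable[of f], of x] by (simp add: inner_self)
    then show "f = 0" by (intro l2_eqI) (simp add: coord_simps)
  qed (simp add: inner_self coord_simps)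
  show "norm f = sqrt (inner f f)" by (simp add: norm_l2_def)
qed
end

lemma norm_sq: "(norm f)\<^sup>2 = (\<Sum>\<^sub>\<infinity>x. (cmod (coord f x))\<^sup>2)" for f :: "'g l2"
  by (metis inner_self dot_square_norm)

lemma sum_le_norm: "finite F \<Longrightarrow> (\<Sum>x\<in>F. (cmod (coord f x))\<^sup>2) \<le> (norm f)\<^sup>2"
  unfolding norm_sq by (rule finite_sum_le_infsum) (auto intro: coord_summable)

lemma norm_leI: "(\<And>F. finite F \<Longrightarrow> (\<Sum>x\<in>F. (cmod (coord f x))\<^sup>2) \<le> C\<^sup>2) \<Longrightarrow> 0 \<le> C \<Longrightarrow> norm f \<le> C"
  by (rule power2_le_imp_le) (auto simp: norm_sq intro!: infsum_le_finite_sums coord_summable)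

lemma coord_le_norm: "cmod (coord f x) \<le> norm f"
  using sum_le_norm[of "{x}" f] by (auto intro: power2_le_imp_le)

lemma coord_sum: "coord (\<Sum>i\<in>I. f i) x = (\<Sum>i\<in>I. coord (f i) x)"
  by (induction I rule: infinite_finite_induct) (auto simp: coord_simps)

instance l2 :: (type) complete_space
proof
  fix X :: "nat \<Rightarrow> 'a l2"
  assume X: "Cauchy X"
  have "Cauchy (\<lambda>n. coord (X n) x)" for x
  proof (rule metric_CauchyI)
    fix e :: real assume "0 < e"
    then obtain M where "\<forall>m\<ge>M. \<forall>n\<ge>M. dist (X m) (X n) < e" using metric_CauchyD[OF X] by blast
    then show "\<exists>M. \<forall>m\<ge>M. \<forall>n\<ge>M. dist (coord (X m) x) (coord (X n) x) < e"
      using le_less_trans[OF coord_le_norm[of "X _ - X _" x, unfolded coord_simps]]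
      by (auto simp: dist_norm intro!: exI[of _ M])
  qed
  then have "\<exists>L. (\<lambda>n. coord (X n) x) \<longlonglongrightarrow> L" for x
    using Cauchy_convergent convergent_def by blast
  then obtain L where L: "\<And>x. (\<lambda>n. coord (X n) x) \<longlonglongrightarrow> L x" by metis
  obtain K where K: "\<And>n. norm (X n) \<le> K"
    using BseqE[OF Cauchy_Bseq[OF X]] by metis
  have "(\<lambda>x. (cmod (L x))\<^sup>2) summable_on UNIV"
  proof (rule summable_on_bounded)
    fix F :: "'a set" assume F: "finite F"
    have "(\<lambda>n. \<Sum>x\<in>F. (cmod (coord (X n) x))\<^sup>2) \<longlonglongrightarrow> (\<Sum>x\<in>F. (cmod (L x))\<^sup>2)"
      by (intro tendsto_sum tendsto_power tendsto_norm L)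
    moreover have "(\<Sum>x\<in>F. (cmod (coord (X n) x))\<^sup>2) \<le> K\<^sup>2" for n
      using sum_le_norm[OF F, of "X n"] power_mono[OF K[of n], of 2] by simp
    ultimately show "(\<Sum>x\<in>F. (cmod (L x))\<^sup>2) \<le> K\<^sup>2" by (intro LIMSEQ_le_const2) auto
  qed simp
  then have cL: "coord (Abs_l2 L) = L" by (rule coord_Abs)
  have "X \<longlonglongrightarrow> Abs_l2 L"
  proof (rule metric_LIMSEQ_I)
    fix e :: real assume e: "0 < e"
    then obtain M where M: "\<And>m n. m\<ge>M \<Longrightarrow> n\<ge>M \<Longrightarrow> dist (X m) (X n) < e / 2"
      using metric_CauchyD[OF X, of "e/2"] by auto
    have "dist (X n) (Abs_l2 L) < e" if n: "n \<ge> M" for n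
    proof -
      have "norm (X n - Abs_l2 L) \<le> e / 2"
      proof (rule norm_leI)
        fix F :: "'a set" assume F: "finite F"
        have "(\<lambda>m. \<Sum>x\<in>F. (cmod (coord (X n - X m) x))\<^sup>2) \<longlonglongrightarrow> (\<Sum>x\<in>F. (cmod (coord (X n - Abs_l2 L) x))\<^sup>2)"
          unfolding coord_simps cL by (intro tendsto_sum tendsto_power tendsto_norm tendsto_diff tendsto_const L)
        moreover have "(\<Sum>x\<in>F. (cmod (coord (X n - X m) x))\<^sup>2) \<le> (e / 2)\<^sup>2" if "m \<ge> M" for m
          using sum_le_norm[OF F, of "X n - X m"] M[OF n that]
            power_mono[of "norm (X n - X m)" "e/2" 2] by (simp add: dist_norm)
        ultimately show "(\<Sum>x\<in>F. (cmod (coord (X n - Abs_l2 L) x))\<^sup>2) \<le> (e / 2)\<^sup>2"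
          by (intro LIMSEQ_le_const2) auto
      qed (use e in simp)
      then show ?thesis using e by (simp add: dist_norm)
    qed
    then show "\<exists>no. \<forall>n\<ge>no. dist (X n) (Abs_l2 L) < e" by blast
  qed
  then show "convergent X" by (auto simp: convergent_def)
qed

definition basis :: "'g \<Rightarrow> 'g l2" where "basis x = Abs_l2 (\<lambda>y. if y = x then 1 else 0)"
definition imul :: "'g l2 \<Rightarrow> 'g l2" where "imul f = Abs_l2 (\<lambda>x. \<i> * coord f x)"
definition restr :: "'g set \<Rightarrow> 'g l2 \<Rightarrow> 'g l2" where
  "restr A f = Abs_l2 (\<lambda>x. if x \<in> A then coord f x else 0)"
definition reindex :: "('g \<Rightarrow> 'g) \<Rightarrow> 'g l2 \<Rightarrow> 'g l2" where
  "reindex \<pi> f = Abs_l2 (\<lambda>x. coord f (\<pi> x))"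

lemma finite_support_summable: "finite F \<Longrightarrow> (\<And>x. x \<notin> F \<Longrightarrow> f x = 0) \<Longrightarrow> (\<lambda>x. (cmod (f x))\<^sup>2) summable_on UNIV"
  by (rule finite_nonzero_values_imp_summable_on) (metis (mono_tags, lifting) finite_subset mem_Collect_eq norm_zero power_zero_numeral subsetI)

lemma coord_basis: "coord (basis x) y = (if y = x then 1 else 0)"
  unfolding basis_def by (subst coord_Abs, rule finite_support_summable[of "{x}"]) auto

lemma coord_imul: "coord (imul f) x = \<i> * coord f x"
  unfolding imul_def by (subst coord_Abs) (auto intro!: sq_summable_mult coord_summable)

lemma coord_restr: "coord (restr A f) x = (if x \<in> A then coord f x else 0)"
  unfolding restr_def
  by (subst coord_Abs)
    (auto intro: summable_on_comparison_test[OF coord_summable[of f]])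

lemma coord_reindex: "bij \<pi> \<Longrightarrow> coord (reindex \<pi> f) x = coord f (\<pi> x)"
  unfolding reindex_def
  by (subst coord_Abs)
    (auto simp: summable_on_reindex_bij_betw[of \<pi> UNIV UNIV "\<lambda>x. (cmod (coord f x))\<^sup>2"] coord_summable)

lemmas coord_ops = coord_simps coord_basis coord_imul coord_restr coord_reindex coord_sum

lemma basis_inner: "inner f (basis x) = Re (coord f x)" "inner f (imul (basis x)) = Im (coord f x)"
proof -
  have "((\<lambda>y. Re (coord f y * cnj (coord (basis x) y))) has_sum Re (coord f x)) UNIV"
    by (rule has_sum_finite_neutralI[of "{x}"]) (auto simp: coord_ops)
  then show "inner f (basis x) = Re (coord f x)" unfolding inner_l2_def by (rule infsumI)
  have "((\<lambda>y. Re (coord f y * cnj (coord (imul (basis x)) y))) has_sum Im (coord f x)) UNIV"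
    by (rule has_sum_finite_neutralI[of "{x}"]) (auto simp: coord_ops)
  then show "inner f (imul (basis x)) = Im (coord f x)" unfolding inner_l2_def by (rule infsumI)
qed

lemma norm_basis [simp]: "norm (basis x) = 1"
  by (simp add: norm_eq_sqrt_inner basis_inner coord_ops)

lemma imul_inner: "inner (imul f) h = - inner f (imul h)"
  unfolding inner_l2_def infsum_uminus[symmetric]
  by (intro infsum_cong) (simp add: coord_ops algebra_simps)

lemma restr_inner: "inner (restr A f) h = inner f (restr A h)"
  unfolding inner_l2_def by (intro infsum_cong) (simp add: coord_ops)

lemma reindex_inner: assumes "bij \<pi>" shows "inner (reindex \<pi> f) (reindex \<pi> h) = inner f h"
  using infsum_reindex_bij_betw[OF assms, of "\<lambda>x. Re (coord f x * cnj (coord h x))"]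
  by (simp add: inner_l2_def coord_reindex assms)

lemma imul_imul [simp]: "imul (imul f) = - f"
  by (rule l2_eqI) (simp add: coord_ops)

lemma norm_imul [simp]: "norm (imul f) = norm f"
  by (simp add: norm_eq_sqrt_inner imul_inner)

lemma norm_reindex [simp]: "bij \<pi> \<Longrightarrow> norm (reindex \<pi> f) = norm f"
  by (simp add: norm_eq_sqrt_inner reindex_inner)

lemma norm_restr: "norm (restr A f) \<le> norm f"
proof (rule norm_leI)
  fix F :: "'a set" assume "finite F"
  then show "(\<Sum>x\<in>F. (cmod (coord (restr A f) x))\<^sup>2) \<le> (norm f)\<^sup>2"
    by (intro order_trans[OF sum_mono sum_le_norm[of F f]]) (auto simp: coord_ops)
qed simp

lemma bounded_linear_imul: "bounded_linear imul"
  by (rule bounded_linear_intro[of _ 1]) (auto intro!: l2_eqI simp: coord_ops algebra_simps)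
lemma bounded_linear_restr: "bounded_linear (restr A)"
  by (rule bounded_linear_intro[of _ 1]) (auto intro!: l2_eqI simp: coord_ops norm_restr)
lemma bounded_linear_reindex: "bij \<pi> \<Longrightarrow> bounded_linear (reindex \<pi>)"
  by (rule bounded_linear_intro[of _ 1]) (auto intro!: l2_eqI simp: coord_ops)

lemma restr_finite:
  "finite F \<Longrightarrow> restr F f = (\<Sum>x\<in>F. Re (coord f x) *\<^sub>R basis x + Im (coord f x) *\<^sub>R imul (basis x))"
  by (rule l2_eqI) (auto simp: coord_ops if_distrib[of "\<lambda>z. _ * z"] sum.distrib complex_eq_iff cong: if_cong)

lemma restr_approx: assumes "e > 0" shows "\<exists>F. finite F \<and> norm (f - restr F f) < e"
proof -
  obtain F where F: "finite F" and *: "dist (\<Sum>x\<in>F. (cmod (coord f x))\<^sup>2) ((norm f)\<^sup>2) \<le> (e/2)\<^sup>2"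
    using infsum_finite_approximation[OF coord_summable[of f], of "(e/2)\<^sup>2"] assms
    by (auto simp: norm_sq)
  have "norm (f - restr F f) \<le> e / 2"
  proof (rule norm_leI)
    fix K :: "'a set" assume K: "finite K"
    have "(\<Sum>x\<in>K. (cmod (coord (f - restr F f) x))\<^sup>2) = (\<Sum>x\<in>K - F. (cmod (coord f x))\<^sup>2)"
      using K by (intro sum.mono_neutral_cong_right) (auto simp: coord_ops)
    moreover have "(\<Sum>x\<in>K - F. (cmod (coord f x))\<^sup>2) + (\<Sum>x\<in>F. (cmod (coord f x))\<^sup>2) \<le> (norm f)\<^sup>2"
      using sum_le_norm[of "(K - F) \<union> F" f] K F by (subst sum.union_disjoint[symmetric]) auto
    ultimately show "(\<Sum>x\<in>K. (cmod (coord (f - restr F f) x))\<^sup>2) \<le> (e/2)\<^sup>2"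
      using * by (auto simp: dist_real_def)
  qed (use assms in simp)
  then show ?thesis using F assms by (intro exI[of _ F]) auto
qed

lemma l2_ext:
  assumes A: "bounded_linear A" and B: "bounded_linear B"
    and eq: "\<And>x. A (basis x) = B (basis x)" "\<And>x. A (imul (basis x)) = B (imul (basis x))"
  shows "A f = B f"
proof -
  interpret D: bounded_linear "\<lambda>f. A f - B f" by (rule bounded_linear_sub[OF A B])
  obtain K where K: "K > 0" "\<And>f. norm (A f - B f) \<le> norm f * K" using D.pos_bounded by blast
  have fin: "A (restr F f) = B (restr F f)" if "finite F" for F
  proof -
    interpret A: bounded_linear A by (rule A)
    interpret B: bounded_linear B by (rule B)
    show ?thesis by (simp add: restr_finite[OF that] A.sum B.sum A.add B.add A.scaleR B.scaleR eq)
  qed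
  have "norm (A f - B f) \<le> e" if e: "e > 0" for e
  proof -
    obtain F where F: "finite F" "norm (f - restr F f) < e / K"
      using restr_approx[of "e / K"] e K by auto
    have "A f - B f = A (f - restr F f) - B (f - restr F f)"
      using D.diff[of f "restr F f"] fin[OF F(1)] by simp
    then have "norm (A f - B f) \<le> norm (f - restr F f) * K" using K by simp
    also have "\<dots> \<le> e / K * K" using F K by (intro mult_right_mono) auto
    finally show ?thesis using K by simp
  qed
  then have "norm (A f - B f) \<le> 0" by (rule field_le_epsilon[of _ 0, simplified])
  then show ?thesis by simp
qed

text \<open>The pairings of \<open>h\<close> with \<open>A (basis x)\<close> and
  \<open>A (imul (basis x))\<close> dictate the coordinates of \<open>A' h\<close>. For square
  summability, \<open>A\<close> is tested on finite truncations of the candidate: pairing with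
  \<open>h\<close> returns the squared norm of the truncation.\<close>

lemma adjoint_exists:
  fixes A :: "'g l2 \<Rightarrow> 'g l2"
  assumes A: "bounded_linear A"
  shows "\<exists>A'. bounded_linear A' \<and> (\<forall>f h. inner (A f) h = inner f (A' h))"
proof -
  interpret A: bounded_linear A by (rule A)
  obtain K where K: "K > 0" "\<And>f. norm (A f) \<le> norm f * K" using A.pos_bounded by blast
  define c where "c h x = Complex (inner h (A (basis x))) (inner h (A (imul (basis x))))" for h x
  have fin: "(\<Sum>x\<in>F. (cmod (c h x))\<^sup>2) \<le> (K * norm h)\<^sup>2" if F: "finite F" for F h
  proof -
    define q where "q = (\<Sum>x\<in>F. Re (c h x) *\<^sub>R basis x + Im (c h x) *\<^sub>R imul (basis x))"
    have cq: "coord q x = (if x \<in> F then c h x else 0)" for x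
      unfolding q_def using F
      by (auto simp: coord_ops if_distrib[of "\<lambda>z. _ * z"] sum.distrib complex_eq_iff cong: if_cong)
    have "((\<lambda>x. (cmod (coord q x))\<^sup>2) has_sum (\<Sum>x\<in>F. (cmod (c h x))\<^sup>2)) UNIV"
      by (rule has_sum_finite_neutralI[OF F]) (auto simp: cq)
    then have nq: "(norm q)\<^sup>2 = (\<Sum>x\<in>F. (cmod (c h x))\<^sup>2)"
      unfolding norm_sq by (rule infsumI)
    have "inner (A q) h = (\<Sum>x\<in>F. (cmod (c h x))\<^sup>2)"
    proof -
      have "inner (A (basis x)) h = Re (c h x)" "inner (A (imul (basis x))) h = Im (c h x)" for x
        by (simp_all add: c_def inner_commute)
      then show ?thesis
        unfolding q_def
        by (simp add: A.sum A.add A.scaleR inner_sum_left inner_add_left cmod_def power2_eq_square)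
    qed
    moreover have "inner (A q) h \<le> norm q * (K * norm h)"
      using norm_cauchy_schwarz[of "A q" h] mult_right_mono[OF K(2)[of q], of "norm h"]
      by (simp add: mult.commute mult.left_commute)
    ultimately show ?thesis using nq K by (intro quad_bound[of _ "norm q" "K * norm h"]) auto
  qed
  define A' where "A' h = Abs_l2 (c h)" for h
  have cA': "coord (A' h) x = c h x" for h x
    unfolding A'_def by (subst coord_Abs) (auto intro: summable_on_bounded fin)
  have "bounded_linear A'"
  proof (rule bounded_linear_intro[of _ K])
    show "A' (f + h) = A' f + A' h" for f h
      by (rule l2_eqI) (simp add: cA' coord_ops c_def inner_add_left complex_eq_iff)
    show "A' (r *\<^sub>R f) = r *\<^sub>R A' f" for r f
      by (rule l2_eqI) (simp add: cA' coord_ops c_def complex_eq_iff)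
    show "norm (A' h) \<le> norm h * K" for h
      using K fin by (intro norm_leI) (auto simp: cA' mult.commute)
  qed
  moreover have "inner (A f) h = inner f (A' h)" for f h
  proof (rule l2_ext[of "\<lambda>f. inner (A f) h" "\<lambda>f. inner f (A' h)"])
    show "bounded_linear (\<lambda>f. inner (A f) h)"
      by (rule bounded_linear_compose[OF bounded_linear_inner_left A])
    show "bounded_linear (\<lambda>f. inner f (A' h))" by (rule bounded_linear_inner_left)
    show "inner (A (basis x)) h = inner (basis x) (A' h)" for x
      by (subst (2) inner_commute) (simp add: basis_inner cA' c_def inner_commute)
    show "inner (A (imul (basis x))) h = inner (imul (basis x)) (A' h)" for x
      by (subst (2) inner_commute) (simp add: basis_inner cA' c_def inner_commute)
  qed
  ultimately show ?thesis by blast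
qed

section \<open>The commutant of the right regular representation\<close>

text \<open>For \<open>g\<close> and \<open>x\<close> in the carrier, \<open>basis x\<close> goes to
  \<open>basis (x g)\<close>, which is a right action. The identity outside the carrier makes the
  index map a permutation of the whole type.\<close>

definition rho :: "('g, 'x) monoid_scheme \<Rightarrow> 'g \<Rightarrow> 'g l2 \<Rightarrow> 'g l2" where
  "rho G g = reindex (\<lambda>x. if x \<in> carrier G then x \<otimes>\<^bsub>G\<^esub> inv\<^bsub>G\<^esub> g else x)"

definition lam :: "('g, 'x) monoid_scheme \<Rightarrow> 'g \<Rightarrow> 'g l2 \<Rightarrow> 'g l2" where
  "lam G g = reindex (\<lambda>x. if x \<in> carrier G then inv\<^bsub>G\<^esub> g \<otimes>\<^bsub>G\<^esub> x else x)"

text \<open>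
  Commuting with \<open>imul\<close> is complex linearity.  Commuting with \<open>restr (carrier G)\<close> separates the part
  of \<open>l2\<close> outside \<open>carrier G\<close>, on which the operators carry no information.
\<close>

definition vn :: "('g, 'x) monoid_scheme \<Rightarrow> ('g l2 \<Rightarrow> 'g l2) set" where
  "vn G = {A. bounded_linear A \<and> (\<forall>f. A (imul f) = imul (A f))
    \<and> (\<forall>f. A (restr (carrier G) f) = restr (carrier G) (A f))
    \<and> (\<forall>g\<in>carrier G. \<forall>f. A (rho G g f) = rho G g (A f))}"

definition e0 :: "('g, 'x) monoid_scheme \<Rightarrow> 'g l2" where "e0 G = basis \<one>\<^bsub>G\<^esub>"

text \<open>The algebra as a left module over itself, an operator being recorded by its value at
  \<delta>. Right multiplication by a group element \<open>g\<close> becomes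
  \<open>rho G g\<close>.\<close>

definition vnvec :: "('g, 'x) monoid_scheme \<Rightarrow> 'g l2 set" where "vnvec G = (\<lambda>A. A (e0 G)) ` vn G"

text \<open>Closeness to 1 is measured at \<delta> only, not in operator norm: this is what the Ore
  condition yields, and traciality makes it sufficient.\<close>

definition near :: "('g, 'x) monoid_scheme \<Rightarrow> real \<Rightarrow> ('g l2 \<Rightarrow> 'g l2) set" where
  "near G e = {a \<in> vn G. (\<forall>f. norm (a f) \<le> norm f) \<and> norm (a (e0 G) - e0 G) \<le> e}"

text \<open>This is \<open>U\<close> times its adjoint for a mean \<open>U\<close> of
  \<open>N\<close> unitary translations. Using the quotients \<open>z k z l^{-1}\<close> instead of
  the \<open>z k\<close> makes the average positive and self-adjoint.\<close>

definition ravg :: "('g, 'x) monoid_scheme \<Rightarrow> nat \<Rightarrow> (nat \<Rightarrow> 'g) \<Rightarrow> 'g l2 \<Rightarrow> 'g l2" where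
  "ravg G N z f = (1 / (real N)\<^sup>2) *\<^sub>R (\<Sum>k<N. \<Sum>l<N. rho G (z k \<otimes>\<^bsub>G\<^esub> inv\<^bsub>G\<^esub> z l) f)"

definition lavg :: "('g, 'x) monoid_scheme \<Rightarrow> nat \<Rightarrow> (nat \<Rightarrow> 'g) \<Rightarrow> 'g l2 \<Rightarrow> 'g l2" where
  "lavg G N z f = (1 / (real N)\<^sup>2) *\<^sub>R (\<Sum>k<N. \<Sum>l<N. lam G (z k \<otimes>\<^bsub>G\<^esub> inv\<^bsub>G\<^esub> z l) f)"

locale unitary_average =
  fixes u u' :: "nat \<Rightarrow> 'h::real_inner \<Rightarrow> 'h" and N :: nat and W :: "'h \<Rightarrow> 'h"
  assumes N: "N > 0"
    and lin: "\<And>k. k < N \<Longrightarrow> linear (u k)"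
    and adj: "\<And>k f h. k < N \<Longrightarrow> u k f \<bullet> h = f \<bullet> u' k h"
    and iso: "\<And>k f. k < N \<Longrightarrow> norm (u k f) = norm f"
    and W: "\<And>f. W f = (1 / (real N)\<^sup>2) *\<^sub>R (\<Sum>k<N. \<Sum>l<N. u k (u' l f))"
begin

definition U' where "U' f = (1 / real N) *\<^sub>R (\<Sum>l<N. u' l f)"

lemma W_U': "W f = (1 / real N) *\<^sub>R (\<Sum>k<N. u k (U' f))"
proof -
  have "u k (U' f) = (1 / real N) *\<^sub>R (\<Sum>l<N. u k (u' l f))" if "k < N" for k
    using lin[OF that] by (simp add: U'_def linear_scale linear_sum)
  then show ?thesis by (simp add: W scaleR_sum_right power2_eq_square)
qed

lemma W_inner: "W f \<bullet> h = U' f \<bullet> U' h"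
  by (simp add: W_U' inner_sum_left adj U'_def[of h] inner_sum_right)

lemma W_sym: "W f \<bullet> h = f \<bullet> W h"
  by (metis W_inner inner_commute)

lemma W_le_U': "norm (W f) \<le> norm (U' f)"
proof -
  have "norm (\<Sum>k<N. u k (U' f)) \<le> (\<Sum>k<N. norm (U' f))"
    by (rule sum_norm_le) (simp add: iso)
  then show ?thesis using N by (simp add: W_U' field_simps)
qed

text \<open>\<open>W f\<close> pairs with \<open>f\<close> to the squared norm of
  \<open>U' f\<close>, which dominates the squared norm of \<open>W f\<close>.\<close>

lemma compl_contr: "norm (f - W f) \<le> norm f"
proof (rule power2_le_imp_le)
  have "(norm (f - W f))\<^sup>2 = (norm f)\<^sup>2 - 2 * (norm (U' f))\<^sup>2 + (norm (W f))\<^sup>2"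
  proof -
    have "W f \<bullet> f = (norm (U' f))\<^sup>2" "f \<bullet> W f = (norm (U' f))\<^sup>2"
      by (simp_all only: W_inner inner_commute[of f "W f"] dot_square_norm)
    moreover have "(norm (x - y))\<^sup>2 = (norm x)\<^sup>2 - 2 * (x \<bullet> y) + (norm y)\<^sup>2" for x y :: 'h
      by (simp add: power2_norm_eq_inner inner_diff_left inner_diff_right inner_commute)
    ultimately show ?thesis by simp
  qed
  moreover have "(norm (W f))\<^sup>2 \<le> (norm (U' f))\<^sup>2" by (intro power_mono W_le_U') simp
  ultimately show "(norm (f - W f))\<^sup>2 \<le> (norm f)\<^sup>2" using zero_le_power2[of "norm (U' f)"] by linarith
qed simp

lemma compl_kernel: assumes "(f - W f) - W (f - W f) = 0" shows "f - W f = 0"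
proof -
  have "(f - W f) \<bullet> (f - W f) = ((f - W f) - W (f - W f)) \<bullet> f"
    by (simp add: inner_diff_left inner_diff_right W_sym)
  then show ?thesis using assms by simp
qed

end

section \<open>Translations and the operators commuting with right translations\<close>

context group
begin

lemma rho_bij: "g \<in> carrier G \<Longrightarrow> bij (\<lambda>x. if x \<in> carrier G then x \<otimes> inv g else x)"
  by (rule bij_betw_byWitness[where f'="\<lambda>x. if x \<in> carrier G then x \<otimes> g else x"])
    (auto simp: m_assoc)

lemma lam_bij: "g \<in> carrier G \<Longrightarrow> bij (\<lambda>x. if x \<in> carrier G then inv g \<otimes> x else x)"
  by (rule bij_betw_byWitness[where f'="\<lambda>x. if x \<in> carrier G then g \<otimes> x else x"])
    (auto simp: m_assoc[symmetric])

lemma coord_rho: "g \<in> carrier G \<Longrightarrow> coord (rho G g f) x = coord f (if x \<in> carrier G then x \<otimes> inv g else x)"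
  by (simp add: rho_def coord_reindex rho_bij)

lemma coord_lam: "g \<in> carrier G \<Longrightarrow> coord (lam G g f) x = coord f (if x \<in> carrier G then inv g \<otimes> x else x)"
  by (simp add: lam_def coord_reindex lam_bij)

lemma rho_linear: "g \<in> carrier G \<Longrightarrow> bounded_linear (rho G g)"
  by (simp add: rho_def bounded_linear_reindex rho_bij)

lemma lam_linear: "g \<in> carrier G \<Longrightarrow> bounded_linear (lam G g)"
  by (simp add: lam_def bounded_linear_reindex lam_bij)

lemma norm_rho: "g \<in> carrier G \<Longrightarrow> norm (rho G g f) = norm f"
  by (simp add: rho_def rho_bij)

lemma norm_lam: "g \<in> carrier G \<Longrightarrow> norm (lam G g f) = norm f"
  by (simp add: lam_def lam_bij)

lemma rho_rho: "g \<in> carrier G \<Longrightarrow> h \<in> carrier G \<Longrightarrow> rho G h (rho G g f) = rho G (g \<otimes> h) f"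
  by (rule l2_eqI) (auto simp: coord_rho inv_mult_group m_assoc)

lemma lam_lam: "g \<in> carrier G \<Longrightarrow> h \<in> carrier G \<Longrightarrow> lam G g (lam G h f) = lam G (g \<otimes> h) f"
  by (rule l2_eqI) (auto simp: coord_lam inv_mult_group m_assoc)

lemma rho_one: "rho G \<one> f = f" and lam_one: "lam G \<one> f = f"
  by (rule l2_eqI, auto simp: coord_rho coord_lam)+

lemma rho_basis: "g \<in> carrier G \<Longrightarrow> x \<in> carrier G \<Longrightarrow> rho G g (basis x) = basis (x \<otimes> g)"
  by (rule l2_eqI) (auto simp: coord_rho coord_basis inv_solve_right m_assoc)

lemma lam_basis: "g \<in> carrier G \<Longrightarrow> x \<in> carrier G \<Longrightarrow> lam G g (basis x) = basis (g \<otimes> x)"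
  by (rule l2_eqI) (auto simp: coord_lam coord_basis m_assoc[symmetric])

lemma rho_inner: "g \<in> carrier G \<Longrightarrow> rho G g f \<bullet> h = f \<bullet> rho G (inv g) h"
  using reindex_inner[OF rho_bij, of g f "rho G (inv g) h"]
  by (simp add: rho_def[of G g, symmetric] rho_rho rho_one)

lemma lam_inner: "g \<in> carrier G \<Longrightarrow> lam G g f \<bullet> h = f \<bullet> lam G (inv g) h"
  using reindex_inner[OF lam_bij, of g f "lam G (inv g) h"]
  by (simp add: lam_def[of G g, symmetric] lam_lam lam_one)

lemma rho_imul: "g \<in> carrier G \<Longrightarrow> rho G g (imul f) = imul (rho G g f)"
  by (rule l2_eqI) (auto simp: coord_rho coord_imul)

lemma rho_restr: "g \<in> carrier G \<Longrightarrow> rho G g (restr (carrier G) f) = restr (carrier G) (rho G g f)"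
  by (rule l2_eqI) (auto simp: coord_rho coord_restr)

lemma vnI:
  assumes "bounded_linear A" "\<And>f. A (imul f) = imul (A f)"
    "\<And>f. A (restr (carrier G) f) = restr (carrier G) (A f)"
    "\<And>g f. g \<in> carrier G \<Longrightarrow> A (rho G g f) = rho G g (A f)"
  shows "A \<in> vn G"
  using assms by (auto simp: vn_def)

lemma vnD:
  assumes "A \<in> vn G"
  shows "bounded_linear A" "\<And>f. A (imul f) = imul (A f)"
    "\<And>f. A (restr (carrier G) f) = restr (carrier G) (A f)"
    "\<And>g f. g \<in> carrier G \<Longrightarrow> A (rho G g f) = rho G g (A f)"
  using assms by (auto simp: vn_def)

lemma vn_linear: "A \<in> vn G \<Longrightarrow> linear A" by (meson bounded_linear.linear vnD(1))

lemma vn_id: "(\<lambda>f. f) \<in> vn G" by (auto intro!: vnI simp: bounded_linear_ident)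

lemma vn_compose: "A \<in> vn G \<Longrightarrow> B \<in> vn G \<Longrightarrow> (\<lambda>f. A (B f)) \<in> vn G"
  by (auto intro!: vnI bounded_linear_compose[of A B] simp: vnD)

lemma vn_add: "A \<in> vn G \<Longrightarrow> B \<in> vn G \<Longrightarrow> (\<lambda>f. A f + B f) \<in> vn G"
  by (auto intro!: vnI bounded_linear_add[of A B] simp: vnD)
    (simp_all add: linear_add bounded_linear.linear bounded_linear_imul bounded_linear_restr rho_linear)

lemma vn_scaleR: "A \<in> vn G \<Longrightarrow> (\<lambda>f. r *\<^sub>R A f) \<in> vn G"
  by (auto intro!: vnI bounded_linear_const_scaleR[of A] simp: vnD)
    (simp_all add: linear_scale bounded_linear.linear bounded_linear_imul bounded_linear_restr rho_linear)

lemma vn_diff: "A \<in> vn G \<Longrightarrow> B \<in> vn G \<Longrightarrow> (\<lambda>f. A f - B f) \<in> vn G"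
  using vn_add[of A "\<lambda>f. (-1) *\<^sub>R B f"] vn_scaleR[of B "-1"] by simp

lemma vn_zero: "(\<lambda>f. 0) \<in> vn G" using vn_scaleR[OF vn_id, of 0] by simp

lemma vn_sum: "(\<And>i. i \<in> I \<Longrightarrow> A i \<in> vn G) \<Longrightarrow> (\<lambda>f. \<Sum>i\<in>I. A i f) \<in> vn G"
  by (induction I rule: infinite_finite_induct) (auto intro: vn_zero vn_add)

lemma vn_lam: "g \<in> carrier G \<Longrightarrow> lam G g \<in> vn G"
  by (intro vnI lam_linear l2_eqI) (auto simp: coord_lam coord_imul coord_restr coord_rho m_assoc)

lemma adjoint_commute:
  assumes adj: "\<And>f h. A f \<bullet> h = f \<bullet> A' h" and u: "\<And>f h. U f \<bullet> h = f \<bullet> U' h"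
    and c: "\<And>f. A (U f) = U (A f)"
  shows "A' (U' f) = U' (A' f)"
proof -
  have "h \<bullet> A' (U' f) = h \<bullet> U' (A' f)" for h
    by (metis adj u c)
  then show ?thesis by (metis inner_diff_right inner_eq_zero_iff right_minus_eq)
qed

lemma vn_adjoint:
  assumes A: "A \<in> vn G" obtains A' where "A' \<in> vn G" "\<And>f h. A f \<bullet> h = f \<bullet> A' h"
proof -
  obtain A' where A': "bounded_linear A'" and adj: "\<And>f h. A f \<bullet> h = f \<bullet> A' h"
    using adjoint_exists[OF vnD(1)[OF A]] by blast
  have "A' \<in> vn G"
  proof (rule vnI)
    show "bounded_linear A'" by (rule A')
    have neg: "A' (- f) = - A' f" for f by (simp add: linear_neg bounded_linear.linear[OF A'])
    \<comment> \<open>The adjoint of \<open>imul\<close> is its negative; \<open>neg\<close> removes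
      the sign afterwards.\<close>
    have "A' (- imul f) = - imul (A' f)" for f
      by (rule adjoint_commute[of A A' imul "\<lambda>f. - imul f"]) (auto simp: adj imul_inner vnD[OF A])
    then show "A' (imul f) = imul (A' f)" for f by (simp add: neg)
    show "A' (restr (carrier G) f) = restr (carrier G) (A' f)" for f
      by (rule adjoint_commute[of A A' "restr (carrier G)"]) (auto simp: adj restr_inner vnD[OF A])
    show "A' (rho G g f) = rho G g (A' f)" if "g \<in> carrier G" for g f
      by (rule adjoint_commute[of A A' "rho G (inv g)"])
        (use that in \<open>auto simp: adj rho_inner vnD[OF A]\<close>)
  qed
  with adj show ?thesis using that by blast
qed

lemma restr_e0: "restr (carrier G) (e0 G) = e0 G"
  by (rule l2_eqI) (auto simp: coord_ops e0_def)

lemma norm_e0 [simp]: "norm (e0 G) = 1" by (simp add: e0_def)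

lemma rho_e0: "g \<in> carrier G \<Longrightarrow> rho G g (e0 G) = basis g"
  by (simp add: e0_def rho_basis)

lemma vn_supp: "A \<in> vn G \<Longrightarrow> x \<notin> carrier G \<Longrightarrow> coord (A (e0 G)) x = 0"
  using vnD(3)[of A "e0 G"] by (metis coord_restr restr_e0)

text \<open>The coordinate of \<open>A' \<delta>\<close> at \<open>x\<close> is the complex
  conjugate of that of \<open>A \<delta>\<close> at \<open>inv x\<close>, and inversion permutes the
  carrier. This is the trace property for the products of \<open>A\<close> with its adjoint.\<close>

lemma norm_adjoint_e0:
  assumes A: "A \<in> vn G" "A' \<in> vn G" and adj: "\<And>f h. A f \<bullet> h = f \<bullet> A' h"
  shows "norm (A' (e0 G)) = norm (A (e0 G))"
proof -
  have "cmod (coord (A' (e0 G)) x) = cmod (coord (A (e0 G)) (inv x))" if x: "x \<in> carrier G" for x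
  proof -
    have b: "basis x = rho G x (e0 G)" using x by (simp add: rho_e0)
    have "Re (coord (A' (e0 G)) x) = A (basis x) \<bullet> e0 G"
      by (metis basis_inner(1) adj inner_commute)
    also have "\<dots> = A (e0 G) \<bullet> basis (inv x)"
      unfolding b by (simp only: vnD(4)[OF A(1) x] rho_inner[OF x] rho_e0[OF inv_closed[OF x]])
    finally have 1: "Re (coord (A' (e0 G)) x) = Re (coord (A (e0 G)) (inv x))"
      by (simp add: basis_inner)
    have "Im (coord (A' (e0 G)) x) = A (imul (basis x)) \<bullet> e0 G"
      by (metis basis_inner(2) adj inner_commute)
    also have "\<dots> = - (A (e0 G) \<bullet> imul (basis (inv x)))"
      unfolding b
      by (simp only: vnD(2)[OF A(1)] vnD(4)[OF A(1) x] imul_inner rho_inner[OF x]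
          rho_imul[OF inv_closed[OF x]] rho_e0[OF inv_closed[OF x]])
    finally have 2: "Im (coord (A' (e0 G)) x) = - Im (coord (A (e0 G)) (inv x))"
      by (simp add: basis_inner)
    show ?thesis by (simp add: cmod_def 1 2)
  qed
  then have "(\<Sum>\<^sub>\<infinity>x\<in>carrier G. (cmod (coord (A' (e0 G)) x))\<^sup>2)
      = (\<Sum>\<^sub>\<infinity>x\<in>carrier G. (cmod (coord (A (e0 G)) (inv x)))\<^sup>2)"
    by (intro infsum_cong) simp
  also have "\<dots> = (\<Sum>\<^sub>\<infinity>x\<in>carrier G. (cmod (coord (A (e0 G)) x))\<^sup>2)"
    by (rule infsum_reindex_bij_betw) (rule bij_betw_byWitness[where f'="\<lambda>x. inv x"], auto)
  finally have "(\<Sum>\<^sub>\<infinity>x\<in>carrier G. (cmod (coord (A' (e0 G)) x))\<^sup>2)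
      = (\<Sum>\<^sub>\<infinity>x\<in>carrier G. (cmod (coord (A (e0 G)) x))\<^sup>2)" .
  moreover have "(norm (B (e0 G)))\<^sup>2 = (\<Sum>\<^sub>\<infinity>x\<in>carrier G. (cmod (coord (B (e0 G)) x))\<^sup>2)" if "B \<in> vn G" for B
    unfolding norm_sq by (rule infsum_cong_neutral) (auto simp: vn_supp[OF that])
  ultimately show ?thesis using A by (metis norm_ge_zero power2_eq_imp_eq)
qed

text \<open>Polarisation of \<open>norm_adjoint_e0\<close>, applied to \<open>B + A'\<close> with
  adjoint \<open>B' + A\<close>; the cross terms are the two sides.\<close>

lemma trace_commute:
  assumes A: "A \<in> vn G" and B: "B \<in> vn G"
  shows "A (B (e0 G)) \<bullet> e0 G = B (A (e0 G)) \<bullet> e0 G"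
proof -
  obtain A' where A': "A' \<in> vn G" "\<And>f h. A f \<bullet> h = f \<bullet> A' h" using vn_adjoint[OF A] by blast
  obtain B' where B': "B' \<in> vn G" "\<And>f h. B f \<bullet> h = f \<bullet> B' h" using vn_adjoint[OF B] by blast
  have A'': "A' f \<bullet> h = f \<bullet> A h" for f h by (metis A'(2) inner_commute)
  have "norm (B' (e0 G) + A (e0 G)) = norm (B (e0 G) + A' (e0 G))"
    by (rule norm_adjoint_e0[OF vn_add[OF B A'(1)] vn_add[OF B'(1) A]])
      (simp add: inner_add_left inner_add_right B' A'')
  then have "(norm (B' (e0 G) + A (e0 G)))\<^sup>2 = (norm (B (e0 G) + A' (e0 G)))\<^sup>2" by simp
  moreover have "(norm (x + y))\<^sup>2 = (norm x)\<^sup>2 + 2 * (y \<bullet> x) + (norm y)\<^sup>2" for x y :: "'a l2"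
    by (simp add: power2_norm_eq_inner inner_add_left inner_add_right inner_commute)
  ultimately have "(norm (B' (e0 G)))\<^sup>2 + 2 * (A (e0 G) \<bullet> B' (e0 G)) + (norm (A (e0 G)))\<^sup>2
    = (norm (B (e0 G)))\<^sup>2 + 2 * (A' (e0 G) \<bullet> B (e0 G)) + (norm (A' (e0 G)))\<^sup>2" by simp
  then have "A (e0 G) \<bullet> B' (e0 G) = B (e0 G) \<bullet> A' (e0 G)"
    using norm_adjoint_e0[OF A A'] norm_adjoint_e0[OF B B']
    by (simp add: inner_commute[of "A' _"])
  then show ?thesis by (simp add: A' B')
qed

text \<open>Here \<open>a = 1 - R\<close> for the column of rescaled \<open>T\<close> and
  \<open>Y\<close>, so \<open>a \<delta> - \<delta>\<close> is \<open>- R \<delta>\<close>, which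
  \<open>R_trace\<close> bounds. The scales are absorbed into \<open>b\<close>.\<close>

lemma vn_Ore:
  assumes T: "T \<in> vn G" and Y: "Y \<in> vn G" and c: "\<And>f. norm (Y f) \<le> norm f" and e: "e > 0"
  obtains a b where "a \<in> vn G" "b \<in> vn G" "\<And>f. norm (a f) \<le> norm f"
    "(norm (a (e0 G) - e0 G))\<^sup>2 \<le> 1 - (norm (Y (e0 G)))\<^sup>2 + e" "\<And>f. a (T f) = b (Y f)"
proof -
  obtain K where K: "K > 0" "\<And>f. norm (T f) \<le> norm f * K"
    using bounded_linear.pos_bounded[OF vnD(1)[OF T]] by blast
  \<comment> \<open>\<open>\<alpha>\<close> shrinks \<open>T\<close> to squared norm at most
    \<open>s\<close>, and \<open>\<beta>\<close> leaves \<open>1 - s\<close> for \<open>Y\<close>;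
    this costs at most \<open>s \<le> e\<close> in the estimate.\<close>
  define s where "s = min e (1/2)"
  have s: "0 < s" "s < 1" "s \<le> e" using e by (auto simp: s_def)
  define \<alpha> \<beta> where "\<alpha> = sqrt s / K" and "\<beta> = sqrt (1 - s)"
  have ab: "\<alpha> > 0" "\<alpha>\<^sup>2 * K\<^sup>2 = s" "\<beta>\<^sup>2 = 1 - s"
    using s K by (auto simp: \<alpha>_def \<beta>_def power_divide)
  obtain T' where T': "T' \<in> vn G" "\<And>f h. T f \<bullet> h = f \<bullet> T' h" using vn_adjoint[OF T] by blast
  obtain Y' where Y': "Y' \<in> vn G" "\<And>f h. Y f \<bullet> h = f \<bullet> Y' h" using vn_adjoint[OF Y] by blast
  let ?T = "\<lambda>f. \<alpha> *\<^sub>R T f" and ?T' = "\<lambda>f. \<alpha> *\<^sub>R T' f" and ?Y = "\<lambda>f. \<beta> *\<^sub>R Y f" and ?Y' = "\<lambda>f. \<beta> *\<^sub>R Y' f"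
  have mem: "?T \<in> vn G" "?T' \<in> vn G" "?Y \<in> vn G" "?Y' \<in> vn G"
    by (intro vn_scaleR T T'(1) Y Y'(1))+
  interpret cc: contractive_column ?T ?T' ?Y ?Y'
  proof (rule contractive_column.intro)
    show "(norm (\<alpha> *\<^sub>R T x))\<^sup>2 + (norm (\<beta> *\<^sub>R Y x))\<^sup>2 \<le> (norm x)\<^sup>2" for x
    proof -
      have "(norm (\<alpha> *\<^sub>R T x))\<^sup>2 = \<alpha>\<^sup>2 * (norm (T x))\<^sup>2" "(norm (\<beta> *\<^sub>R Y x))\<^sup>2 = \<beta>\<^sup>2 * (norm (Y x))\<^sup>2"
        by (simp_all add: power_mult_distrib)
      moreover have "(norm (T x))\<^sup>2 \<le> (norm x * K)\<^sup>2" "(norm (Y x))\<^sup>2 \<le> (norm x)\<^sup>2"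
        by (intro power_mono K c norm_ge_zero)+
      then have "\<alpha>\<^sup>2 * (norm (T x))\<^sup>2 \<le> \<alpha>\<^sup>2 * (norm x * K)\<^sup>2" "\<beta>\<^sup>2 * (norm (Y x))\<^sup>2 \<le> \<beta>\<^sup>2 * (norm x)\<^sup>2"
        by (intro mult_left_mono; simp)+
      moreover have "\<alpha>\<^sup>2 * (norm x * K)\<^sup>2 = s * (norm x)\<^sup>2"
        by (simp add: power_mult_distrib ab(2)[symmetric])
      moreover have "\<beta>\<^sup>2 * (norm x)\<^sup>2 = (norm x)\<^sup>2 - s * (norm x)\<^sup>2"
        by (simp add: ab left_diff_distrib)
      ultimately show ?thesis by linarith
    qed
  qed (use vnD(1)[OF mem(1)] vnD(1)[OF mem(2)] vnD(1)[OF mem(3)] vnD(1)[OF mem(4)] T' Y' in auto)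
  have comm: "F (U x) = U (F x)"
    if "F \<in> {?T, ?T', ?Y, ?Y'}" "U = imul \<or> U = restr (carrier G) \<or> (\<exists>g\<in>carrier G. U = rho G g)" for F U x
    using that vnD[OF mem(1)] vnD[OF mem(2)] vnD[OF mem(3)] vnD[OF mem(4)] by auto
  have bl: "bounded_linear U" if "U = imul \<or> U = restr (carrier G) \<or> (\<exists>g\<in>carrier G. U = rho G g)" for U
    using that bounded_linear_imul bounded_linear_restr rho_linear by auto
  have RU: "cc.R (U v) = U (cc.R v)" and SU: "cc.S (U v) = U (cc.S v)" and GU: "cc.G k (U v) = U (cc.G k v)"
    if "U = imul \<or> U = restr (carrier G) \<or> (\<exists>g\<in>carrier G. U = rho G g)" for U v k
    by (intro cc.commuting[OF bl[OF that]] cc.G_commute[OF bl[OF that]]; rule comm[OF _ that]; simp)+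
  have R: "cc.R \<in> vn G" by (rule vnI) (auto intro: cc.R_linear RU)
  have S: "cc.S \<in> vn G" by (rule vnI) (auto intro: cc.S_linear SU)
  have Gk: "cc.G k \<in> vn G" for k by (rule vnI) (auto intro: cc.G_linear GU)
  have "(norm (cc.R (e0 G)))\<^sup>2 \<le> 1 - (norm (\<beta> *\<^sub>R Y' (e0 G)))\<^sup>2"
    using trace_commute[OF mem(1) vn_compose[OF Gk mem(2)]] trace_commute[OF mem(3) vn_compose[OF Gk mem(4)]]
    by (intro cc.R_trace) auto
  also have "norm (\<beta> *\<^sub>R Y' (e0 G)) = norm (\<beta> *\<^sub>R Y (e0 G))"
    using norm_adjoint_e0[OF Y Y'] by simp
  also have "1 - (norm (\<beta> *\<^sub>R Y (e0 G)))\<^sup>2 \<le> 1 - (norm (Y (e0 G)))\<^sup>2 + s"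
  proof -
    have "(norm (Y (e0 G)))\<^sup>2 \<le> 1\<^sup>2" using c[of "e0 G"] by (intro power_mono) auto
    then have "s * (norm (Y (e0 G)))\<^sup>2 \<le> s" using s by simp
    then show ?thesis by (simp add: power_mult_distrib ab algebra_simps)
  qed
  finally have n: "(norm (cc.R (e0 G)))\<^sup>2 \<le> 1 - (norm (Y (e0 G)))\<^sup>2 + e" using s by simp
  show ?thesis
  proof (rule that)
    show "(\<lambda>f. f - cc.R f) \<in> vn G" by (rule vn_diff[OF vn_id R])
    show "(\<lambda>f. (\<beta> / \<alpha>) *\<^sub>R cc.S f) \<in> vn G" by (rule vn_scaleR[OF S])
    show "norm (f - cc.R f) \<le> norm f" for f by (rule cc.R_contr)
    show "(norm (e0 G - cc.R (e0 G) - e0 G))\<^sup>2 \<le> 1 - (norm (Y (e0 G)))\<^sup>2 + e" using n by simp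
    show "T f - cc.R (T f) = (\<beta> / \<alpha>) *\<^sub>R cc.S (Y f)" for f
    proof -
      have "\<alpha> *\<^sub>R (T f - cc.R (T f)) = \<alpha> *\<^sub>R T f - cc.R (\<alpha> *\<^sub>R T f)"
        using vn_linear[OF R] by (simp add: linear_scale scaleR_diff_right)
      also have "\<dots> = \<beta> *\<^sub>R cc.S (Y f)"
        using cc.Ore[of f] vn_linear[OF S] by (simp add: linear_scale)
      finally have "(1 / \<alpha>) *\<^sub>R (\<alpha> *\<^sub>R (T f - cc.R (T f))) = (1 / \<alpha>) *\<^sub>R (\<beta> *\<^sub>R cc.S (Y f))" by simp
      then show ?thesis using ab(1) by simp
    qed
  qed
qed

section \<open>Bounded vectors and almost-identities\<close>

lemma vnvecI: "A \<in> vn G \<Longrightarrow> A (e0 G) \<in> vnvec G"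
  by (auto simp: vnvec_def)

lemma vnvec_apply: "a \<in> vn G \<Longrightarrow> v \<in> vnvec G \<Longrightarrow> a v \<in> vnvec G"
  unfolding vnvec_def using vnvecI[OF vn_compose[of a]] by (auto simp: vnvec_def)

lemma vnvec_rho: "g \<in> carrier G \<Longrightarrow> v \<in> vnvec G \<Longrightarrow> rho G g v \<in> vnvec G"
proof -
  assume g: "g \<in> carrier G" and "v \<in> vnvec G"
  then obtain A where A: "A \<in> vn G" "v = A (e0 G)" by (auto simp: vnvec_def)
  \<comment> \<open>\<open>rho G g\<close> and \<open>lam G g\<close> agree at \<delta>, so
    translating \<open>A \<delta>\<close> on the right means composing \<open>A\<close> with a left
    translation.\<close>
  have "rho G g v = A (lam G g (e0 G))"
    using g by (simp add: A vnD(4)[OF A(1), symmetric] rho_e0) (simp add: e0_def lam_basis)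
  then show ?thesis using vnvecI[OF vn_compose[OF A(1) vn_lam[OF g]]] by simp
qed

lemma vnvec_add: "v \<in> vnvec G \<Longrightarrow> w \<in> vnvec G \<Longrightarrow> v + w \<in> vnvec G"
  using vnvecI[OF vn_add] by (auto simp: vnvec_def)
lemma vnvec_scaleR: "v \<in> vnvec G \<Longrightarrow> r *\<^sub>R v \<in> vnvec G"
  using vnvecI[OF vn_scaleR] by (auto simp: vnvec_def)
lemma vnvec_zero: "0 \<in> vnvec G"
  using vnvecI[OF vn_zero] by simp
lemma vnvec_uminus: "v \<in> vnvec G \<Longrightarrow> - v \<in> vnvec G"
  using vnvec_scaleR[of v "-1"] by simp
lemma vnvec_diff: "v \<in> vnvec G \<Longrightarrow> w \<in> vnvec G \<Longrightarrow> v - w \<in> vnvec G"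
  using vnvec_add[of v "- w"] vnvec_uminus[of w] by simp
lemma vnvec_sum: "(\<And>i. i \<in> I \<Longrightarrow> f i \<in> vnvec G) \<Longrightarrow> sum f I \<in> vnvec G"
  by (induction I rule: infinite_finite_induct) (auto intro: vnvec_zero vnvec_add)

lemma nearD: "a \<in> near G e \<Longrightarrow> a \<in> vn G" "a \<in> near G e \<Longrightarrow> norm (a f) \<le> norm f"
    "a \<in> near G e \<Longrightarrow> norm (a (e0 G) - e0 G) \<le> e"
  by (auto simp: near_def)

text \<open>\<open>a b \<delta> - \<delta> = a (b \<delta> - \<delta>) + (a \<delta> -
  \<delta>)\<close>, and the contraction \<open>a\<close> does not enlarge the first
  summand.\<close>

lemma near_compose:
  assumes a: "a \<in> near G e" and b: "b \<in> near G e'" shows "(\<lambda>f. a (b f)) \<in> near G (e + e')"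
proof -
  have eq: "a (b (e0 G)) - e0 G = a (b (e0 G) - e0 G) + (a (e0 G) - e0 G)"
    using vn_linear[OF nearD(1)[OF a]] by (simp add: linear_diff)
  have "norm (a (b (e0 G)) - e0 G) \<le> norm (b (e0 G) - e0 G) + norm (a (e0 G) - e0 G)"
    unfolding eq
    using norm_triangle_ineq[of "a (b (e0 G) - e0 G)" "a (e0 G) - e0 G"] nearD(2)[OF a, of "b (e0 G) - e0 G"]
    by linarith
  then have "norm (a (b (e0 G)) - e0 G) \<le> e + e'"
    using nearD(3)[OF a] nearD(3)[OF b] by linarith
  moreover have "norm (a (b f)) \<le> norm f" for f
    using nearD(2)[OF a, of "b f"] nearD(2)[OF b, of f] by linarith
  ultimately show ?thesis
    using vn_compose[OF nearD(1)[OF a] nearD(1)[OF b]] by (simp add: near_def)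
qed

lemma near_id: "e \<ge> 0 \<Longrightarrow> (\<lambda>f. f) \<in> near G e" by (simp add: near_def vn_id)

text \<open>By traciality \<open>\<parallel>\<delta> - a\<^sup>* \<delta>\<parallel> = \<parallel>\<delta> - a \<delta>\<parallel>\<close>, which bounds each coordinate of \<open>v = (1 - a) v\<close>.\<close>

lemma torsion_free:
  assumes supp: "\<And>x. x \<notin> carrier G \<Longrightarrow> coord v x = 0"
    and kill: "\<And>e. e > 0 \<Longrightarrow> \<exists>a\<in>near G e. a v = 0"
  shows "v = 0"
proof -
  have re: "Re (coord w x) = 0" if x: "x \<in> carrier G" and w: "\<And>e. e > 0 \<Longrightarrow> \<exists>a\<in>near G e. a w = 0" for w x
  proof -
    have "\<bar>Re (coord w x)\<bar> \<le> e * (norm w + 1)" if e: "e > 0" for e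
    proof -
      obtain a where a: "a \<in> near G e" "a w = 0" using w[OF e] by blast
      obtain a' where a': "a' \<in> vn G" "\<And>f h. a f \<bullet> h = f \<bullet> a' h" using vn_adjoint[OF nearD(1)[OF a(1)]] by blast
      have "Re (coord w x) = w \<bullet> (basis x - a' (basis x))"
        using a a'(2)[of w "basis x"] by (simp add: inner_diff_right) (simp add: basis_inner(1))
      \<comment> \<open>\<open>basis x\<close> is a right translate of \<delta>, and
        \<open>a'\<close> commutes with right translations.\<close>
      moreover have "norm (basis x - a' (basis x)) = norm (e0 G - a' (e0 G))"
      proof -
        have "basis x - a' (basis x) = rho G x (e0 G - a' (e0 G))"
          using x rho_linear[OF x] vnD(4)[OF a'(1) x]
          by (simp add: linear_diff bounded_linear.linear rho_e0 flip: rho_e0)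
        then show ?thesis using x by (simp add: norm_rho)
      qed
      moreover have "norm (e0 G - a' (e0 G)) = norm (e0 G - a (e0 G))"
        by (rule norm_adjoint_e0[OF vn_diff[OF vn_id nearD(1)[OF a(1)]] vn_diff[OF vn_id a'(1)]])
          (simp add: inner_diff_left inner_diff_right a'(2))
      ultimately have "\<bar>Re (coord w x)\<bar> \<le> norm w * norm (e0 G - a (e0 G))"
        using Cauchy_Schwarz_ineq2[of w "basis x - a' (basis x)"] by simp
      also have "\<dots> \<le> norm w * e" using nearD(3)[OF a(1)]
        by (intro mult_left_mono) (auto simp: norm_minus_commute)
      finally show ?thesis using e by (simp add: algebra_simps)
    qed
    then have *: "\<bar>Re (coord w x)\<bar> \<le> e * (norm w + 1)" if "e > 0" for e using that by blast
    have "\<bar>Re (coord w x)\<bar> \<le> 0 + d" if "d > 0" for d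
    proof -
      have "norm w + 1 > 0" by (simp add: add_nonneg_pos)
      then show ?thesis using *[of "d / (norm w + 1)"] that by simp
    qed
    then show ?thesis using field_le_epsilon[of "\<bar>Re (coord w x)\<bar>" 0] by auto
  qed
  \<comment> \<open>By complex linearity the operators killing \<open>v\<close> also kill
    \<open>imul v\<close>, whose real parts are the imaginary parts of \<open>v\<close> up to
    sign.\<close>
  have "Re (coord (imul v) x) = 0" if "x \<in> carrier G" for x
  proof (rule re[OF that])
    fix e :: real assume "e > 0"
    then obtain a where a: "a \<in> near G e" "a v = 0" using kill by blast
    then have "a (imul v) = imul 0" using vnD(2)[OF nearD(1)[OF a(1)]] by simp
    also have "imul 0 = 0" by (rule l2_eqI) (simp add: coord_ops)
    finally show "\<exists>a\<in>near G e. a (imul v) = 0" using a by blast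
  qed
  then have "Im (coord v x) = 0" if "x \<in> carrier G" for x using that by (simp add: coord_imul)
  then have "coord v x = 0" for x
    using re[OF _ kill, of x] supp[of x] by (cases "x \<in> carrier G") (auto simp: complex_eq_iff)
  then show ?thesis by (intro l2_eqI) (simp add: coord_zero)
qed

context
  fixes N :: nat and z :: "nat \<Rightarrow> 'a"
  assumes N: "N > 0" and z: "\<And>k. k < N \<Longrightarrow> z k \<in> carrier G"
begin

lemma lavg_average: "unitary_average (\<lambda>k. lam G (z k)) (\<lambda>k. lam G (inv z k)) N (lavg G N z)"
  by (rule unitary_average.intro)
    (auto simp: N z lam_inner norm_lam lavg_def lam_lam bounded_linear.linear[OF lam_linear])

text \<open>\<open>rho\<close> is a right action, so the double sum comes out with its indices
  exchanged; hence the inverses in the first family and the swapped summation.\<close>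

lemma ravg_average: "unitary_average (\<lambda>k. rho G (inv z k)) (\<lambda>k. rho G (z k)) N (ravg G N z)"
  by (rule unitary_average.intro)
    (auto simp: N z rho_inner norm_rho ravg_def rho_rho bounded_linear.linear[OF rho_linear],
      subst sum.swap, rule refl)

lemma ravg_linear: "linear (ravg G N z)"
proof -
  have "linear (\<lambda>f. (1 / (real N)\<^sup>2) *\<^sub>R (\<Sum>k<N. \<Sum>l<N. rho G (z k \<otimes> inv z l) f))"
    using z by (intro linear_compose_scale_right linear_compose_sum ballI bounded_linear.linear[OF rho_linear]) auto
  then show ?thesis by (simp add: ravg_def[abs_def])
qed

lemma ravg_vn: "a \<in> vn G \<Longrightarrow> a (ravg G N z f) = ravg G N z (a f)"
  using z by (simp add: ravg_def linear_scale linear_sum vn_linear vnD(4))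

lemma ravg_vnvec: "v \<in> vnvec G \<Longrightarrow> ravg G N z v \<in> vnvec G"
  using z by (auto simp: ravg_def intro!: vnvec_scaleR vnvec_sum vnvec_rho)

lemma lavg_vn: "lavg G N z \<in> vn G"
proof -
  have "(\<lambda>f. (1 / (real N)\<^sup>2) *\<^sub>R (\<Sum>k<N. \<Sum>l<N. lam G (z k \<otimes> inv z l) f)) \<in> vn G"
    using z by (intro vn_scaleR vn_sum vn_lam) auto
  then show ?thesis by (simp add: lavg_def[abs_def])
qed

text \<open>Through this the Ore condition, which concerns left multiplication, yields right
  averages.\<close>

lemma lavg_e0: "lavg G N z (e0 G) = ravg G N z (e0 G)"
  using z by (simp add: lavg_def ravg_def e0_def lam_basis rho_basis)

lemma ravg_kernel:
  "(f - ravg G N z f) - ravg G N z (f - ravg G N z f) = 0 \<Longrightarrow> f - ravg G N z f = 0"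
  by (rule unitary_average.compl_kernel[OF ravg_average])

text \<open>By \<open>W_le_U'\<close> it is enough to bound the mean of \<open>N\<close> basis
  vectors; injectivity of \<open>z\<close> makes them orthonormal.\<close>

lemma norm_lavg_e0: assumes "inj_on z {..<N}" shows "norm (lavg G N z (e0 G)) \<le> 1 / sqrt N"
proof -
  interpret L: unitary_average "\<lambda>k. lam G (z k)" "\<lambda>k. lam G (inv z k)" N "lavg G N z" by (rule lavg_average)
  have U: "L.U' (e0 G) = (1 / real N) *\<^sub>R (\<Sum>l<N. basis (inv z l))"
    using z by (simp add: L.U'_def e0_def lam_basis)
  have "(norm (\<Sum>l<N. basis (inv z l)))\<^sup>2 = (\<Sum>l<N. \<Sum>m<N. if m = l then 1 else 0)"
  proof -
    have "basis (inv z l) \<bullet> basis (inv z m) = (if m = l then 1 else 0)" if "l < N" "m < N" for l m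
    proof -
      have "m = l" if "inv z m = inv z l"
        using that \<open>l < N\<close> \<open>m < N\<close> z inj_onD[OF assms, of m l] by (metis inv_inv lessThan_iff)
      then show ?thesis by (auto simp: basis_inner coord_basis)
    qed
    then show ?thesis by (simp add: power2_norm_eq_inner inner_sum_left inner_sum_right)
  qed
  also have "\<dots> = N" by simp
  finally have "norm (\<Sum>l<N. basis (inv z l)) = sqrt N" by (metis norm_ge_zero real_sqrt_unique)
  then have "norm (L.U' (e0 G)) = sqrt N / N" by (simp add: U)
  also have "\<dots> = 1 / sqrt N" using N by (subst frac_eq_eq) auto
  finally show ?thesis using L.W_le_U' by metis
qed

text \<open>\<open>vn_Ore\<close> is applied to \<open>Y = (1 - L)^2\<close> with \<open>L\<close>
  the left average. For \<open>d = 1 / sqrt N\<close> the vector \<open>Y \<delta>\<close> is within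
  \<open>3 d\<close> of \<delta>, so 1 exceeds its squared norm by at most \<open>6 d\<close>; the
  slack of \<open>vn_Ore\<close> is another \<open>d\<close>, which explains the 7. The solution is
  \<open>w = b \<delta>\<close>.\<close>

lemma Ore_average:
  fixes e :: real
  assumes inj: "inj_on z {..<N}" and v: "v \<in> vnvec G" and e: "7 / sqrt N \<le> e\<^sup>2" "e > 0"
  shows "\<exists>a\<in>near G e. \<exists>w\<in>vnvec G. a v = (w - ravg G N z w) - ravg G N z (w - ravg G N z w)"
proof -
  interpret L: unitary_average "\<lambda>k. lam G (z k)" "\<lambda>k. lam G (inv z k)" N "lavg G N z" by (rule lavg_average)
  obtain T where T: "T \<in> vn G" "v = T (e0 G)" using v by (auto simp: vnvec_def)
  let ?L = "lavg G N z" and ?R = "ravg G N z"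
  define Y where "Y f = (f - ?L f) - ?L (f - ?L f)" for f
  have Y: "Y \<in> vn G"
    unfolding Y_def[abs_def]
    by (rule vn_diff[OF vn_diff[OF vn_id lavg_vn] vn_compose[OF lavg_vn vn_diff[OF vn_id lavg_vn]]])
  have Yc: "norm (Y f) \<le> norm f" for f
    unfolding Y_def by (meson L.compl_contr order_trans)
  define d where "d = 1 / sqrt N"
  have d: "d > 0" "7 * d \<le> e\<^sup>2" using N e by (auto simp: d_def)
  have "norm (e0 G - Y (e0 G)) \<le> 3 * d"
  proof -
    have Ld: "norm (?L (e0 G)) \<le> d" using norm_lavg_e0[OF inj] by (simp add: d_def)
    have "norm (?L (e0 G - ?L (e0 G))) \<le> norm (?L (e0 G)) + norm (?L (?L (e0 G)))"
      using norm_triangle_ineq4 vn_linear[OF lavg_vn] by (simp add: linear_diff)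
    moreover have Lc: "norm (?L f) \<le> norm f" for f
    proof -
      have "norm (L.U' f) \<le> norm f"
      proof -
        have "norm (\<Sum>l<N. lam G (inv z l) f) \<le> (\<Sum>l<N. norm f)"
          by (rule sum_norm_le) (simp add: norm_lam z)
        then show ?thesis using N by (simp add: L.U'_def field_simps)
      qed
      then show ?thesis using L.W_le_U' order_trans by blast
    qed
    ultimately have "norm (?L (e0 G - ?L (e0 G))) \<le> 2 * d" using Ld Lc[of "?L (e0 G)"]
      by linarith
    moreover have "norm (e0 G - Y (e0 G)) \<le> norm (?L (e0 G)) + norm (?L (e0 G - ?L (e0 G)))"
      unfolding Y_def using norm_triangle_ineq[of "?L (e0 G)" "?L (e0 G - ?L (e0 G))"] by (simp add: algebra_simps)
    ultimately show ?thesis using Ld by linarith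
  qed
  then have Y1: "norm (Y (e0 G)) \<ge> 1 - 3 * d"
    using norm_triangle_ineq2[of "e0 G" "e0 G - Y (e0 G)"] by simp
  have "1 - (norm (Y (e0 G)))\<^sup>2 \<le> 6 * d"
  proof (cases "3 * d \<le> 1")
    case True
    then have "(1 - 3 * d)\<^sup>2 \<le> (norm (Y (e0 G)))\<^sup>2" using Y1 by (intro power_mono) auto
    moreover have "(1 - 3 * d)\<^sup>2 \<ge> 1 - 6 * d"
      using zero_le_power2[of d] by (simp add: power2_eq_square algebra_simps)
    ultimately show ?thesis by linarith
  next
    case False
    then show ?thesis using zero_le_power2[of "norm (Y (e0 G))"] by linarith
  qed
  moreover obtain a b where ab: "a \<in> vn G" "b \<in> vn G" "\<And>f. norm (a f) \<le> norm f"
    "(norm (a (e0 G) - e0 G))\<^sup>2 \<le> 1 - (norm (Y (e0 G)))\<^sup>2 + d" "\<And>f. a (T f) = b (Y f)"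
    using vn_Ore[OF T(1) Y Yc d(1)] by blast
  ultimately have "(norm (a (e0 G) - e0 G))\<^sup>2 \<le> e\<^sup>2" using d by linarith
  then have "norm (a (e0 G) - e0 G) \<le> e" by (rule power2_le_imp_le) (use e in simp)
  then have "a \<in> near G e" using ab by (simp add: near_def)
  moreover have "b (e0 G) \<in> vnvec G" using ab by (auto simp: vnvec_def)
  moreover have "a v = (b (e0 G) - ?R (b (e0 G))) - ?R (b (e0 G) - ?R (b (e0 G)))"
  proof -
    \<comment> \<open>\<open>?L\<close> commutes with \<open>?R\<close> and agrees with it at
      \<delta>, so one factor after the other can be replaced.\<close>
    have "?L (?L (e0 G)) = ?R (?R (e0 G))"
      using ravg_vn[OF lavg_vn, of "e0 G"] by (simp add: lavg_e0)
    then have "Y (e0 G) = (e0 G - ?R (e0 G)) - ?R (e0 G - ?R (e0 G))"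
      using vn_linear[OF lavg_vn] ravg_linear by (simp add: Y_def linear_diff lavg_e0)
    then show ?thesis
      using ab vn_linear[OF ab(2)] ravg_vn[OF ab(2)] by (simp add: T linear_diff)
  qed
  ultimately show ?thesis by blast
qed

end

text \<open>A common multiplier, built one vector at a time. A later factor \<open>b\<close>
  commutes with right averages, so it carries an earlier solution \<open>w i\<close> to the solution
  \<open>b (w i)\<close>.\<close>

lemma Ore_average_family:
  fixes e :: real
  assumes "finite I" and N: "N > 0" and e: "7 / sqrt N \<le> e\<^sup>2" "e > 0"
    and z: "\<And>i k. i \<in> I \<Longrightarrow> k < N \<Longrightarrow> z i k \<in> carrier G" "\<And>i. i \<in> I \<Longrightarrow> inj_on (z i) {..<N}"
    and v: "\<And>i. i \<in> I \<Longrightarrow> v i \<in> vnvec G"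
  shows "\<exists>a\<in>near G (card I * e). \<exists>w. \<forall>i\<in>I. w i \<in> vnvec G
    \<and> a (v i) = (w i - ravg G N (z i) (w i)) - ravg G N (z i) (w i - ravg G N (z i) (w i))"
  using assms(1) z v
proof (induction I)
  case empty
  then show ?case using near_id[of 0] by auto
next
  case (insert j I)
  have "\<exists>a\<in>near G (card I * e). \<exists>w. \<forall>i\<in>I. w i \<in> vnvec G
    \<and> a (v i) = (w i - ravg G N (z i) (w i)) - ravg G N (z i) (w i - ravg G N (z i) (w i))"
    by (rule insert.IH) (use insert.prems in auto)
  then obtain a w where a: "a \<in> near G (card I * e)" and aw: "\<forall>i\<in>I. w i \<in> vnvec G
    \<and> a (v i) = (w i - ravg G N (z i) (w i)) - ravg G N (z i) (w i - ravg G N (z i) (w i))"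
    by blast
  then have w: "\<And>i. i \<in> I \<Longrightarrow> w i \<in> vnvec G"
    "\<And>i. i \<in> I \<Longrightarrow> a (v i) = (w i - ravg G N (z i) (w i)) - ravg G N (z i) (w i - ravg G N (z i) (w i))"
    by blast+
  have zj: "\<And>k. k < N \<Longrightarrow> z j k \<in> carrier G" "inj_on (z j) {..<N}" and "a (v j) \<in> vnvec G"
    using insert.prems vnvec_apply[OF nearD(1)[OF a]] by auto
  then obtain b u where b: "b \<in> near G e" and u: "u \<in> vnvec G"
    "b (a (v j)) = (u - ravg G N (z j) u) - ravg G N (z j) (u - ravg G N (z j) u)"
    using Ore_average[OF N zj(1) zj(2) _ e] by blast
  have "(\<lambda>f. b (a f)) \<in> near G (card (insert j I) * e)"
    using near_compose[OF b a] insert.hyps by (simp add: algebra_simps)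
  moreover have "b (a (v i)) = (b (w i) - ravg G N (z i) (b (w i))) - ravg G N (z i) (b (w i) - ravg G N (z i) (b (w i)))"
    if "i \<in> I" for i
    using that w ravg_vn[OF N _ nearD(1)[OF b], of "z i"] insert.prems vn_linear[OF nearD(1)[OF b]]
    by (simp add: linear_diff)
  ultimately show ?case
    using u w vnvec_apply[OF nearD(1)[OF b]] insert.hyps
    by (intro bexI[of _ "\<lambda>f. b (a f)"] exI[of _ "\<lambda>i. if i = j then u else b (w i)"]) auto
qed

end

abbreviation "keys \<equiv> Poly_Mapping.keys"
abbreviation "lookup \<equiv> Poly_Mapping.lookup"
abbreviation "single \<equiv> Poly_Mapping.single"

section \<open>Linear extension\<close>

definition pext :: "('b \<Rightarrow> 'v \<Rightarrow> 'm) \<Rightarrow> ('b \<Rightarrow>\<^sub>0 'v::ab_group_add) \<Rightarrow> 'm::ab_group_add" where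
  "pext \<phi> c = (\<Sum>b\<in>keys c. \<phi> b (lookup c b))"

lemma additive_at_0: "additive f \<Longrightarrow> f 0 = 0" by (rule additive.zero)

lemma pext_superset:
  assumes "\<And>b. additive (\<phi> b)" "finite K" "keys c \<subseteq> K"
  shows "pext \<phi> c = (\<Sum>b\<in>K. \<phi> b (lookup c b))"
  unfolding pext_def using assms
  by (intro sum.mono_neutral_left) (auto simp: in_keys_iff additive_at_0)

lemma pext_additive:
  fixes \<phi> :: "'b \<Rightarrow> 'v::ab_group_add \<Rightarrow> 'm::ab_group_add"
  assumes "\<And>b. additive (\<phi> b)" shows "additive (pext \<phi>)"
proof (rule additive.intro)
  fix c d :: "'b \<Rightarrow>\<^sub>0 'v"
  let ?K = "keys c \<union> keys d"
  have "keys (c + d) \<subseteq> ?K" by (rule Poly_Mapping.keys_add)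
  then show "pext \<phi> (c + d) = pext \<phi> c + pext \<phi> d"
    using pext_superset[OF assms, of ?K] additive.add[OF assms]
    by (simp add: lookup_add sum.distrib)
qed

lemma pext_single: assumes "additive (\<phi> b)" shows "pext \<phi> (single b v) = \<phi> b v"
  by (cases "v = 0") (simp_all add: pext_def additive_at_0[OF assms])

lemma pext_0 [simp]: "pext \<phi> 0 = 0" by (simp add: pext_def)

lemma pext_cong: "(\<And>b. b \<in> keys c \<Longrightarrow> \<phi> b (lookup c b) = \<psi> b (lookup c b)) \<Longrightarrow> pext \<phi> c = pext \<psi> c"
  unfolding pext_def by (rule sum.cong) auto

lemma additive_pext: "additive F \<Longrightarrow> F (pext \<phi> c) = pext (\<lambda>b v. F (\<phi> b v)) c"
  unfolding pext_def by (rule additive.sum)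

lemma additive_single: "additive (single b)"
  by (rule additive.intro) (rule single_add)

lemma pext_id: "pext single c = c"
proof (rule poly_mapping_eqI)
  fix b
  have "lookup (pext single c) b = (\<Sum>b'\<in>keys c. lookup (single b' (lookup c b')) b)"
    by (simp add: pext_def lookup_sum)
  also have "\<dots> = (\<Sum>b'\<in>keys c. if b' = b then lookup c b else 0)"
    by (rule sum.cong) (auto simp: lookup_single when_def)
  also have "\<dots> = lookup c b" by (simp add: in_keys_iff)
  finally show "lookup (pext single c) b = lookup c b" .
qed

lemma additive_comp: "additive f \<Longrightarrow> additive g \<Longrightarrow> additive (\<lambda>x. f (g x))"
  by (auto simp: additive_def)

lemma additive_ext:
  assumes "additive F" "additive F'" "\<And>b v. b \<in> keys c \<Longrightarrow> v = lookup c b \<Longrightarrow> F (single b v) = F' (single b v)"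
  shows "F c = F' c"
proof -
  have "F (pext single c) = F' (pext single c)"
    unfolding additive_pext[OF assms(1)] additive_pext[OF assms(2)] using assms(3) by (rule pext_cong) auto
  then show ?thesis by (simp add: pext_id)
qed

lemma additive_zero_fun: "additive (\<lambda>_. 0)" by (rule additive.intro) simp

lemma additive_linear: "linear f \<Longrightarrow> additive f"
  by (rule additive.intro) (rule linear_add)

section \<open>Alternating sums over faces of a list\<close>

text \<open>The faces are handed to \<open>f\<close>, which builds the chains; so one recursion
  serves both the boundary in the group entries and the one in the tuples.\<close>

primrec bds :: "'a list \<Rightarrow> ('a list \<Rightarrow> 'm::ab_group_add) \<Rightarrow> 'm" where
  "bds [] f = 0"
| "bds (x # xs) f = f xs - bds xs (\<lambda>l. f (x # l))"

text \<open>The prism operator: position \<open>j\<close> contributes, with sign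
  \<open>(-1)^j\<close>, the list that follows \<open>xs\<close> through entry \<open>j\<close> and
  \<open>map z xs\<close> from entry \<open>j\<close> on.\<close>

primrec prs :: "('a \<Rightarrow> 'a) \<Rightarrow> 'a list \<Rightarrow> ('a list \<Rightarrow> 'm::ab_group_add) \<Rightarrow> 'm" where
  "prs z [] f = 0"
| "prs z (x # xs) f = f (x # z x # map z xs) - prs z xs (\<lambda>l. f (x # l))"

lemma bds_hom: "additive F \<Longrightarrow> F (bds xs f) = bds xs (\<lambda>l. F (f l))"
  by (induction xs arbitrary: f) (simp_all add: additive_at_0 additive.diff)

lemma prs_hom: "additive F \<Longrightarrow> F (prs z xs f) = prs z xs (\<lambda>l. F (f l))"
  by (induction xs arbitrary: f) (simp_all add: additive_at_0 additive.diff)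

lemma bds_diff: "bds xs (\<lambda>l. f l - g l) = bds xs f - bds xs g"
  by (induction xs arbitrary: f g) simp_all

lemma bds_add: "bds xs (\<lambda>l. f l + g l) = bds xs f + bds xs g"
  by (induction xs arbitrary: f g) (simp_all add: algebra_simps)

lemma prs_diff: "prs z xs (\<lambda>l. f l - g l) = prs z xs f - prs z xs g"
  by (induction xs arbitrary: f g) simp_all

lemma prs_add: "prs z xs (\<lambda>l. f l + g l) = prs z xs f + prs z xs g"
  by (induction xs arbitrary: f g) (simp_all add: algebra_simps)

lemma bds_zero: "bds xs (\<lambda>l. 0) = 0" and prs_zero: "prs z xs (\<lambda>l. 0) = 0"
  by (induction xs) simp_all

lemma bds_swap: "bds xs (\<lambda>l. bds ys (f l)) = bds ys (\<lambda>m. bds xs (\<lambda>l. f l m))"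
  by (induction xs arbitrary: f) (simp_all add: bds_zero bds_diff)

lemma bds_bds: "bds xs (\<lambda>l. bds l f) = 0"
  by (induction xs arbitrary: f) (simp_all add: bds_diff)

lemma bds_in:
  "P 0 \<Longrightarrow> (\<And>a b. P a \<Longrightarrow> P b \<Longrightarrow> P (a - b)) \<Longrightarrow>
    (\<And>l. Suc (length l) = length xs \<Longrightarrow> set l \<subseteq> set xs \<Longrightarrow> P (f l)) \<Longrightarrow> P (bds xs f)"
proof (induction xs arbitrary: f)
  case (Cons x xs)
  have "P (bds xs (\<lambda>l. f (x # l)))"
    by (rule Cons.IH) (auto intro!: Cons.prems)
  moreover have "P (f xs)" by (rule Cons.prems(3)) auto
  ultimately show ?case using Cons.prems(2) by simp
qed simp

lemma prs_in:
  "P 0 \<Longrightarrow> (\<And>a b. P a \<Longrightarrow> P b \<Longrightarrow> P (a - b)) \<Longrightarrow>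
    (\<And>l. length l = Suc (length xs) \<Longrightarrow> set l \<subseteq> set xs \<union> z ` set xs \<Longrightarrow> P (f l)) \<Longrightarrow> P (prs z xs f)"
proof (induction xs arbitrary: f)
  case (Cons x xs)
  have "P (prs z xs (\<lambda>l. f (x # l)))"
  proof (rule Cons.IH)
    fix l assume "length l = Suc (length xs)" "set l \<subseteq> set xs \<union> z ` set xs"
    then show "P (f (x # l))" by (intro Cons.prems(3)) auto
  qed (use Cons.prems in auto)
  moreover have "P (f (x # z x # map z xs))" by (rule Cons.prems(3)) auto
  ultimately show ?case using Cons.prems(2) by simp
qed simp

lemma bds_map: "bds (map h xs) f = bds xs (\<lambda>l. f (map h l))"
  by (induction xs arbitrary: f) simp_all

lemma prs_map:
  "(\<And>x. x \<in> set xs \<Longrightarrow> h (z x) = z' (h x)) \<Longrightarrow> prs z' (map h xs) f = prs z xs (\<lambda>l. f (map h l))"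
proof (induction xs arbitrary: f)
  case (Cons x xs)
  have "map z' (map h xs) = map h (map z xs)" using Cons.prems by auto
  moreover have "prs z' (map h xs) (\<lambda>l. f (h x # l)) = prs z xs (\<lambda>l. f (map h (x # l)))"
    using Cons.IH[of "\<lambda>l. f (h x # l)"] Cons.prems by simp
  moreover have "z' (h x) = h (z x)" using Cons.prems[of x] by simp
  ultimately show ?case by (simp del: map_map)
qed simp

text \<open>Neighbouring prisms share their inner faces with opposite signs, so only top and bottom
  remain.\<close>

lemma prism: "prs z xs (\<lambda>l. bds l f) + bds xs (\<lambda>l. prs z l f) = f (map z xs) - f xs"
proof (induction xs arbitrary: f)
  case (Cons x xs)
  have "prs z (x # xs) (\<lambda>l. bds l f) + bds (x # xs) (\<lambda>l. prs z l f)
    = bds (x # z x # map z xs) f - prs z xs (\<lambda>l. bds (x # l) f)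
      + (prs z xs f - bds xs (\<lambda>l. prs z (x # l) f))"
    by simp
  also have "prs z xs (\<lambda>l. bds (x # l) f) = prs z xs f - prs z xs (\<lambda>l. bds l (\<lambda>m. f (x # m)))"
    by (simp add: prs_diff)
  also have "bds xs (\<lambda>l. prs z (x # l) f)
    = bds xs (\<lambda>l. f (x # z x # map z l)) - bds xs (\<lambda>l. prs z l (\<lambda>m. f (x # m)))"
    by (simp add: bds_diff)
  also have "bds (x # z x # map z xs) f = f (z x # map z xs) - (f (x # map z xs) - bds xs (\<lambda>l. f (x # z x # map z l)))"
    by (simp add: bds_map)
  finally have eq: "prs z (x # xs) (\<lambda>l. bds l f) + bds (x # xs) (\<lambda>l. prs z l f)
    = f (z x # map z xs) - (f (x # map z xs) - bds xs (\<lambda>l. f (x # z x # map z l)))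
      - (prs z xs f - prs z xs (\<lambda>l. bds l (\<lambda>m. f (x # m))))
      + (prs z xs f - (bds xs (\<lambda>l. f (x # z x # map z l)) - bds xs (\<lambda>l. prs z l (\<lambda>m. f (x # m)))))" .
  show ?case unfolding eq using Cons.IH[of "\<lambda>m. f (x # m)"] by (simp add: algebra_simps)
qed simp

section \<open>Homogeneous chains over a G-set\<close>

text \<open>
  \<open>single (l, y) v\<close> stands for \<open>v \<otimes> (l, y)\<close> over the group ring, where \<open>G\<close> acts diagonally on \<open>(l, y)\<close> and
  by \<open>rho\<close> on the value.  The translate \<open>tr G act g c\<close> represents the same element as \<open>c\<close>, and \<open>nrm\<close> picks
  the representative whose lists start with \<open>\<one>\<close>, so that \<open>c\<close> and \<open>d\<close> are equal over the group ring if and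
  only if \<open>nrm G act c = nrm G act d\<close>.  Leaving \<open>single b v\<close> alone when the head is not in \<open>carrier G\<close>
  makes \<open>nrm\<close> additive on all chains.
\<close>

type_synonym ('g, 'y) chain = "'g list \<times> 'y \<Rightarrow>\<^sub>0 'g l2"

text \<open>Lists of length \<open>k\<close> have degree \<open>k - 1\<close>. Modulo the action
  these chains compute the homology of the stabilisers of points of \<open>Y\<close> with
  coefficients in the algebra, one summand for each orbit.\<close>

definition Ch :: "('g, 'x) monoid_scheme \<Rightarrow> 'y set \<Rightarrow> nat \<Rightarrow> ('g, 'y) chain set" where
  "Ch G Y k = {c. (\<forall>(l, y)\<in>keys c. length l = k \<and> set l \<subseteq> carrier G \<and> y \<in> Y)
    \<and> (\<forall>b. lookup c b \<in> vnvec G)}"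

definition tr :: "('g, 'x) monoid_scheme \<Rightarrow> ('g \<Rightarrow> 'y \<Rightarrow> 'y) \<Rightarrow> 'g \<Rightarrow> ('g, 'y) chain \<Rightarrow> ('g, 'y) chain" where
  "tr G act g = pext (\<lambda>(l, y) v. single (map (\<lambda>h. inv\<^bsub>G\<^esub> g \<otimes>\<^bsub>G\<^esub> h) l, act (inv\<^bsub>G\<^esub> g) y) (rho G g v))"

definition nrm :: "('g, 'x) monoid_scheme \<Rightarrow> ('g \<Rightarrow> 'y \<Rightarrow> 'y) \<Rightarrow> ('g, 'y) chain \<Rightarrow> ('g, 'y) chain" where
  "nrm G act = pext (\<lambda>b v. if hd (fst b) \<in> carrier G then tr G act (hd (fst b)) (single b v) else single b v)"

definition bdG :: "('g, 'y) chain \<Rightarrow> ('g, 'y) chain" where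
  "bdG = pext (\<lambda>(l, y) v. bds l (\<lambda>m. single (m, y) v))"

definition cf :: "('y \<Rightarrow> 'g l2 \<Rightarrow> 'g l2) \<Rightarrow> ('g, 'y) chain \<Rightarrow> ('g, 'y) chain" where
  "cf \<psi> = pext (\<lambda>(l, y) v. single (l, y) (\<psi> y v))"

definition prismG :: "('g, 'x) monoid_scheme \<Rightarrow> ('y \<Rightarrow> 'g) \<Rightarrow> ('g, 'y) chain \<Rightarrow> ('g, 'y) chain" where
  "prismG G \<zeta> = pext (\<lambda>(l, y) v. prs (\<lambda>h. \<zeta> y \<otimes>\<^bsub>G\<^esub> h) l (\<lambda>m. single (m, y) v))"

text \<open>Cycles and boundaries are taken modulo the diagonal action. In degree 0 every chain is a
  cycle, as \<open>bdG\<close> would only produce the augmentation on empty lists.\<close>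

definition tors :: "('g, 'x) monoid_scheme \<Rightarrow> ('g \<Rightarrow> 'y \<Rightarrow> 'y) \<Rightarrow> 'y set \<Rightarrow> nat \<Rightarrow> bool" where
  "tors G act Y i \<longleftrightarrow> (\<forall>c\<in>Ch G Y (Suc i). i = 0 \<or> nrm G act (bdG c) = 0 \<longrightarrow>
    (\<forall>e>0. \<exists>a\<in>near G e. \<exists>d\<in>Ch G Y (Suc (Suc i)). nrm G act (cf (\<lambda>_. a) c) = nrm G act (bdG d)))"

definition eqv :: "('g, 'x) monoid_scheme \<Rightarrow> ('g \<Rightarrow> 'y \<Rightarrow> 'y) \<Rightarrow> ('g \<Rightarrow> 'w \<Rightarrow> 'w) \<Rightarrow> 'y set \<Rightarrow> 'w set
    \<Rightarrow> nat \<Rightarrow> nat \<Rightarrow> (('g, 'y) chain \<Rightarrow> ('g, 'w) chain) \<Rightarrow> bool" where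
  "eqv G act act' Y Y' k k' F \<longleftrightarrow> additive F \<and> (\<forall>c\<in>Ch G Y k. F c \<in> Ch G Y' k') \<and>
    (\<forall>g\<in>carrier G. \<forall>l y v. length l = k \<and> set l \<subseteq> carrier G \<and> y \<in> Y \<and> v \<in> vnvec G \<longrightarrow>
       F (tr G act g (single (l, y) v)) = tr G act' g (F (single (l, y) v)))"

locale gset = group G for G :: "('g, 'x) monoid_scheme" (structure) +
  fixes act :: "'g \<Rightarrow> 'y \<Rightarrow> 'y" and Y :: "'y set"
  assumes act_closed: "g \<in> carrier G \<Longrightarrow> y \<in> Y \<Longrightarrow> act g y \<in> Y"
    and act_one: "y \<in> Y \<Longrightarrow> act \<one> y = y"
    and act_mult: "g \<in> carrier G \<Longrightarrow> h \<in> carrier G \<Longrightarrow> y \<in> Y \<Longrightarrow> act (g \<otimes> h) y = act g (act h y)"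

context group
begin

lemma rho_additive: "g \<in> carrier G \<Longrightarrow> additive (rho G g)"
  by (intro additive_linear bounded_linear.linear rho_linear)

lemma ChD: "c \<in> Ch G Y k \<Longrightarrow> (l, y) \<in> keys c \<Longrightarrow> length l = k \<and> set l \<subseteq> carrier G \<and> y \<in> Y"
  and Ch_lookup: "c \<in> Ch G Y k \<Longrightarrow> lookup c b \<in> vnvec G"
  by (auto simp: Ch_def) (cases b, auto)

lemma Ch_0: "0 \<in> Ch G Y k" by (simp add: Ch_def vnvec_zero)

lemma Ch_add: "c \<in> Ch G Y k \<Longrightarrow> d \<in> Ch G Y k \<Longrightarrow> c + d \<in> Ch G Y k"
  using Poly_Mapping.keys_add[of c d] by (fastforce simp: Ch_def lookup_add vnvec_add)

lemma Ch_uminus: "c \<in> Ch G Y k \<Longrightarrow> - c \<in> Ch G Y k"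
  by (simp add: Ch_def vnvec_uminus)

lemma Ch_diff: "c \<in> Ch G Y k \<Longrightarrow> d \<in> Ch G Y k \<Longrightarrow> c - d \<in> Ch G Y k"
  using Ch_add[of c Y k "- d"] Ch_uminus[of d] by simp

lemma Ch_sum: "(\<And>i. i \<in> I \<Longrightarrow> f i \<in> Ch G Y k) \<Longrightarrow> sum f I \<in> Ch G Y k"
  by (induction I rule: infinite_finite_induct) (auto intro: Ch_0 Ch_add)

lemma Ch_single:
  "length l = k \<Longrightarrow> set l \<subseteq> carrier G \<Longrightarrow> y \<in> Y \<Longrightarrow> v \<in> vnvec G \<Longrightarrow> single (l, y) v \<in> Ch G Y k"
  by (auto simp: Ch_def lookup_single when_def vnvec_zero)

lemma pext_Ch:
  assumes "c \<in> Ch G Y k"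
    and "\<And>l y v. length l = k \<Longrightarrow> set l \<subseteq> carrier G \<Longrightarrow> y \<in> Y \<Longrightarrow> v \<in> vnvec G \<Longrightarrow> \<phi> (l, y) v \<in> Ch G Y' k'"
  shows "pext \<phi> c \<in> Ch G Y' k'"
  unfolding pext_def
proof (rule Ch_sum)
  fix b assume "b \<in> keys c"
  then show "\<phi> b (lookup c b) \<in> Ch G Y' k'"
    using assms(2)[of "fst b" "snd b" "lookup c b"] ChD[OF assms(1), of "fst b" "snd b"] Ch_lookup[OF assms(1)] by simp
qed

lemma additive_Ch_ext:
  assumes "additive F" "additive F'" "c \<in> Ch G Y k"
    and "\<And>l y v. length l = k \<Longrightarrow> set l \<subseteq> carrier G \<Longrightarrow> y \<in> Y \<Longrightarrow> v \<in> vnvec G \<Longrightarrow>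
      F (single (l, y) v) = F' (single (l, y) v)"
  shows "F c = F' c"
proof (rule additive_ext[OF assms(1,2)])
  fix b v assume "b \<in> keys c" "v = lookup c b"
  then show "F (single b v) = F' (single b v)"
    using assms(4)[of "fst b" "snd b" v] ChD[OF assms(3), of "fst b" "snd b"] Ch_lookup[OF assms(3)] by simp
qed

lemma tr_additive: "g \<in> carrier G \<Longrightarrow> additive (tr G act g)"
  unfolding tr_def
  by (rule pext_additive) (auto intro!: additive_comp[OF additive_single rho_additive])

lemma tr_single: "g \<in> carrier G \<Longrightarrow> tr G act g (single (l, y) v)
    = single (map (\<lambda>h. inv g \<otimes> h) l, act (inv g) y) (rho G g v)"
  unfolding tr_def by (subst pext_single) (auto intro!: additive_comp[OF additive_single rho_additive])

lemma bdG_additive: "additive bdG"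
  unfolding bdG_def by (rule pext_additive) (auto intro!: additive.intro simp: single_add bds_add)

lemma bdG_single: "bdG (single (l, y) v) = bds l (\<lambda>m. single (m, y) v)"
  unfolding bdG_def by (subst pext_single) (auto intro!: additive.intro simp: single_add bds_add)

lemma cf_additive: "(\<And>y. additive (\<psi> y)) \<Longrightarrow> additive (cf \<psi>)"
  unfolding cf_def by (rule pext_additive) (auto intro!: additive_comp[OF additive_single])

lemma cf_single: "(\<And>y. additive (\<psi> y)) \<Longrightarrow> cf \<psi> (single (l, y) v) = single (l, y) (\<psi> y v)"
  unfolding cf_def by (subst pext_single) (auto intro!: additive_comp[OF additive_single])

lemma lookup_cf: assumes "\<And>y. additive (\<psi> y)" shows "lookup (cf \<psi> c) (l, y) = \<psi> y (lookup c (l, y))"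
proof (rule additive_ext[where c=c])
  show "additive (\<lambda>c. lookup (cf \<psi> c) (l, y))"
    by (rule additive.intro) (simp add: additive.add[OF cf_additive[OF assms]] lookup_add)
  show "additive (\<lambda>c. \<psi> y (lookup c (l, y)))"
    by (rule additive.intro) (simp add: additive.add[OF assms] lookup_add)
  show "lookup (cf \<psi> (single b v)) (l, y) = \<psi> y (lookup (single b v) (l, y))" for b v
    using assms by (cases b) (auto simp: cf_single lookup_single when_def additive_at_0)
qed

lemma cf_Ch: "(\<And>y. additive (\<psi> y)) \<Longrightarrow> (\<And>y v. y \<in> Y \<Longrightarrow> v \<in> vnvec G \<Longrightarrow> \<psi> y v \<in> vnvec G)
    \<Longrightarrow> c \<in> Ch G Y k \<Longrightarrow> cf \<psi> c \<in> Ch G Y k"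
  unfolding cf_def by (erule pext_Ch) (auto intro: Ch_single)

lemma bdG_Ch: "c \<in> Ch G Y (Suc k) \<Longrightarrow> bdG c \<in> Ch G Y k"
  unfolding bdG_def
proof (erule pext_Ch)
  fix l :: "'a list" and y v
  assume "length l = Suc k" "set l \<subseteq> carrier G" "y \<in> Y" "v \<in> vnvec G"
  then show "(case (l, y) of (l, y) \<Rightarrow> \<lambda>v. bds l (\<lambda>m. single (m, y) v)) v \<in> Ch G Y k"
    by (auto intro!: bds_in[where P="\<lambda>c. c \<in> Ch G Y k"] Ch_0 Ch_diff Ch_single)
qed

lemma bdG_bdG: "bdG (bdG c) = 0" for c :: "('a, 'y) chain"
proof (rule additive_ext[where F="\<lambda>c. bdG (bdG c)" and F'="\<lambda>_. 0" and c=c])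
  show "bdG (bdG (single b v)) = 0" for b :: "'a list \<times> 'y" and v :: "'a l2"
    by (cases b) (simp add: bdG_single bds_hom[OF bdG_additive] bds_bds)
qed (rule additive_comp[OF bdG_additive bdG_additive], rule additive_zero_fun)

lemma bdG_cf: assumes "\<And>y. additive (\<psi> y)" shows "bdG (cf \<psi> c) = cf \<psi> (bdG c)"
  by (rule additive_ext[OF additive_comp[OF bdG_additive cf_additive[OF assms]]
        additive_comp[OF cf_additive[OF assms] bdG_additive]])
    (auto simp: cf_single[OF assms] bdG_single bds_hom[OF cf_additive[OF assms]])

lemma vn_additive: "a \<in> vn G \<Longrightarrow> additive a"
  by (intro additive_linear vn_linear)

lemma near_additive: "a \<in> near G e \<Longrightarrow> additive a"
  by (intro vn_additive nearD)

lemma cf_cf: "(\<And>y. additive (\<psi> y)) \<Longrightarrow> (\<And>y. additive (\<phi> y)) \<Longrightarrow>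
    cf \<psi> (cf \<phi> c) = cf (\<lambda>y v. \<psi> y (\<phi> y v)) c"
  by (rule poly_mapping_eqI, case_tac k) (simp add: lookup_cf additive_comp)

end

section \<open>Chains modulo the diagonal action\<close>

context gset
begin

lemma act_inv: "g \<in> carrier G \<Longrightarrow> y \<in> Y \<Longrightarrow> act g (act (inv g) y) = y" "g \<in> carrier G \<Longrightarrow> y \<in> Y \<Longrightarrow> act (inv g) (act g y) = y"
  by (simp_all add: act_mult[symmetric] act_one)

lemma nrm_fun_additive: "additive (\<lambda>v. if hd (fst b) \<in> carrier G then tr G act (hd (fst b)) (single b v) else single b v)"
  by (cases "hd (fst b) \<in> carrier G") (auto intro: additive_comp[OF tr_additive additive_single] additive_single)

lemma nrm_additive: "additive (nrm G act)"
  unfolding nrm_def by (rule pext_additive[OF nrm_fun_additive])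

lemma nrm_single: "hd l \<in> carrier G \<Longrightarrow> nrm G act (single (l, y) v) = tr G act (hd l) (single (l, y) v)"
  unfolding nrm_def by (subst pext_single, rule nrm_fun_additive) simp

lemma hd_carrier: "length l = Suc k \<Longrightarrow> set l \<subseteq> carrier G \<Longrightarrow> hd l \<in> carrier G"
  by (cases l) auto

lemma nrm_tr: assumes g: "g \<in> carrier G" and c: "c \<in> Ch G Y (Suc k)"
  shows "nrm G act (tr G act g c) = nrm G act c"
proof (rule additive_Ch_ext[where F="\<lambda>c. nrm G act (tr G act g c)", OF _ nrm_additive c])
  show "additive (\<lambda>c. nrm G act (tr G act g c))"
    by (rule additive_comp[OF nrm_additive tr_additive[OF g]])
  fix l y v
  assume *: "length l = Suc k" "set l \<subseteq> carrier G" "y \<in> Y" "v \<in> vnvec G"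
  then obtain h m where l: "l = h # m" and h: "h \<in> carrier G" and m: "set m \<subseteq> carrier G"
    by (cases l) auto
  have m1: "map ((\<otimes>) (inv (inv g \<otimes> h))) (map ((\<otimes>) (inv g)) m) = map ((\<otimes>) (inv h)) m"
    using g h m by (auto simp: inv_mult_group m_assoc[symmetric] subset_iff) (simp add: m_assoc)
  have m2: "act (inv (inv g \<otimes> h)) (act (inv g) y) = act (inv h) y"
    using g h * by (simp add: act_mult[symmetric] inv_mult_group m_assoc)
  have m3: "rho G (inv g \<otimes> h) (rho G g v) = rho G h v"
    using g h by (simp add: rho_rho m_assoc[symmetric])
  show "nrm G act (tr G act g (single (l, y) v)) = nrm G act (single (l, y) v)"
    using g h by (simp add: l tr_single nrm_single m1 m2 m3 del: map_map)
qed

lemma eqvD: assumes "eqv G act act' Y Y' k k' F"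
  shows "additive F" "c \<in> Ch G Y k \<Longrightarrow> F c \<in> Ch G Y' k'"
    "g \<in> carrier G \<Longrightarrow> length l = k \<Longrightarrow> set l \<subseteq> carrier G \<Longrightarrow> y \<in> Y \<Longrightarrow> v \<in> vnvec G \<Longrightarrow>
      F (tr G act g (single (l, y) v)) = tr G act' g (F (single (l, y) v))"
  using assms by (auto simp: eqv_def)

text \<open>Normalising a generator translates it; an equivariant \<open>F\<close> turns this into a
  translation of the image, which \<open>nrm_tr\<close> removes. So \<open>F\<close> descends to
  chains modulo the action.\<close>

lemma nrm_eqv:
  assumes Y': "gset G act' Y'" and F: "eqv G act act' Y Y' (Suc k) (Suc k') F" and c: "c \<in> Ch G Y (Suc k)"
  shows "nrm G act' (F (nrm G act c)) = nrm G act' (F c)"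
proof -
  interpret Y': gset G act' Y' by (rule Y')
  note add = additive_comp[OF Y'.nrm_additive eqvD(1)[OF F]]
  show ?thesis
  proof (rule additive_Ch_ext[OF additive_comp[OF add nrm_additive] add c])
    fix l y v
    assume *: "length l = Suc k" "set l \<subseteq> carrier G" "y \<in> Y" "v \<in> vnvec G"
    have h: "hd l \<in> carrier G" using hd_carrier * by blast
    show "nrm G act' (F (nrm G act (single (l, y) v))) = nrm G act' (F (single (l, y) v))"
      unfolding nrm_single[OF h] eqvD(3)[OF F h *]
      by (rule Y'.nrm_tr[OF h eqvD(2)[OF F Ch_single[OF *]]])
  qed
qed

lemma nrm_eqv_cong:
  assumes "gset G act' Y'" "eqv G act act' Y Y' (Suc k) (Suc k') F"
    "c \<in> Ch G Y (Suc k)" "d \<in> Ch G Y (Suc k)" "nrm G act c = nrm G act d"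
  shows "nrm G act' (F c) = nrm G act' (F d)"
  using nrm_eqv[OF assms(1-3)] nrm_eqv[OF assms(1,2,4)] assms(5) by simp

lemma nrm_eqv_zero:
  assumes "gset G act' Y'" "eqv G act act' Y Y' (Suc k) (Suc k') F"
    "c \<in> Ch G Y (Suc k)" "nrm G act c = 0"
  shows "nrm G act' (F c) = 0"
proof -
  interpret Y': gset G act' Y' by (rule assms)
  show ?thesis
    using nrm_eqv_cong[OF assms(1-3) Ch_0] assms(4) additive_at_0[OF eqvD(1)[OF assms(2)]]
    by (simp add: additive_at_0[OF nrm_additive] additive_at_0[OF Y'.nrm_additive])
qed

lemma gset_self: "gset G act Y" by unfold_locales

lemma eqv_bdG: "eqv G act act Y Y (Suc k) k bdG"
  unfolding eqv_def
proof (intro conjI ballI allI impI)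
  fix g l y v assume g: "g \<in> carrier G"
  show "bdG (tr G act g (single (l, y) v)) = tr G act g (bdG (single (l, y) v))"
    by (simp add: tr_single[OF g] bdG_single bds_map bds_hom[OF tr_additive[OF g]])
qed (auto intro: bdG_additive bdG_Ch)

lemma eqv_cf:
  assumes a: "\<And>y. additive (\<psi> y)"
    and m: "\<And>y v. y \<in> Y \<Longrightarrow> v \<in> vnvec G \<Longrightarrow> \<psi> y v \<in> vnvec G"
    and e: "\<And>g y v. g \<in> carrier G \<Longrightarrow> y \<in> Y \<Longrightarrow> v \<in> vnvec G \<Longrightarrow> \<psi> (act (inv g) y) (rho G g v) = rho G g (\<psi> y v)"
  shows "eqv G act act Y Y k k (cf \<psi>)"
  unfolding eqv_def
  by (auto intro!: cf_additive a cf_Ch m simp: tr_single cf_single[OF a] e)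

lemma eqv_cf_vn: "a \<in> vn G \<Longrightarrow> eqv G act act Y Y k k (cf (\<lambda>_. a))"
  by (rule eqv_cf) (auto intro: vn_additive vnvec_apply simp: vnD(4))

text \<open>Coefficient maps change no list, so an equivariant one commutes with \<open>nrm\<close>
  on the nose. Kernels can therefore be examined coefficient by coefficient.\<close>

lemma nrm_cf:
  assumes e: "eqv G act act Y Y (Suc k) (Suc k) (cf \<psi>)" and a: "\<And>y. additive (\<psi> y)" and c: "c \<in> Ch G Y (Suc k)"
  shows "cf \<psi> (nrm G act c) = nrm G act (cf \<psi> c)"
proof (rule additive_Ch_ext[OF _ _ c])
  show "additive (\<lambda>c. cf \<psi> (nrm G act c))" "additive (\<lambda>c. nrm G act (cf \<psi> c))"
    by (rule additive_comp[OF cf_additive[OF a] nrm_additive] additive_comp[OF nrm_additive cf_additive[OF a]])+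
  fix l y v
  assume *: "length l = Suc k" "set l \<subseteq> carrier G" "y \<in> Y" "v \<in> vnvec G"
  have h: "hd l \<in> carrier G" using hd_carrier * by blast
  show "cf \<psi> (nrm G act (single (l, y) v)) = nrm G act (cf \<psi> (single (l, y) v))"
    using eqvD(3)[OF e h *] by (simp add: nrm_single h cf_single a)
qed

text \<open>\<open>Y'\<close> is an equivariant retract of \<open>Y\<close>: push a cycle to
  \<open>Y\<close> by \<open>f'\<close>, solve there and return by \<open>f\<close>.\<close>

lemma tors_transfer:
  assumes Y': "gset G act' Y'" and T: "tors G act Y i"
    and f: "\<And>y. y \<in> Y \<Longrightarrow> f y \<in> Y'" "\<And>g y. g \<in> carrier G \<Longrightarrow> y \<in> Y \<Longrightarrow> f (act g y) = act' g (f y)"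
    and f': "\<And>y. y \<in> Y' \<Longrightarrow> f' y \<in> Y" "\<And>g y. g \<in> carrier G \<Longrightarrow> y \<in> Y' \<Longrightarrow> f' (act' g y) = act g (f' y)"
    and ff': "\<And>y. y \<in> Y' \<Longrightarrow> f (f' y) = y"
  shows "tors G act' Y' i"
proof -
  interpret Y': gset G act' Y' by (rule Y')
  define F where "F = pext (\<lambda>(l :: 'g list, y) v :: 'g l2. single (l, f y) v)"
  define F' where "F' = pext (\<lambda>(l :: 'g list, y) v :: 'g l2. single (l, f' y) v)"
  have add: "additive F" "additive F'"
    unfolding F_def F'_def by (rule pext_additive, auto simp: additive_single)+
  have sgl: "F (single (l, y) v) = single (l, f y) v" "F' (single (l, y') v) = single (l, f' y') v" for l y y' v
    unfolding F_def F'_def by (subst pext_single, auto simp: additive_single)+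
  have F: "eqv G act act' Y Y' k k F" and F': "eqv G act' act Y' Y k k F'" for k
    unfolding eqv_def using add f f'
    by (auto simp: sgl tr_single) (auto simp: F_def F'_def intro!: pext_Ch[where Y=Y and k=k] pext_Ch[where Y=Y' and k=k] Ch_single)
  have bd: "bdG (F c) = F (bdG c)" for c
    by (rule additive_ext[OF additive_comp[OF bdG_additive add(1)] additive_comp[OF add(1) bdG_additive]])
      (auto simp: sgl bdG_single bds_hom[OF add(1)])
  have bd': "bdG (F' c) = F' (bdG c)" for c
    by (rule additive_ext[OF additive_comp[OF bdG_additive add(2)] additive_comp[OF add(2) bdG_additive]])
      (auto simp: sgl bdG_single bds_hom[OF add(2)])
  show ?thesis
    unfolding tors_def
  proof (intro ballI impI allI)
    fix c' and e :: real
    assume c': "c' \<in> Ch G Y' (Suc i)" and cyc: "i = 0 \<or> nrm G act' (bdG c') = 0" and e: "0 < e"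
    have Fc: "F' c' \<in> Ch G Y (Suc i)" using Y'.eqvD(2)[OF F' c'] .
    have "i = 0 \<or> nrm G act (bdG (F' c')) = 0"
    proof (cases i)
      case (Suc j)
      then have "bdG c' \<in> Ch G Y' (Suc j)" "nrm G act' (bdG c') = 0" using cyc c' by (auto intro: bdG_Ch)
      then show ?thesis unfolding bd' using Y'.nrm_eqv_zero[OF gset_self F'] by blast
    qed simp
    then obtain a d where a: "a \<in> near G e" and d: "d \<in> Ch G Y (Suc (Suc i))"
      and ad: "nrm G act (cf (\<lambda>_. a) (F' c')) = nrm G act (bdG d)"
      using T Fc e unfolding tors_def by blast
    have "nrm G act' (F (cf (\<lambda>_. a) (F' c'))) = nrm G act' (F (bdG d))"
      by (rule nrm_eqv_cong[OF Y' F _ _ ad])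
        (auto intro: bdG_Ch d cf_Ch Fc near_additive[OF a] vnvec_apply[OF nearD(1)[OF a]])
    moreover have "F (cf (\<lambda>_. a) (F' c')) = cf (\<lambda>_. a) c'"
    proof (rule additive_Ch_ext[OF _ _ c'])
      show "additive (\<lambda>c. F (cf (\<lambda>_. a) (F' c)))" "additive (cf (\<lambda>_. a) :: _ \<Rightarrow> ('g, 'd) chain)"
        by (rule additive_comp[OF add(1) additive_comp[OF cf_additive[OF near_additive[OF a]] add(2)]])
          (rule cf_additive[OF near_additive[OF a]])
    qed (simp add: sgl cf_single near_additive[OF a] ff')
    ultimately show "\<exists>a\<in>near G e. \<exists>d\<in>Ch G Y' (Suc (Suc i)). nrm G act' (cf (\<lambda>_. a) c') = nrm G act' (bdG d)"
      using a eqvD(2)[OF F d] by (metis bd)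
  qed
qed

end

section \<open>Resolving a G-set by tuples in the fibres of an equivariant map\<close>

locale fibred = gset G act Y for G :: "('g, 'x) monoid_scheme" (structure) and act :: "'g \<Rightarrow> 'y \<Rightarrow> 'y" and Y :: "'y set" +
  fixes Fib :: "'y \<Rightarrow> 'f set" and actf :: "'g \<Rightarrow> 'f \<Rightarrow> 'f"
  assumes fib_closed: "g \<in> carrier G \<Longrightarrow> y \<in> Y \<Longrightarrow> x \<in> Fib y \<Longrightarrow> actf g x \<in> Fib (act g y)"
    and fib_one: "y \<in> Y \<Longrightarrow> x \<in> Fib y \<Longrightarrow> actf \<one> x = x"
    and fib_mult: "g \<in> carrier G \<Longrightarrow> h \<in> carrier G \<Longrightarrow> y \<in> Y \<Longrightarrow> x \<in> Fib y \<Longrightarrow> actf (g \<otimes> h) x = actf g (actf h x)"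
    and fib_nonempty: "y \<in> Y \<Longrightarrow> Fib y \<noteq> {}"
begin

definition TY :: "nat \<Rightarrow> ('f list \<times> 'y) set" where
  "TY p = {(xs, y). y \<in> Y \<and> length xs = p \<and> set xs \<subseteq> Fib y}"

definition tact :: "'g \<Rightarrow> 'f list \<times> 'y \<Rightarrow> 'f list \<times> 'y" where
  "tact g = (\<lambda>(xs, y). (map (actf g) xs, act g y))"

definition sec :: "'y \<Rightarrow> 'f" where "sec y = (SOME x. x \<in> Fib y)"

lemma sec: "y \<in> Y \<Longrightarrow> sec y \<in> Fib y"
  unfolding sec_def using fib_nonempty by (simp add: some_in_eq)

lemma gset_T: "gset G tact (TY p)"
proof unfold_locales
  fix g h z assume z: "z \<in> TY p" and g: "g \<in> carrier G" and h: "h \<in> carrier G"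
  show "tact g z \<in> TY p"
    using z g by (auto simp: TY_def tact_def act_closed intro!: fib_closed)
  show "tact (g \<otimes> h) z = tact g (tact h z)"
    using z g h by (auto simp: TY_def tact_def act_mult subset_iff intro!: fib_mult)
next
  fix z assume z: "z \<in> TY p"
  show "tact \<one> z = z"
    using z by (auto simp: TY_def tact_def act_one subset_iff intro!: map_idI fib_one)
qed

definition bdX :: "('g, 'f list \<times> 'y) chain \<Rightarrow> ('g, 'f list \<times> 'y) chain" where
  "bdX = pext (\<lambda>(l, xs, y) v. bds xs (\<lambda>m. single (l, m, y) v))"

text \<open>The base point of the fibre is transported by the first group element to make the homotopy equivariant.\<close>

definition hX :: "('g, 'f list \<times> 'y) chain \<Rightarrow> ('g, 'f list \<times> 'y) chain" where
  "hX = pext (\<lambda>(l, xs, y) v. single (l, actf (hd l) (sec (act (inv (hd l)) y)) # xs, y) v)"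

lemma bdX_additive: "additive bdX"
  unfolding bdX_def by (rule pext_additive) (auto intro!: additive.intro simp: single_add bds_add)

lemma bdX_single: "bdX (single (l, xs, y) v) = bds xs (\<lambda>m. single (l, m, y) v)"
  unfolding bdX_def by (subst pext_single) (auto intro!: additive.intro simp: single_add bds_add)

lemma hX_additive: "additive hX"
  unfolding hX_def by (rule pext_additive) (auto simp: additive_single)

lemma hX_single: "hX (single (l, xs, y) v) = single (l, actf (hd l) (sec (act (inv (hd l)) y)) # xs, y) v"
  unfolding hX_def by (subst pext_single) (auto simp: additive_single)

text \<open>\<open>hX\<close> is a cone whose apex depends on the group entries and \<open>y\<close>
  but not on the tuple; the faces of a cone are the tuple itself and the cones over its
  faces.\<close>

lemma bdX_hX: "bdX (hX c) = c - hX (bdX c)"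
proof -
  have "additive (\<lambda>c. bdX (hX c) + hX (bdX c))"
    by (rule additive.intro) (simp add: additive.add[OF bdX_additive] additive.add[OF hX_additive])
  moreover have "additive (\<lambda>c::('g, 'f list \<times> 'y) chain. c)" by (rule additive.intro) simp
  ultimately have "bdX (hX c) + hX (bdX c) = c"
    by (rule additive_ext) (auto simp: bdX_single hX_single bds_hom[OF hX_additive])
  then show ?thesis by (simp add: algebra_simps)
qed

lemma bdX_bdX: "bdX (bdX c) = 0"
  by (rule additive_ext[OF additive_comp[OF bdX_additive bdX_additive] additive_zero_fun])
    (auto simp: bdX_single bds_hom[OF bdX_additive] bds_bds)

lemma bdG_bdX: "bdG (bdX c) = bdX (bdG c)"
  by (rule additive_ext[OF additive_comp[OF bdG_additive bdX_additive] additive_comp[OF bdX_additive bdG_additive]])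
    (auto simp: bdX_single bdG_single bds_hom[OF bdX_additive] bds_hom[OF bdG_additive] intro: bds_swap)

lemma bdX_cf: "additive a \<Longrightarrow> bdX (cf (\<lambda>_. a) c) = cf (\<lambda>_. a) (bdX c)"
  by (rule additive_ext[OF additive_comp[OF bdX_additive cf_additive] additive_comp[OF cf_additive bdX_additive]])
    (auto simp: bdX_single cf_single bds_hom[OF cf_additive])

lemma bdX_empty: "c \<in> Ch G (TY 0) k \<Longrightarrow> bdX c = 0"
  by (rule additive_Ch_ext[OF bdX_additive additive_zero_fun]) (auto simp: TY_def bdX_single)

lemma eqv_bdX: "eqv G tact tact (TY (Suc p)) (TY p) k k bdX"
  unfolding eqv_def
proof (intro conjI ballI allI impI)
  show "additive bdX" by (rule bdX_additive)
next
  fix c assume "c \<in> Ch G (TY (Suc p)) k"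
  then show "bdX c \<in> Ch G (TY p) k"
    unfolding bdX_def
  proof (rule pext_Ch)
    fix l z v
    assume *: "length l = k" "set l \<subseteq> carrier G" "z \<in> TY (Suc p)" "v \<in> vnvec G"
    obtain xs y where z: "z = (xs, y)" by (cases z)
    have "bds xs (\<lambda>m. single (l, m, y) v) \<in> Ch G (TY p) k"
      using * by (intro bds_in[where P="\<lambda>c. c \<in> Ch G (TY p) k"] Ch_0 Ch_diff Ch_single) (auto simp: z TY_def)
    then show "(case (l, z) of (l, xs, y) \<Rightarrow> \<lambda>v. bds xs (\<lambda>m. single (l, m, y) v)) v \<in> Ch G (TY p) k"
      by (simp add: z)
  qed
next
  fix g and l :: "'g list" and z :: "'f list \<times> 'y" and v :: "'g l2" assume g: "g \<in> carrier G"
  obtain xs y where z: "z = (xs, y)" by (cases z)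
  show "bdX (tr G tact g (single (l, z) v)) = tr G tact g (bdX (single (l, z) v))"
    by (simp add: z tr_single[OF g] bdX_single tact_def bds_map bds_hom[OF tr_additive[OF g]])
qed

lemma eqv_hX: "eqv G tact tact (TY p) (TY (Suc p)) (Suc k) (Suc k) hX"
  unfolding eqv_def
proof (intro conjI ballI allI impI)
  show "additive hX" by (rule hX_additive)
next
  fix c assume "c \<in> Ch G (TY p) (Suc k)"
  then show "hX c \<in> Ch G (TY (Suc p)) (Suc k)"
    unfolding hX_def
  proof (rule pext_Ch)
    fix l z v
    assume *: "length l = Suc k" "set l \<subseteq> carrier G" "z \<in> TY p" "v \<in> vnvec G"
    obtain xs y where z: "z = (xs, y)" by (cases z)
    have h: "hd l \<in> carrier G" using * hd_carrier by blast
    have y: "y \<in> Y" using * by (simp add: z TY_def)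
    have "actf (hd l) (sec (act (inv (hd l)) y)) \<in> Fib (act (hd l) (act (inv (hd l)) y))"
      by (intro fib_closed sec h act_closed y inv_closed)
    then have "single (l, actf (hd l) (sec (act (inv (hd l)) y)) # xs, y) v \<in> Ch G (TY (Suc p)) (Suc k)"
      using * h y by (intro Ch_single) (auto simp: z TY_def act_inv)
    then show "(case (l, z) of (l, xs, y) \<Rightarrow> \<lambda>v. single (l, actf (hd l) (sec (act (inv (hd l)) y)) # xs, y) v) v
        \<in> Ch G (TY (Suc p)) (Suc k)"
      by (simp add: z)
  qed
next
  fix g and l :: "'g list" and z :: "'f list \<times> 'y" and v :: "'g l2" assume g: "g \<in> carrier G"
  assume *: "length l = Suc k \<and> set l \<subseteq> carrier G \<and> z \<in> TY p \<and> v \<in> vnvec G"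
  obtain xs y where z: "z = (xs, y)" by (cases z)
  obtain h m where l: "l = h # m" and h: "h \<in> carrier G" using * by (cases l) auto
  have y: "y \<in> Y" using * by (simp add: z TY_def)
  have "act (inv (inv g \<otimes> h)) (act (inv g) y) = act (inv h) y"
    using g h y by (simp add: act_mult[symmetric] inv_mult_group m_assoc)
  then have "actf (inv g \<otimes> h) (sec (act (inv (inv g \<otimes> h)) (act (inv g) y)))
      = actf (inv g) (actf h (sec (act (inv h) y)))"
    using g h y by (simp add: fib_mult[OF _ _ act_closed sec[OF act_closed]])
  then show "hX (tr G tact g (single (l, z) v)) = tr G tact g (hX (single (l, z) v))"
    by (simp add: z l tr_single[OF g] hX_single tact_def)
qed

text \<open>Dimension shifting: a class over \<open>TY p\<close> killed by \<open>bdX\<close> comes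
  from \<open>TY (Suc p)\<close>, where torsion is known. The clause on \<open>bdX d\<close> in the
  conclusion ensures that the correction of a lift is invisible to \<open>bdX\<close>.\<close>

lemma tors_step:
  assumes T: "\<And>j q. 1 \<le> q \<Longrightarrow> j + q \<le> Suc m \<Longrightarrow> tors G tact (TY q) j"
  shows "i + p \<le> m \<Longrightarrow> c \<in> Ch G (TY p) (Suc i) \<Longrightarrow> i = 0 \<or> nrm G tact (bdG c) = 0
    \<Longrightarrow> nrm G tact (bdX c) = 0 \<Longrightarrow> e > 0 \<Longrightarrow>
    \<exists>a\<in>near G e. \<exists>d\<in>Ch G (TY p) (Suc (Suc i)).
      nrm G tact (cf (\<lambda>_. a) c) = nrm G tact (bdG d) \<and> nrm G tact (bdX d) = 0"
proof (induction i arbitrary: p c e)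
  \<comment> \<open>Exactness in the tuple direction: modulo the action, \<open>hX c\<close> is a
    preimage of \<open>c\<close> under \<open>bdX\<close>.\<close>
  have lift: "nrm G tact (bdX (hX c)) = nrm G tact c"
    if c: "c \<in> Ch G (TY p) (Suc i)" and x: "nrm G tact (bdX c) = 0" for c p i
  proof -
    interpret T1: gset G tact "TY p" by (rule gset_T)
    have "nrm G tact (hX (bdX c)) = 0"
    proof (cases p)
      case 0
      then show ?thesis using bdX_empty c
        by (simp add: additive_at_0[OF hX_additive] additive_at_0[OF T1.nrm_additive])
    next
      case (Suc q)
      interpret T0: gset G tact "TY q" by (rule gset_T)
      interpret Tq: gset G tact "TY (Suc q)" by (rule gset_T)
      have "bdX c \<in> Ch G (TY q) (Suc i)" using Tq.eqvD(2)[OF eqv_bdX] c Suc by blast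
      then show ?thesis using T0.nrm_eqv_zero[OF gset_T eqv_hX] x by blast
    qed
    then show ?thesis by (simp add: bdX_hX additive.diff[OF T1.nrm_additive])
  qed
  \<comment> \<open>For a cycle \<open>c'\<close> over \<open>TY (Suc p)\<close> above
    \<open>b c\<close>, torsion gives \<open>f\<close> bounding \<open>a c'\<close>; then
    \<open>bdX f\<close> bounds \<open>a b c\<close> and is killed by \<open>bdX\<close>.\<close>
  have finish: "\<exists>a\<in>near G (e' + e). \<exists>d\<in>Ch G (TY p) (Suc (Suc i)).
      nrm G tact (cf (\<lambda>_. a) c) = nrm G tact (bdG d) \<and> nrm G tact (bdX d) = 0"
    if ip: "i + p \<le> m" and c: "c \<in> Ch G (TY p) (Suc i)" and b: "b \<in> near G e"
      and c': "c' \<in> Ch G (TY (Suc p)) (Suc i)" and e': "e' > 0"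
      and cyc: "i = 0 \<or> nrm G tact (bdG c') = 0"
      and bd: "nrm G tact (bdX c') = nrm G tact (cf (\<lambda>_. b) c)" for i p c c' b e e'
  proof -
    interpret T0: gset G tact "TY p" by (rule gset_T)
    interpret T1: gset G tact "TY (Suc p)" by (rule gset_T)
    have "tors G tact (TY (Suc p)) i" using T[of "Suc p" i] ip by simp
    then obtain a f where a: "a \<in> near G e'" and f: "f \<in> Ch G (TY (Suc p)) (Suc (Suc i))"
      and af: "nrm G tact (cf (\<lambda>_. a) c') = nrm G tact (bdG f)"
      using c' cyc e' unfolding tors_def by blast
    note aa = near_additive[OF a] and bb = near_additive[OF b]
    have c'': "bdX c' \<in> Ch G (TY p) (Suc i)" using T1.eqvD(2)[OF eqv_bdX] c' by blast
    have bc: "cf (\<lambda>_. b) c \<in> Ch G (TY p) (Suc i)"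
      using T0.eqvD(2)[OF T0.eqv_cf_vn[OF nearD(1)[OF b]]] c by blast
    have ac: "cf (\<lambda>_. a) c' \<in> Ch G (TY (Suc p)) (Suc i)"
      using T1.eqvD(2)[OF T1.eqv_cf_vn[OF nearD(1)[OF a]]] c' by blast
    have "nrm G tact (bdG (bdX f)) = nrm G tact (bdX (cf (\<lambda>_. a) c'))"
      unfolding bdG_bdX by (rule T1.nrm_eqv_cong[OF gset_T eqv_bdX bdG_Ch[OF f] ac af[symmetric]])
    also have "\<dots> = nrm G tact (cf (\<lambda>_. a) (bdX c'))" by (simp add: bdX_cf[OF aa])
    also have "\<dots> = nrm G tact (cf (\<lambda>_. a) (cf (\<lambda>_. b) c))"
      by (rule T0.nrm_eqv_cong[OF gset_T T0.eqv_cf_vn[OF nearD(1)[OF a]] c'' bc bd])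
    also have "\<dots> = nrm G tact (cf (\<lambda>_ v. a (b v)) c)" by (simp add: cf_cf aa bb)
    finally have "nrm G tact (cf (\<lambda>_ v. a (b v)) c) = nrm G tact (bdG (bdX f))" by simp
    moreover have "nrm G tact (bdX (bdX f)) = 0" by (simp add: bdX_bdX additive_at_0[OF T0.nrm_additive])
    ultimately show ?thesis
      using near_compose[OF a b] T1.eqvD(2)[OF eqv_bdX f] by blast
  qed
  {
    case 0
    interpret T0: gset G tact "TY p" by (rule gset_T)
    have "cf (\<lambda>_ v. v) c = c"
      using pext_id[of c] by (simp add: cf_def split_def)
    then show ?case
      using finish[of 0 p c "\<lambda>v. v" "e/2" "hX c" "e/2"] 0 lift[of c p 0] near_id[of "e/2"] T0.eqvD(2)[OF eqv_hX] by simp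
  next
    case (Suc i)
    interpret T0: gset G tact "TY p" by (rule gset_T)
    interpret T1: gset G tact "TY (Suc p)" by (rule gset_T)
    have hc: "hX c \<in> Ch G (TY (Suc p)) (Suc (Suc i))" using T0.eqvD(2)[OF eqv_hX Suc.prems(2)] .
    have xh: "nrm G tact (bdX (hX c)) = nrm G tact c" using lift Suc.prems by blast
    \<comment> \<open>\<open>hX c\<close> need not be a cycle, but its boundary is a cycle of lower
      degree killed by \<open>bdX\<close>, so the induction hypothesis applies to it over
      \<open>TY (Suc p)\<close>.\<close>
    have "nrm G tact (bdX (bdG (hX c))) = nrm G tact (bdG c)"
      unfolding bdG_bdX[symmetric]
      by (rule T0.nrm_eqv_cong[OF gset_T T0.eqv_bdG _ _ xh]) (use Suc.prems T1.eqvD(2)[OF eqv_bdX hc] in auto)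
    then have 1: "nrm G tact (bdX (bdG (hX c))) = 0" using Suc.prems by simp
    have e: "e / 2 > 0" using Suc.prems by simp
    have "\<exists>a\<in>near G (e/2). \<exists>d\<in>Ch G (TY (Suc p)) (Suc (Suc i)).
      nrm G tact (cf (\<lambda>_. a) (bdG (hX c))) = nrm G tact (bdG d) \<and> nrm G tact (bdX d) = 0"
      by (rule Suc.IH[OF _ bdG_Ch[OF hc] _ 1 e])
        (use Suc.prems in \<open>auto simp: bdG_bdG additive_at_0[OF T0.nrm_additive]\<close>)
    then obtain a d where a: "a \<in> near G (e/2)" and d: "d \<in> Ch G (TY (Suc p)) (Suc (Suc i))"
      and ad: "nrm G tact (cf (\<lambda>_. a) (bdG (hX c))) = nrm G tact (bdG d)" and xd: "nrm G tact (bdX d) = 0"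
      by blast
    note aa = near_additive[OF a]
    have ahc: "cf (\<lambda>_. a) (hX c) \<in> Ch G (TY (Suc p)) (Suc (Suc i))"
      using T1.eqvD(2)[OF T1.eqv_cf_vn[OF nearD(1)[OF a]] hc] .
    \<comment> \<open>The corrected lift is a cycle, and it still lies above \<open>a c\<close>
      because \<open>bdX d\<close> vanishes modulo the action.\<close>
    have "nrm G tact (bdG (cf (\<lambda>_. a) (hX c) - d)) = 0"
      using ad by (simp add: additive.diff[OF bdG_additive] additive.diff[OF T0.nrm_additive] bdG_cf aa)
    moreover have "nrm G tact (bdX (cf (\<lambda>_. a) (hX c) - d)) = nrm G tact (cf (\<lambda>_. a) c)"
    proof -
      have "nrm G tact (cf (\<lambda>_. a) (bdX (hX c))) = nrm G tact (cf (\<lambda>_. a) c)"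
        by (rule T0.nrm_eqv_cong[OF gset_T T0.eqv_cf_vn[OF nearD(1)[OF a]] _ _ xh])
          (use Suc.prems T1.eqvD(2)[OF eqv_bdX hc] in auto)
      then show ?thesis
        by (simp add: additive.diff[OF bdX_additive] additive.diff[OF T0.nrm_additive] bdX_cf aa xd)
    qed
    ultimately show ?case
      using finish[OF Suc.prems(1,2) a Ch_diff[OF ahc d] e] by simp
  }
qed

text \<open>The case \<open>p = 0\<close> of \<open>tors_step\<close>: an empty tuple has no faces,
  so \<open>bdX\<close> kills every chain, and \<open>TY 0\<close> is a copy of
  \<open>Y\<close>.\<close>

lemma tors_base:
  assumes "\<And>j q. 1 \<le> q \<Longrightarrow> j + q \<le> Suc m \<Longrightarrow> tors G tact (TY q) j" "i \<le> m"
  shows "tors G act Y i"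
proof -
  interpret T0: gset G tact "TY 0" by (rule gset_T)
  have "tors G tact (TY 0) i"
    unfolding tors_def
  proof (intro ballI impI allI)
    fix c and e :: real
    assume c: "c \<in> Ch G (TY 0) (Suc i)" "i = 0 \<or> nrm G tact (bdG c) = 0" "0 < e"
    have "nrm G tact (bdX c) = 0"
      using bdX_empty[OF c(1)] by (simp add: additive_at_0[OF T0.nrm_additive])
    then show "\<exists>a\<in>near G e. \<exists>d\<in>Ch G (TY 0) (Suc (Suc i)). nrm G tact (cf (\<lambda>_. a) c) = nrm G tact (bdG d)"
      using tors_step[where m=m and p=0 and i=i and c=c and e=e] assms c by auto
  qed
  then show ?thesis
    by (rule T0.tors_transfer[OF gset_self, where f=snd and f'="\<lambda>y. ([], y)"])
      (auto simp: TY_def tact_def)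
qed

end

section \<open>Stabilisers with infinite centre\<close>

context gset
begin

lemma prismG_additive: "additive (prismG G \<zeta>)"
  unfolding prismG_def by (rule pext_additive) (auto intro!: additive.intro simp: single_add prs_add)

lemma prismG_single: "prismG G \<zeta> (single (l, y) v) = prs (\<lambda>h. \<zeta> y \<otimes> h) l (\<lambda>m. single (m, y) v)"
  unfolding prismG_def by (subst pext_single) (auto intro!: additive.intro simp: single_add prs_add)

lemma eqv_prismG:
  assumes z: "\<And>y. y \<in> Y \<Longrightarrow> \<zeta> y \<in> carrier G"
    and e: "\<And>g y. g \<in> carrier G \<Longrightarrow> y \<in> Y \<Longrightarrow> \<zeta> (act g y) = g \<otimes> \<zeta> y \<otimes> inv g"
  shows "eqv G act act Y Y k (Suc k) (prismG G \<zeta>)"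
  unfolding eqv_def
proof (intro conjI ballI allI impI)
  show "additive (prismG G \<zeta>)" by (rule prismG_additive)
next
  fix c assume "c \<in> Ch G Y k"
  then show "prismG G \<zeta> c \<in> Ch G Y (Suc k)"
    unfolding prismG_def
  proof (rule pext_Ch)
    fix l y v
    assume *: "length l = k" "set l \<subseteq> carrier G" "y \<in> Y" "v \<in> vnvec G"
    have "prs (\<lambda>h. \<zeta> y \<otimes> h) l (\<lambda>m. single (m, y) v) \<in> Ch G Y (Suc k)"
    proof (rule prs_in[where P="\<lambda>c. c \<in> Ch G Y (Suc k)"])
      fix m assume m: "length m = Suc (length l)" "set m \<subseteq> set l \<union> (\<otimes>) (\<zeta> y) ` set l"
      moreover have "set l \<union> (\<otimes>) (\<zeta> y) ` set l \<subseteq> carrier G" using * z by auto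
      ultimately show "single (m, y) v \<in> Ch G Y (Suc k)" using * by (intro Ch_single) auto
    qed (auto intro: Ch_0 Ch_diff)
    then show "(case (l, y) of (l, y) \<Rightarrow> \<lambda>v. prs ((\<otimes>) (\<zeta> y)) l (\<lambda>m. single (m, y) v)) v \<in> Ch G Y (Suc k)"
      by simp
  qed
next
  fix g l y v assume g: "g \<in> carrier G"
  assume *: "length l = k \<and> set l \<subseteq> carrier G \<and> y \<in> Y \<and> v \<in> vnvec G"
  have "prs ((\<otimes>) (\<zeta> (act (inv g) y))) (map ((\<otimes>) (inv g)) l) f
    = prs ((\<otimes>) (\<zeta> y)) l (\<lambda>m. f (map ((\<otimes>) (inv g)) m))" for f :: "'g list \<Rightarrow> ('g, 'y) chain"
  proof (rule prs_map)
    fix x assume "x \<in> set l"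
    then have x: "x \<in> carrier G" using * by auto
    show "inv g \<otimes> (\<zeta> y \<otimes> x) = \<zeta> (act (inv g) y) \<otimes> (inv g \<otimes> x)"
    proof -
      have "\<zeta> (act (inv g) y) \<otimes> (inv g \<otimes> x) = inv g \<otimes> \<zeta> y \<otimes> (g \<otimes> (inv g \<otimes> x))"
        using e[of "inv g" y] g * x z by (simp add: m_assoc)
      also have "g \<otimes> (inv g \<otimes> x) = x" using g x by (simp add: m_assoc[symmetric])
      finally show ?thesis using g x * z by (simp add: m_assoc)
    qed
  qed
  then show "prismG G \<zeta> (tr G act g (single (l, y) v)) = tr G act g (prismG G \<zeta> (single (l, y) v))"
    by (simp add: tr_single[OF g] prismG_single prs_hom[OF tr_additive[OF g]])
qed

text \<open>Right multiplication by a central section \<open>\<zeta>\<close> of the stabilisers is homotopic to the identity.\<close>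

lemma central_homotopy:
  assumes z: "\<And>y. y \<in> Y \<Longrightarrow> \<zeta> y \<in> carrier G" "\<And>y. y \<in> Y \<Longrightarrow> act (\<zeta> y) y = y"
    and e: "\<And>g y. g \<in> carrier G \<Longrightarrow> y \<in> Y \<Longrightarrow> \<zeta> (act g y) = g \<otimes> \<zeta> y \<otimes> inv g"
    and c: "c \<in> Ch G Y (Suc i)" and cyc: "i = 0 \<or> nrm G act (bdG c) = 0"
  defines "\<psi> \<equiv> \<lambda>y. if y \<in> Y then rho G (\<zeta> y) else (\<lambda>_. 0)"
  shows "\<exists>d\<in>Ch G Y (Suc (Suc i)). nrm G act (c - cf \<psi> c) = nrm G act (bdG d)"
proof -
  have \<psi>: "additive (\<psi> y)" for y
    by (auto simp: \<psi>_def rho_additive z additive_zero_fun)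
  define L where "L = pext (\<lambda>(l, y) v :: 'g l2. single (map (\<lambda>h. \<zeta> y \<otimes> h) l, y) v)"
  have L: "additive L" "L (single (l, y) v) = single (map (\<lambda>h. \<zeta> y \<otimes> h) l, y) v" for l y v
    unfolding L_def by (rule pext_additive, auto simp: additive_single) (subst pext_single, auto simp: additive_single)
  have "prismG G \<zeta> (bdG c) + bdG (prismG G \<zeta> c) = L c - c"
  proof (rule additive_ext[where F="\<lambda>c. prismG G \<zeta> (bdG c) + bdG (prismG G \<zeta> c)" and F'="\<lambda>c. L c - c"])
    show "additive (\<lambda>c. prismG G \<zeta> (bdG c) + bdG (prismG G \<zeta> c))"
      by (rule additive.intro) (simp add: additive.add[OF prismG_additive] additive.add[OF bdG_additive])
    show "additive (\<lambda>c. L c - c)"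
      by (rule additive.intro) (simp add: additive.add[OF L(1)])
    fix b :: "'g list \<times> 'y" and v :: "'g l2"
    show "prismG G \<zeta> (bdG (single b v)) + bdG (prismG G \<zeta> (single b v)) = L (single b v) - single b v"
      using prism[of "(\<otimes>) (\<zeta> (snd b))" "fst b" "\<lambda>m. single (m, snd b) v"]
      by (cases b) (simp add: L bdG_single prismG_single bds_hom[OF prismG_additive] prs_hom[OF bdG_additive] add.commute)
  qed
  then have eq: "bdG (prismG G \<zeta> c) = L c - c - prismG G \<zeta> (bdG c)" by (simp add: algebra_simps)
  have pc: "prismG G \<zeta> c \<in> Ch G Y (Suc (Suc i))" using eqvD(2)[OF eqv_prismG[OF z(1) e] c] by simp
  \<comment> \<open>In degree 0 \<open>bdG c\<close> lives on empty lists, over which there is no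
    prism.\<close>
  have n0: "nrm G act (prismG G \<zeta> (bdG c)) = 0"
  proof (cases i)
    case 0
    have "prismG G \<zeta> (bdG c) = 0"
    proof (rule additive_Ch_ext[OF additive_comp[OF prismG_additive bdG_additive] additive_zero_fun c])
      fix l :: "'g list" and y :: 'y and v :: "'g l2" assume "length l = Suc i"
      then obtain x where "l = [x]" using 0 by (cases l) auto
      then show "prismG G \<zeta> (bdG (single (l, y) v)) = 0"
        by (simp add: bdG_single prismG_single)
    qed
    then show ?thesis by (simp add: additive_at_0[OF nrm_additive])
  next
    case (Suc j)
    then have "bdG c \<in> Ch G Y (Suc j)" "nrm G act (bdG c) = 0" using c cyc by (auto intro: bdG_Ch)
    then show ?thesis using nrm_eqv_zero[OF gset_self eqv_prismG[OF z(1) e]] by blast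
  qed
  have "nrm G act (L c) = nrm G act (cf \<psi> c)"
  proof (rule additive_Ch_ext[OF additive_comp[OF nrm_additive L(1)] additive_comp[OF nrm_additive cf_additive[OF \<psi>]] c])
    fix l y v assume *: "length l = Suc i" "set l \<subseteq> carrier G" "y \<in> Y" "v \<in> vnvec G"
    have zy: "\<zeta> y \<in> carrier G" "act (\<zeta> y) y = y" using z * by auto
    \<comment> \<open>As \<open>\<zeta> y\<close> fixes \<open>y\<close>, multiplying the list by it
      is a diagonal translation, which is traded for \<open>rho\<close> on the coefficient.\<close>
    have "single (map ((\<otimes>) (\<zeta> y)) l, y) v = tr G act (inv \<zeta> y) (single (l, y) (rho G (\<zeta> y) v))"
      using zy by (simp add: tr_single rho_rho rho_one)
    moreover have "cf \<psi> (single (l, y) v) = single (l, y) (rho G (\<zeta> y) v)"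
      using *(3) by (subst cf_single[OF \<psi>]) (simp add: \<psi>_def)
    ultimately show "nrm G act (L (single (l, y) v)) = nrm G act (cf \<psi> (single (l, y) v))"
      using nrm_tr[OF inv_closed[OF zy(1)] Ch_single[OF *(1-3) vnvec_rho[OF zy(1) *(4)]]]
      by (simp add: L(2))
  qed
  then have "nrm G act (c - cf \<psi> c) = nrm G act (bdG (- prismG G \<zeta> c))"
    by (simp add: additive.minus[OF bdG_additive] additive.minus[OF nrm_additive] eq additive.diff[OF nrm_additive] n0)
  then show ?thesis using Ch_uminus[OF pc] by blast
qed

definition bdry :: "nat \<Rightarrow> ('g, 'y) chain set" where
  "bdry i = {c. \<exists>d\<in>Ch G Y (Suc (Suc i)). nrm G act c = nrm G act (bdG d)}"

lemma bdry_add: "c \<in> bdry i \<Longrightarrow> d \<in> bdry i \<Longrightarrow> c + d \<in> bdry i"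
  unfolding bdry_def
  by (auto simp: additive.add[OF nrm_additive] intro!: bexI[OF _ Ch_add] simp: additive.add[OF bdG_additive])

lemma bdry_sum: "(\<And>i. i \<in> I \<Longrightarrow> f i \<in> bdry k) \<Longrightarrow> sum f I \<in> bdry k"
proof (induction I rule: infinite_finite_induct)
  have "0 \<in> bdry k" unfolding bdry_def
    by (auto simp: additive_at_0[OF nrm_additive] additive_at_0[OF bdG_additive] intro!: bexI[OF _ Ch_0])
  then show "sum f {} \<in> bdry k" "\<And>A. infinite A \<Longrightarrow> sum f A \<in> bdry k" by simp_all
qed (auto intro: bdry_add)

text \<open>This is the complement \<open>1 - w\<close>, not the average. Off \<open>Y\<close> the
  average counts as 0, in accordance with \<open>\<psi>\<close> in
  \<open>average_homotopy\<close>.\<close>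

definition ravgs :: "nat \<Rightarrow> ('y \<Rightarrow> nat \<Rightarrow> 'g) \<Rightarrow> 'y \<Rightarrow> 'g l2 \<Rightarrow> 'g l2" where
  "ravgs N z y v = (if y \<in> Y then v - ravg G N (z y) v else v)"

text \<open>\<open>c (1 - w)\<close> is the sum over all pairs \<open>k, l\<close> of
  \<open>c' - c' z k z l^{-1}\<close> with \<open>c' = c / N^2\<close>, and each summand is a
  boundary by \<open>central_homotopy\<close>.\<close>

lemma average_homotopy:
  assumes N: "N > 0"
    and z: "\<And>y k. y \<in> Y \<Longrightarrow> k < N \<Longrightarrow> z y k \<in> carrier G" "\<And>y k. y \<in> Y \<Longrightarrow> k < N \<Longrightarrow> act (z y k) y = y"
    and e: "\<And>g y k. g \<in> carrier G \<Longrightarrow> y \<in> Y \<Longrightarrow> k < N \<Longrightarrow> z (act g y) k = g \<otimes> z y k \<otimes> inv g"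
    and c: "c \<in> Ch G Y (Suc i)" and cyc: "i = 0 \<or> nrm G act (bdG c) = 0"
  shows "cf (ravgs N z) c \<in> bdry i"
proof -
  let ?r = "1 / (real N)\<^sup>2"
  define c' where "c' = cf (\<lambda>_ v. ?r *\<^sub>R v) c"
  have r: "(\<lambda>v. ?r *\<^sub>R v) \<in> vn G" by (rule vn_scaleR[OF vn_id])
  note ra = vn_additive[OF r]
  have c': "c' \<in> Ch G Y (Suc i)" unfolding c'_def using eqvD(2)[OF eqv_cf_vn[OF r] c] .
  have cyc': "i = 0 \<or> nrm G act (bdG c') = 0"
  proof (cases i)
    case (Suc j)
    then have "bdG c \<in> Ch G Y (Suc j)" "nrm G act (bdG c) = 0" using c cyc by (auto intro: bdG_Ch)
    then show ?thesis unfolding c'_def bdG_cf[OF ra]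
      using nrm_eqv_zero[OF gset_self eqv_cf_vn[OF r]] by blast
  qed simp
  define \<psi> where "\<psi> k l y = (if y \<in> Y then rho G (z y k \<otimes> inv z y l) else (\<lambda>_. 0))" for k l y
  have \<psi>: "additive (\<psi> k l y)" if "k < N" "l < N" for k l y
    using z that by (auto simp: \<psi>_def rho_additive additive_zero_fun)
  have b: "c' - cf (\<psi> k l) c' \<in> bdry i" if kl: "k < N" "l < N" for k l
  proof -
    have "act (z y k \<otimes> inv z y l) y = y" if "y \<in> Y" for y
    proof -
      have "act (inv z y l) y = y" using act_inv(2)[of "z y l" y] z that kl by simp
      then show ?thesis using z that kl by (simp add: act_mult)
    qed
    moreover have "z (act g y) k \<otimes> inv z (act g y) l = g \<otimes> (z y k \<otimes> inv z y l) \<otimes> inv g"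
      if "g \<in> carrier G" "y \<in> Y" for g y
    proof -
      have "inv z (act g y) l = g \<otimes> inv z y l \<otimes> inv g"
        using e[OF that kl(2)] that z kl by (simp add: inv_mult_group m_assoc)
      moreover have "inv g \<otimes> (g \<otimes> x) = x" if "x \<in> carrier G" for x
        using \<open>g \<in> carrier G\<close> that by (simp add: m_assoc[symmetric])
      ultimately show ?thesis using e[OF that kl(1)] that z kl by (simp add: m_assoc)
    qed
    ultimately show ?thesis
      unfolding bdry_def \<psi>_def using central_homotopy[of "\<lambda>y. z y k \<otimes> inv z y l", OF _ _ _ c' cyc'] z kl by simp
  qed
  have "cf (ravgs N z) c = (\<Sum>k<N. \<Sum>l<N. c' - cf (\<psi> k l) c')"
  proof (rule poly_mapping_eqI)
    fix b :: "'g list \<times> 'y"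
    obtain l y where b: "b = (l, y)" by (cases b)
    have R: "additive (ravgs N z y)" for y
    proof (rule additive.intro)
      fix v w
      show "ravgs N z y (v + w) = ravgs N z y v + ravgs N z y w"
        using ravg_linear[OF N, of "z y"] z by (auto simp: ravgs_def linear_add)
    qed
    let ?v = "lookup c b"
    have "lookup (\<Sum>k<N. \<Sum>l<N. c' - cf (\<psi> k l) c') b = (\<Sum>k<N. \<Sum>l<N. ?r *\<^sub>R ?v - \<psi> k l y (?r *\<^sub>R ?v))"
      by (simp add: lookup_sum lookup_minus b lookup_cf \<psi> c'_def lookup_cf[OF ra])
    also have "\<dots> = ?v - (\<Sum>k<N. \<Sum>l<N. \<psi> k l y (?r *\<^sub>R ?v))"
      using N by (simp add: sum_subtractf sum_constant_scaleR power2_eq_square)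
    also have "\<dots> = ravgs N z y ?v"
    proof (cases "y \<in> Y")
      case True
      have "\<psi> k l y (?r *\<^sub>R ?v) = ?r *\<^sub>R rho G (z y k \<otimes> inv z y l) ?v" if "k < N" "l < N" for k l
        using z True that by (simp add: \<psi>_def linear_scale[OF bounded_linear.linear[OF rho_linear]])
      then show ?thesis using True by (simp add: ravgs_def ravg_def scaleR_sum_right)
    qed (simp add: \<psi>_def ravgs_def)
    also have "\<dots> = lookup (cf (ravgs N z) c) b" by (simp add: b lookup_cf[OF R])
    finally show "lookup (cf (ravgs N z) c) b = lookup (\<Sum>k<N. \<Sum>l<N. c' - cf (\<psi> k l) c') b" by simp
  qed
  then show ?thesis using b by (auto intro!: bdry_sum)
qed

text \<open>
  By the Ore condition \<open>a c = d (1 - w)\<^sup>2\<close> for some chain \<open>d\<close>.  As \<open>1 - w\<close> is self-adjoint, \<open>(1 - w)\<^sup>2\<close> and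
  \<open>1 - w\<close> have the same kernel, so \<open>d (1 - w)\<close> is a cycle along with \<open>a c\<close>, and therefore
  \<open>a c = d (1 - w) - d (1 - w) w\<close> is a boundary.
\<close>

lemma tors_central_family:
  assumes fam: "\<And>N::nat. \<exists>z. \<forall>y\<in>Y. inj_on (z y) {..<N} \<and> (\<forall>k<N. z y k \<in> carrier G \<and> act (z y k) y = y
    \<and> (\<forall>g\<in>carrier G. z (act g y) k = g \<otimes> z y k \<otimes> inv g))"
  shows "tors G act Y i"
  unfolding tors_def
proof (intro ballI impI allI)
  fix c and e :: real
  assume c: "c \<in> Ch G Y (Suc i)" and cyc: "i = 0 \<or> nrm G act (bdG c) = 0" and e: "0 < e"
  define I where "I = keys c"
  have fI: "finite I" by (simp add: I_def)
  \<comment> \<open>Each of the \<open>card I\<close> coefficients costs \<open>\<eta>\<close> in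
    \<open>Ore_average_family\<close>; the added 1 covers \<open>c = 0\<close>.\<close>
  define \<eta> where "\<eta> = e / real (card I + 1)"
  have \<eta>: "\<eta> > 0" "card I * \<eta> \<le> e" using e by (auto simp: \<eta>_def field_simps)
  obtain N where N: "N > 0" "7 / sqrt (real N) \<le> \<eta>\<^sup>2"
  proof -
    obtain N :: nat where n: "(7 / \<eta>\<^sup>2)\<^sup>2 < real N" using reals_Archimedean2 by blast
    then have p: "N > 0" using zero_le_power2[of "7 / \<eta>\<^sup>2"] by (cases N) auto
    have "7 / \<eta>\<^sup>2 \<le> sqrt N" using n by (intro real_le_rsqrt) simp
    then have "7 \<le> sqrt N * \<eta>\<^sup>2" using \<eta>(1) by (simp add: pos_divide_le_eq)
    then have "7 / sqrt N \<le> \<eta>\<^sup>2" using p by (simp add: pos_divide_le_eq mult.commute)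
    then show ?thesis using that p by blast
  qed
  obtain z where zz: "\<forall>y\<in>Y. inj_on (z y) {..<N} \<and> (\<forall>k<N. z y k \<in> carrier G \<and> act (z y k) y = y
    \<and> (\<forall>g\<in>carrier G. z (act g y) k = g \<otimes> z y k \<otimes> inv g))" using fam[of N] by blast
  have z: "\<And>y. y \<in> Y \<Longrightarrow> inj_on (z y) {..<N}" "\<And>y k. y \<in> Y \<Longrightarrow> k < N \<Longrightarrow> z y k \<in> carrier G"
    "\<And>y k. y \<in> Y \<Longrightarrow> k < N \<Longrightarrow> act (z y k) y = y"
    "\<And>g y k. g \<in> carrier G \<Longrightarrow> y \<in> Y \<Longrightarrow> k < N \<Longrightarrow> z (act g y) k = g \<otimes> z y k \<otimes> inv g"
    using zz by simp_all
  have IY: "snd b \<in> Y" if "b \<in> I" for b using ChD[OF c, of "fst b" "snd b"] that by (simp add: I_def)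
  have "\<exists>a\<in>near G (card I * \<eta>). \<exists>w. \<forall>b\<in>I. w b \<in> vnvec G \<and>
    a (lookup c b) = (w b - ravg G N (z (snd b)) (w b)) - ravg G N (z (snd b)) (w b - ravg G N (z (snd b)) (w b))"
    by (rule Ore_average_family[OF fI N(1) N(2) \<eta>(1)]) (auto intro: z IY Ch_lookup[OF c])
  then obtain a w where a: "a \<in> near G (card I * \<eta>)" and w: "\<forall>b\<in>I. w b \<in> vnvec G \<and>
    a (lookup c b) = (w b - ravg G N (z (snd b)) (w b)) - ravg G N (z (snd b)) (w b - ravg G N (z (snd b)) (w b))"
    by blast
  have a': "a \<in> near G e" using a \<eta>(2) by (auto simp: near_def)
  note aa = near_additive[OF a]
  let ?\<Phi> = "cf (ravgs N z) :: ('g, 'y) chain \<Rightarrow> ('g, 'y) chain"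
  have R: "additive (ravgs N z y)" for y
  proof (rule additive.intro)
    fix v w
    show "ravgs N z y (v + w) = ravgs N z y v + ravgs N z y w"
      using ravg_linear[OF N(1), of "z y"] z by (auto simp: ravgs_def linear_add)
  qed
  have Req: "eqv G act act Y Y k k ?\<Phi>" for k
  proof (rule eqv_cf[OF R])
    fix y v assume "y \<in> Y" "v \<in> vnvec G"
    then show "ravgs N z y v \<in> vnvec G"
      using z by (auto simp: ravgs_def intro!: vnvec_diff ravg_vnvec[OF N(1)])
  next
    fix g y v assume g: "g \<in> carrier G" and y: "y \<in> Y"
    \<comment> \<open>The elements at the moved point are conjugates; moving the translation by
      \<open>g\<close> past them undoes the conjugation, so the average is equivariant.\<close>
    have "rho G (z (act (inv g) y) k \<otimes> inv z (act (inv g) y) l) (rho G g v) = rho G g (rho G (z y k \<otimes> inv z y l) v)"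
      if kl: "k < N" "l < N" for k l
    proof -
      have zz: "z (act (inv g) y) k = inv g \<otimes> z y k \<otimes> g" "z (act (inv g) y) l = inv g \<otimes> z y l \<otimes> g"
        using z(4)[of "inv g" y] g y kl by auto
      have "g \<otimes> (inv g \<otimes> x) = x" if "x \<in> carrier G" for x
        using g that by (simp add: m_assoc[symmetric])
      then have "g \<otimes> (z (act (inv g) y) k \<otimes> inv z (act (inv g) y) l) = z y k \<otimes> inv z y l \<otimes> g"
        unfolding zz using z(2)[OF y] g kl by (simp add: m_assoc inv_mult_group)
      then show ?thesis
        using z(2)[OF y] z(2)[of "act (inv g) y"] g y kl by (simp add: rho_rho act_closed)
    qed
    then have "ravg G N (z (act (inv g) y)) (rho G g v) = rho G g (ravg G N (z y) v)"
      using g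
      by (simp add: ravg_def linear_sum[OF bounded_linear.linear[OF rho_linear[OF g]]] linear_scale[OF bounded_linear.linear[OF rho_linear[OF g]]])
    then show "ravgs N z (act (inv g) y) (rho G g v) = rho G g (ravgs N z y v)"
      using g y by (simp add: ravgs_def act_closed linear_diff[OF bounded_linear.linear[OF rho_linear[OF g]]])
  qed
  define d where "d = (\<Sum>b\<in>I. single b (w b))"
  have d: "d \<in> Ch G Y (Suc i)"
    unfolding d_def
  proof (rule Ch_sum)
    fix b assume b: "b \<in> I"
    then show "single b (w b) \<in> Ch G Y (Suc i)"
      using ChD[OF c, of "fst b" "snd b"] w Ch_single[of "fst b" "Suc i" "snd b" Y "w b"] by (auto simp: I_def)
  qed
  have ac: "cf (\<lambda>_. a) c = ?\<Phi> (?\<Phi> d)"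
  proof -
    have "c = (\<Sum>b\<in>I. single b (lookup c b))" using pext_id[of c] by (simp add: pext_def I_def)
    then have "cf (\<lambda>_. a) c = (\<Sum>b\<in>I. cf (\<lambda>_. a) (single b (lookup c b)))"
      using additive.sum[OF cf_additive[OF aa], where A=I and g="\<lambda>b. single b (lookup c b)"] by metis
    also have "\<dots> = (\<Sum>b\<in>I. ?\<Phi> (?\<Phi> (single b (w b))))"
    proof (rule sum.cong[OF refl])
      fix b assume b: "b \<in> I"
      obtain l y where ly: "b = (l, y)" by (cases b)
      have "y \<in> Y" using IY[OF b] ly by simp
      then show "cf (\<lambda>_. a) (single b (lookup c b)) = ?\<Phi> (?\<Phi> (single b (w b)))"
        using w b by (auto simp: ly cf_single[OF R] cf_single[OF aa] ravgs_def)
    qed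
    also have "\<dots> = ?\<Phi> (?\<Phi> d)"
      by (simp add: d_def additive.sum[OF cf_additive[OF R]])
    finally show ?thesis .
  qed
  have \<Phi>d: "?\<Phi> d \<in> Ch G Y (Suc i)" using eqvD(2)[OF Req d] .
  have cyc\<Phi>: "i = 0 \<or> nrm G act (bdG (?\<Phi> d)) = 0"
  proof (cases i)
    case (Suc j)
    let ?b = "nrm G act (bdG d)"
    have bd: "bdG d \<in> Ch G Y (Suc j)" "bdG (?\<Phi> d) \<in> Ch G Y (Suc j)"
      using d \<Phi>d Suc by (auto intro: bdG_Ch)
    have "bdG c \<in> Ch G Y (Suc j)" "nrm G act (bdG c) = 0" using c cyc Suc by (auto intro: bdG_Ch)
    then have "nrm G act (bdG (cf (\<lambda>_. a) c)) = 0"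
      unfolding bdG_cf[OF aa] using nrm_eqv_zero[OF gset_self eqv_cf_vn[OF nearD(1)[OF a]]] by blast
    \<comment> \<open>By \<open>nrm_cf\<close> this is an equation of chains and not only modulo the
      action, so \<open>ravg_kernel\<close> applies to each coefficient.\<close>
    then have "?\<Phi> (?\<Phi> ?b) = 0"
      unfolding ac bdG_cf[OF R] nrm_cf[OF Req R bd(1)]
      using nrm_cf[OF Req R bd(2)] by (simp add: bdG_cf[OF R])
    have "?\<Phi> ?b = 0"
    proof (rule poly_mapping_eqI)
      fix b :: "'g list \<times> 'y"
      obtain l y where ly: "b = (l, y)" by (cases b)
      have "lookup (?\<Phi> (?\<Phi> ?b)) (l, y) = ravgs N z y (ravgs N z y (lookup ?b (l, y)))"
        by (simp only: lookup_cf[OF R])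
      then have *: "ravgs N z y (ravgs N z y (lookup ?b (l, y))) = 0"
        unfolding \<open>?\<Phi> (?\<Phi> ?b) = 0\<close> by simp
      have "ravgs N z y (lookup ?b (l, y)) = 0"
        using * ravg_kernel[OF N(1), of "z y" "lookup ?b (l, y)"] z(2)
        by (cases "y \<in> Y") (auto simp: ravgs_def)
      then show "lookup (?\<Phi> ?b) b = lookup 0 b" by (simp add: ly lookup_cf[OF R])
    qed
    then show ?thesis using nrm_cf[OF Req R bd(1)] by (simp add: bdG_cf[OF R])
  qed simp
  have "?\<Phi> (?\<Phi> d) \<in> bdry i"
    by (rule average_homotopy[OF N(1) _ _ _ \<Phi>d cyc\<Phi>]) (simp_all add: z)
  then show "\<exists>a\<in>near G e. \<exists>d\<in>Ch G Y (Suc (Suc i)). nrm G act (cf (\<lambda>_. a) c) = nrm G act (bdG d)"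
    using a' unfolding ac[symmetric] bdry_def by blast
qed

text \<open>Elements are chosen at one representative of each orbit and transported by conjugation.
  Two transporters differ by an element of the stabiliser, which commutes with the chosen elements;
  hence the transport is equivariant.\<close>

theorem tors_central_stabilizers:
  assumes inf: "\<And>y. y \<in> Y \<Longrightarrow>
    infinite {z \<in> carrier G. act z y = y \<and> (\<forall>s\<in>carrier G. act s y = y \<longrightarrow> s \<otimes> z = z \<otimes> s)}"
  shows "tors G act Y i"
proof (rule tors_central_family)
  fix N :: nat
  define orb where "orb y = {act g y |g. g \<in> carrier G}" for y
  have orb_eq: "orb (act g y) = orb y" if "g \<in> carrier G" "y \<in> Y" for g y
  proof -
    have "act h y = act (h \<otimes> inv g) (act g y)" if "h \<in> carrier G" for h
      using that \<open>g \<in> carrier G\<close> \<open>y \<in> Y\<close> by (simp add: act_mult act_inv act_closed)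
    moreover have "act h (act g y) = act (h \<otimes> g) y" if "h \<in> carrier G" for h
      using that \<open>g \<in> carrier G\<close> \<open>y \<in> Y\<close> by (simp add: act_mult)
    ultimately show ?thesis using that unfolding orb_def by (metis (no_types, opaque_lifting) inv_closed m_closed)
  qed
  \<comment> \<open>The choice depends only on the set \<open>orb y\<close>, so points of one orbit
    share their representative.\<close>
  define r where "r y = (SOME x. x \<in> orb y)" for y
  have r: "\<exists>t\<in>carrier G. act t (r y) = y" "r y \<in> Y" if y: "y \<in> Y" for y
  proof -
    have "y \<in> orb y" using act_one[OF y] by (auto simp: orb_def intro!: exI[of _ \<one>])
    then have "r y \<in> orb y" unfolding r_def by (rule someI)
    then obtain g where "g \<in> carrier G" "r y = act g y" by (auto simp: orb_def)
    then show "\<exists>t\<in>carrier G. act t (r y) = y" "r y \<in> Y" using y act_inv(2) act_closed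
      by (auto intro!: bexI[of _ "inv g"])
  qed
  define t where "t y = (SOME t. t \<in> carrier G \<and> act t (r y) = y)" for y
  have t: "t y \<in> carrier G" "act (t y) (r y) = y" if "y \<in> Y" for y
    using someI_ex[of "\<lambda>t. t \<in> carrier G \<and> act t (r y) = y"] r(1)[OF that] unfolding t_def by blast+
  let ?Z = "\<lambda>y. {z \<in> carrier G. act z y = y \<and> (\<forall>s\<in>carrier G. act s y = y \<longrightarrow> s \<otimes> z = z \<otimes> s)}"
  have "\<forall>y\<in>Y. \<exists>f::nat \<Rightarrow> 'g. inj f \<and> range f \<subseteq> ?Z y"
    using infinite_countable_subset[OF inf] by blast
  from bchoice[OF this] obtain f :: "'y \<Rightarrow> nat \<Rightarrow> 'g" where ff: "\<forall>y\<in>Y. inj (f y) \<and> range (f y) \<subseteq> ?Z y"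
    by blast
  then have f: "inj (f y)" "f y k \<in> ?Z y" if "y \<in> Y" for y k
    using that by (blast, blast)
  define z where "z y k = t y \<otimes> f (r y) k \<otimes> inv t y" for y and k :: nat
  show "\<exists>z. \<forall>y\<in>Y. inj_on (z y) {..<N} \<and> (\<forall>k<N. z y k \<in> carrier G \<and> act (z y k) y = y
    \<and> (\<forall>g\<in>carrier G. z (act g y) k = g \<otimes> z y k \<otimes> inv g))"
  proof (intro exI[of _ z] ballI conjI allI impI)
    fix y assume y: "y \<in> Y"
    note ry = r(2)[OF y] and ty = t[OF y]
    have fk: "f (r y) k \<in> carrier G" "act (f (r y) k) (r y) = r y"
      "\<And>s. s \<in> carrier G \<Longrightarrow> act s (r y) = r y \<Longrightarrow> s \<otimes> f (r y) k = f (r y) k \<otimes> s" for k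
      using f(2)[OF ry] by auto
    show "inj_on (z y) {..<N}"
      using ty fk f(1)[OF ry] by (auto simp: z_def inj_on_def inj_def)
    fix k
    show zc: "z y k \<in> carrier G" using ty fk by (simp add: z_def)
    have inv_t: "act (inv t y) y = r y" using act_inv(2)[OF ty(1) ry] ty(2) by simp
    show "act (z y k) y = y"
      using ty fk inv_t y ry by (simp add: z_def act_mult act_closed)
    fix g assume g: "g \<in> carrier G"
    have gy: "act g y \<in> Y" using act_closed g y by blast
    have rg: "r (act g y) = r y" using orb_eq[OF g y] by (simp add: r_def)
    \<comment> \<open>\<open>s\<close> compares the two ways from the representative to
      \<open>act g y\<close>; it lies in the stabiliser of the representative.\<close>
    define s where "s = inv t (act g y) \<otimes> (g \<otimes> t y)"
    have s: "s \<in> carrier G" "act s (r y) = r y"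
      using t[OF gy] ty g ry act_inv(2)[OF t(1)[OF gy] ry] by (simp_all add: s_def act_mult rg act_closed)
    have gt: "g \<otimes> t y = t (act g y) \<otimes> s"
      using t[OF gy] ty g by (simp add: s_def m_assoc[symmetric])
    have "g \<otimes> z y k \<otimes> inv g = (g \<otimes> t y) \<otimes> f (r y) k \<otimes> inv (g \<otimes> t y)"
      using g ty fk by (simp add: z_def inv_mult_group m_assoc)
    also have "\<dots> = t (act g y) \<otimes> (s \<otimes> f (r y) k) \<otimes> inv s \<otimes> inv t (act g y)"
      unfolding gt using s(1) t(1)[OF gy] fk(1) by (simp add: inv_mult_group m_assoc)
    also have "\<dots> = z (act g y) k"
    proof -
      have "s \<otimes> (inv s \<otimes> inv t (act g y)) = inv t (act g y)"
        using s t[OF gy] by (simp add: m_assoc[symmetric])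
      then show ?thesis
        unfolding fk(3)[OF s] using s(1) t(1)[OF gy] fk(1) by (simp add: z_def rg m_assoc)
    qed
    finally show "z (act g y) k = g \<otimes> z y k \<otimes> inv g" by simp
  qed
qed

end

text \<open>The fibre over \<open>y\<close> consists of the cosets \<open>A y #> h\<close>. An
  element mapping one of them to itself lies in \<open>A y\<close>, while \<open>A y\<close> fixes
  them all; so a nonempty tuple over \<open>y\<close> has stabiliser \<open>A y\<close>, which is
  infinite and abelian.\<close>

theorem (in gset) tors_normal_subgroups:
  assumes sub: "\<And>y. y \<in> Y \<Longrightarrow> subgroup (A y) G"
    and stab: "\<And>y a. y \<in> Y \<Longrightarrow> a \<in> A y \<Longrightarrow> act a y = y"
    and comm: "\<And>y a b. y \<in> Y \<Longrightarrow> a \<in> A y \<Longrightarrow> b \<in> A y \<Longrightarrow> a \<otimes> b = b \<otimes> a"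
    and inf: "\<And>y. y \<in> Y \<Longrightarrow> infinite (A y)"
    and conj: "\<And>g y a. g \<in> carrier G \<Longrightarrow> y \<in> Y \<Longrightarrow> a \<in> A y \<Longrightarrow> g \<otimes> a \<otimes> inv g \<in> A (act g y)"
  shows "tors G act Y i"
proof -
  have Ac: "a \<in> carrier G" if "y \<in> Y" "a \<in> A y" for a y using subgroup.mem_carrier[OF sub] that by blast
  define Fib where "Fib y = {A y #> h |h. h \<in> carrier G}" for y
  define actf where "actf g C = (\<lambda>c. g \<otimes> c) ` C" for g C
  have FibE: "\<exists>h\<in>carrier G. C = A y #> h" if "C \<in> Fib y" for C y using that by (auto simp: Fib_def)
  have Cc: "c \<in> carrier G" if "y \<in> Y" "C \<in> Fib y" "c \<in> C" for c C y
    using FibE[OF that(2)] that Ac by (auto simp: r_coset_def)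
  \<comment> \<open>\<open>g A h = (g A g^{-1}) g h\<close>; the reverse inclusion uses
    \<open>conj\<close> for \<open>inv g\<close>.\<close>
  have translate: "actf g (A y #> h) = A (act g y) #> (g \<otimes> h)"
    if g: "g \<in> carrier G" and y: "y \<in> Y" and h: "h \<in> carrier G" for g y h
  proof
    show "actf g (A y #> h) \<subseteq> A (act g y) #> (g \<otimes> h)"
    proof
      fix x assume "x \<in> actf g (A y #> h)"
      then obtain a where a: "a \<in> A y" "x = g \<otimes> (a \<otimes> h)" by (auto simp: actf_def r_coset_def)
      have "x = (g \<otimes> a \<otimes> inv g) \<otimes> (g \<otimes> h)"
      proof -
        have "inv g \<otimes> (g \<otimes> h) = h" using g h by (simp add: m_assoc[symmetric])
        then show ?thesis using a g h Ac[OF y a(1)] by (simp add: m_assoc)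
      qed
      then show "x \<in> A (act g y) #> (g \<otimes> h)" using conj[OF g y a(1)] by (auto simp: r_coset_def)
    qed
    show "A (act g y) #> (g \<otimes> h) \<subseteq> actf g (A y #> h)"
    proof
      fix x assume "x \<in> A (act g y) #> (g \<otimes> h)"
      then obtain b where b: "b \<in> A (act g y)" "x = b \<otimes> (g \<otimes> h)" by (auto simp: r_coset_def)
      have bc: "b \<in> carrier G" using Ac[OF act_closed[OF g y] b(1)] .
      have "inv g \<otimes> b \<otimes> inv (inv g) \<in> A (act (inv g) (act g y))"
        using conj[of "inv g" "act g y" b] g y b act_closed by auto
      then have "inv g \<otimes> b \<otimes> g \<in> A y" using g y by (simp add: act_inv)
      moreover have "x = g \<otimes> ((inv g \<otimes> b \<otimes> g) \<otimes> h)"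
      proof -
        have "g \<otimes> (inv g \<otimes> (b \<otimes> (g \<otimes> h))) = b \<otimes> (g \<otimes> h)" using g h bc by (simp add: m_assoc[symmetric])
        then show ?thesis using b g h bc by (simp add: m_assoc)
      qed
      ultimately show "x \<in> actf g (A y #> h)" by (auto simp: actf_def r_coset_def)
    qed
  qed
  interpret F: fibred G act Y Fib actf
  proof unfold_locales
    fix g y C assume g: "g \<in> carrier G" "y \<in> Y" "C \<in> Fib y"
    then obtain h where h: "h \<in> carrier G" "C = A y #> h" using FibE by blast
    show "actf g C \<in> Fib (act g y)"
      unfolding h(2) translate[OF g(1,2) h(1)] Fib_def using g h by blast
  next
    fix y C assume "y \<in> Y" "C \<in> Fib y"
    then show "actf \<one> C = C" using Cc by (auto simp: actf_def image_iff)
  next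
    fix g h y C assume "g \<in> carrier G" "h \<in> carrier G" "y \<in> Y" "C \<in> Fib y"
    then show "actf (g \<otimes> h) C = actf g (actf h C)"
      unfolding actf_def image_image using Cc by (intro image_cong) (auto simp: m_assoc)
  next
    fix y assume "y \<in> Y"
    show "Fib y \<noteq> {}" by (auto simp: Fib_def)
  qed
  have "tors G F.tact (F.TY q) j" if q: "1 \<le> q" for q j
  proof (rule gset.tors_central_stabilizers[OF F.gset_T])
    fix z assume z: "z \<in> F.TY q"
    obtain Cs y where zy: "z = (Cs, y)" by (cases z)
    obtain C Ds where Cs: "Cs = C # Ds" using z q by (cases Cs) (auto simp: zy F.TY_def)
    have y: "y \<in> Y" and Cf: "\<And>D. D \<in> set Cs \<Longrightarrow> D \<in> Fib y" using z by (auto simp: zy F.TY_def)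
    interpret Ay: subgroup "A y" G by (rule sub[OF y])
    have "A y \<subseteq> {a \<in> carrier G. F.tact a z = z \<and> (\<forall>s\<in>carrier G. F.tact s z = z \<longrightarrow> s \<otimes> a = a \<otimes> s)}"
    proof safe
      fix a assume a: "a \<in> A y"
      show ac: "a \<in> carrier G" using Ac[OF y a] .
      have "actf a D = D" if D: "D \<in> set Cs" for D
      proof -
        obtain h where h: "h \<in> carrier G" "D = A y #> h" using FibE[OF Cf[OF D]] by blast
        have "actf a D = (A y #> a) #> h"
          using translate[OF ac y h(1)] stab[OF y a] ac h Ay.subset by (simp add: coset_mult_assoc)
        also have "A y #> a = A y" using a by (simp add: Ay.rcos_const is_group)
        finally show ?thesis using h by simp
      qed
      then show "F.tact a z = z" using stab[OF y a] by (simp add: zy F.tact_def map_idI)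
      fix s assume s: "s \<in> carrier G" "F.tact s z = z"
      obtain h where h: "h \<in> carrier G" "C = A y #> h" using FibE[OF Cf] Cs by auto
      have "h \<in> C" using h Ay.one_closed by (force simp: r_coset_def)
      moreover have "actf s C = C" using s(2) by (simp add: zy Cs F.tact_def)
      ultimately have "s \<otimes> h \<in> A y #> h" using h by (metis actf_def imageI)
      then obtain b where b: "b \<in> A y" "s \<otimes> h = b \<otimes> h" by (auto simp: r_coset_def)
      then have "s = b" using s h Ac[OF y] by (metis right_cancel)
      then show "s \<otimes> a = a \<otimes> s" using comm[OF y a b(1)] by simp
    qed
    then show "infinite {a \<in> carrier G. F.tact a z = z \<and> (\<forall>s\<in>carrier G. F.tact s z = z \<longrightarrow> s \<otimes> a = a \<otimes> s)}"
      using inf[OF y] infinite_super by blast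
  qed
  then show ?thesis by (intro F.tors_base[where m=i]) auto
qed

text \<open>The tuples of elements of \<open>Y\<close> resolve a single point, and
  \<open>tors_normal_subgroups\<close> handles each set of tuples. Degrees up to \<open>m\<close>
  need tuples of up to \<open>Suc m\<close> entries.\<close>

theorem (in gset) tors_point:
  assumes ne: "Y \<noteq> {}"
    and sub: "\<And>xs. set xs \<subseteq> Y \<Longrightarrow> 1 \<le> length xs \<Longrightarrow> length xs \<le> Suc m \<Longrightarrow> subgroup (A xs) G"
    and stab: "\<And>xs a x. set xs \<subseteq> Y \<Longrightarrow> a \<in> A xs \<Longrightarrow> x \<in> set xs \<Longrightarrow> act a x = x"
    and comm: "\<And>xs a b. set xs \<subseteq> Y \<Longrightarrow> a \<in> A xs \<Longrightarrow> b \<in> A xs \<Longrightarrow> a \<otimes> b = b \<otimes> a"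
    and inf: "\<And>xs. set xs \<subseteq> Y \<Longrightarrow> 1 \<le> length xs \<Longrightarrow> length xs \<le> Suc m \<Longrightarrow> infinite (A xs)"
    and conj: "\<And>g xs a. g \<in> carrier G \<Longrightarrow> set xs \<subseteq> Y \<Longrightarrow> a \<in> A xs \<Longrightarrow> g \<otimes> a \<otimes> inv g \<in> A (map (act g) xs)"
    and i: "i \<le> m"
  shows "tors G (\<lambda>_ _. ()) {()} i"
proof -
  interpret P: fibred G "\<lambda>_ _. ()" "{()}" "\<lambda>_. Y" act
    by unfold_locales (auto simp: act_closed act_one act_mult ne)
  have "tors G P.tact (P.TY q) j" if q: "1 \<le> q" "j + q \<le> Suc m" for q j
  proof -
    interpret T: gset G P.tact "P.TY q" by (rule P.gset_T)
    show ?thesis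
    proof (rule T.tors_normal_subgroups[where A="\<lambda>z. A (fst z)"])
      fix z a assume z: "z \<in> P.TY q" "a \<in> A (fst z)"
      then have "map (act a) (fst z) = fst z" by (auto simp: P.TY_def intro!: map_idI stab)
      then show "P.tact a z = z" by (cases z) (simp add: P.tact_def)
    qed (use q sub comm inf conj in \<open>auto simp: P.TY_def P.tact_def\<close>)
  qed
  then show ?thesis using P.tors_base[of m i] i by blast
qed

section \<open>The group von Neumann algebra as the commutant\<close>

definition lop :: "('g, 'x) monoid_scheme \<Rightarrow> ('g l2 \<Rightarrow> 'g l2) \<Rightarrow> ('g \<Rightarrow> complex) \<Rightarrow> 'g \<Rightarrow> complex" where
  "lop G A = (\<lambda>f\<in>ell2 G. coord (A (Abs_l2 f)))"

text \<open>Evaluation at \<delta> is injective on the algebra, so its identities can be checked on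
  vectors of \<open>l2\<close>.\<close>

definition symb :: "('g, 'x) monoid_scheme \<Rightarrow> (('g \<Rightarrow> complex) \<Rightarrow> 'g \<Rightarrow> complex) \<Rightarrow> 'g l2" where
  "symb G T = Abs_l2 (T (coord (e0 G)))"

context group
begin

lemma ell2D: assumes "f \<in> ell2 G"
  shows "x \<notin> carrier G \<Longrightarrow> f x = 0" "coord (Abs_l2 f) = f" "restr (carrier G) (Abs_l2 f) = Abs_l2 f"
    "norm (Abs_l2 f) = ell2_norm G f"
proof -
  show z: "x \<notin> carrier G \<Longrightarrow> f x = 0" for x using assms by (simp add: ell2_def)
  have "(\<lambda>x. (cmod (f x))\<^sup>2) summable_on carrier G" using assms by (simp add: ell2_def)
  moreover have "(\<lambda>x. (cmod (f x))\<^sup>2) summable_on carrier G \<longleftrightarrow> (\<lambda>x. (cmod (f x))\<^sup>2) summable_on UNIV"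
    by (rule summable_on_cong_neutral) (auto simp: z)
  ultimately show c: "coord (Abs_l2 f) = f" by (simp add: coord_Abs)
  show "restr (carrier G) (Abs_l2 f) = Abs_l2 f"
    by (rule l2_eqI) (auto simp: coord_restr c z)
  have "(\<Sum>\<^sub>\<infinity>x. (cmod (f x))\<^sup>2) = (\<Sum>\<^sub>\<infinity>x\<in>carrier G. (cmod (f x))\<^sup>2)"
    by (rule infsum_cong_neutral) (auto simp: z)
  then have "(norm (Abs_l2 f))\<^sup>2 = (\<Sum>\<^sub>\<infinity>x\<in>carrier G. (cmod (f x))\<^sup>2)" by (simp add: norm_sq c)
  then show "norm (Abs_l2 f) = ell2_norm G f"
    unfolding ell2_norm_def by (metis norm_ge_zero real_sqrt_unique)
qed

lemma ell2I: assumes "\<And>x. x \<notin> carrier G \<Longrightarrow> coord v x = 0" shows "coord v \<in> ell2 G"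
proof -
  have "(\<lambda>x. (cmod (coord v x))\<^sup>2) summable_on carrier G \<longleftrightarrow> (\<lambda>x. (cmod (coord v x))\<^sup>2) summable_on UNIV"
    by (rule summable_on_cong_neutral) (auto simp: assms)
  then show ?thesis using assms coord_summable[of v] by (auto simp: ell2_def)
qed

lemma Abs_coord [simp]: "Abs_l2 (coord v) = v" by (rule coord_inverse)

lemma restr_ell2: "restr (carrier G) v = v \<Longrightarrow> coord v \<in> ell2 G"
  by (rule ell2I) (metis coord_restr)

lemma coord_restr_ell2: "coord (restr (carrier G) v) \<in> ell2 G"
  by (rule ell2I) (simp add: coord_restr)

lemma vn_restr: "A \<in> vn G \<Longrightarrow> restr (carrier G) v = v \<Longrightarrow> restr (carrier G) (A v) = A v"
  by (metis vnD(3))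

lemma lop_ell2: "A \<in> vn G \<Longrightarrow> f \<in> ell2 G \<Longrightarrow> coord (A (Abs_l2 f)) \<in> ell2 G"
  by (rule restr_ell2, rule vn_restr) (simp_all add: ell2D(3))

lemma e0_ell2: "coord (e0 G) \<in> ell2 G" by (rule restr_ell2[OF restr_e0])

lemma symb_lop: "A \<in> vn G \<Longrightarrow> symb G (lop G A) = A (e0 G)"
  by (simp add: symb_def lop_def e0_ell2)

text \<open>\<delta> is cyclic: its right translates are the \<open>basis x\<close> with
  \<open>x\<close> in the carrier, and complex linearity supplies
  \<open>imul (basis x)\<close>.\<close>

lemma vn_ext:
  assumes A: "A \<in> vn G" and B: "B \<in> vn G" and eq: "A (e0 G) = B (e0 G)" and v: "restr (carrier G) v = v"
  shows "A v = B v"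
proof -
  have r0: "restr (carrier G) (basis x) = (if x \<in> carrier G then basis x else 0)" for x
    by (rule l2_eqI) (auto simp: coord_ops)
  have bx: "A (restr (carrier G) (basis x)) = B (restr (carrier G) (basis x))" for x
    using eq vnD(4)[OF A, of x "e0 G"] vnD(4)[OF B, of x "e0 G"]
      linear_0[OF vn_linear[OF A]] linear_0[OF vn_linear[OF B]]
    by (cases "x \<in> carrier G") (simp_all add: r0 rho_e0)
  have ri: "restr (carrier G) (imul f) = imul (restr (carrier G) f)" for f :: "'a l2"
    by (rule l2_eqI) (simp add: coord_ops)
  have "A (restr (carrier G) v) = B (restr (carrier G) v)"
  proof (rule l2_ext[of "\<lambda>v. A (restr (carrier G) v)" "\<lambda>v. B (restr (carrier G) v)"])
    show "bounded_linear (\<lambda>v. A (restr (carrier G) v))" "bounded_linear (\<lambda>v. B (restr (carrier G) v))"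
      by (rule bounded_linear_compose[OF vnD(1)[OF A] bounded_linear_restr]
          bounded_linear_compose[OF vnD(1)[OF B] bounded_linear_restr])+
  qed (simp_all only: ri vnD(2)[OF A] vnD(2)[OF B] bx)
  then show ?thesis by (simp add: v)
qed

lemma lop_cong: assumes "A \<in> vn G" "B \<in> vn G" "A (e0 G) = B (e0 G)" shows "lop G A = lop G B"
  unfolding lop_def
proof (rule restrict_ext)
  fix f assume "f \<in> ell2 G"
  from vn_ext[OF assms ell2D(3)[OF this]] show "coord (A (Abs_l2 f)) = coord (B (Abs_l2 f))" by simp
qed

lemma coord_rho_right: "g \<in> carrier G \<Longrightarrow> f \<in> ell2 G \<Longrightarrow> coord (rho G (inv g) (Abs_l2 f)) = right_translation G g f"
  using ell2D(1)[of f] by (intro ext) (auto simp: coord_rho right_translation_def ell2D(2))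

lemma ell2_add: "f \<in> ell2 G \<Longrightarrow> h \<in> ell2 G \<Longrightarrow> (\<lambda>x. f x + h x) = coord (Abs_l2 f + Abs_l2 h)"
  by (rule ext) (simp add: coord_ops ell2D(2))

lemma ell2_mult: "f \<in> ell2 G \<Longrightarrow> (\<lambda>x. c * f x) = coord (Re c *\<^sub>R Abs_l2 f + Im c *\<^sub>R imul (Abs_l2 f))"
  by (rule ext) (auto simp: coord_ops ell2D(2) complex_eq_iff)

lemma lop_in: assumes A: "A \<in> vn G" shows "lop G A \<in> carrier (group_vN_algebra G)"
proof -
  have ap: "lop G A f = coord (A (Abs_l2 f))" if "f \<in> ell2 G" for f using that by (simp add: lop_def)
  have add_in: "(\<lambda>x. f x + h x) \<in> ell2 G" if "f \<in> ell2 G" "h \<in> ell2 G" for f h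
    unfolding ell2_add[OF that] using ell2D(1,2)[OF that(1)] ell2D(1,2)[OF that(2)]
    by (intro ell2I) (simp add: coord_ops)
  have mult_in: "(\<lambda>x. c * f x) \<in> ell2 G" if "f \<in> ell2 G" for f c
    unfolding ell2_mult[OF that] using ell2D(1,2)[OF that] by (intro ell2I) (simp add: coord_ops)
  obtain K where K: "\<And>v. norm (A v) \<le> norm v * K" using bounded_linear.bounded[OF vnD(1)[OF A]] by blast
  have "lop G A \<in> bounded_operators G"
    unfolding bounded_operators_def
  proof (intro CollectI conjI ballI allI exI[of _ K])
    show "lop G A \<in> ell2 G \<rightarrow>\<^sub>E ell2 G" using lop_ell2[OF A] by (auto simp: lop_def)
    fix f assume f: "f \<in> ell2 G"
    show "lop G A (\<lambda>x. f x + h x) = (\<lambda>x. lop G A f x + lop G A h x)" if h: "h \<in> ell2 G" for h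
      using f h by (simp add: ap add_in) (auto simp: ell2_add linear_add[OF vn_linear[OF A]] coord_ops)
    show "lop G A (\<lambda>x. c * f x) = (\<lambda>x. c * lop G A f x)" for c
      using f by (simp add: ap mult_in)
        (auto simp: ell2_mult linear_add[OF vn_linear[OF A]] linear_scale[OF vn_linear[OF A]] vnD(2)[OF A] coord_ops complex_eq_iff)
    show "ell2_norm G (lop G A f) \<le> K * ell2_norm G f"
      using K[of "Abs_l2 f"] ell2D(4)[OF f] ell2D(4)[OF lop_ell2[OF A f]] by (simp add: ap f mult.commute)
  qed
  moreover have "lop G A (right_translation G g f) = right_translation G g (lop G A f)"
    if g: "g \<in> carrier G" and f: "f \<in> ell2 G" for g f
  proof -
    have "right_translation G g f \<in> ell2 G"
      unfolding coord_rho_right[OF g f, symmetric] using g ell2D(1,2)[OF f] by (intro ell2I) (auto simp: coord_rho)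
    then have "lop G A (right_translation G g f) = coord (rho G (inv g) (A (Abs_l2 f)))"
      using g by (simp add: ap) (simp add: coord_rho_right[OF g f, symmetric] vnD(4)[OF A])
    also have "\<dots> = right_translation G g (lop G A f)"
      using coord_rho_right[OF g lop_ell2[OF A f]] by (simp add: ap f)
    finally show ?thesis .
  qed
  ultimately show ?thesis by (simp add: group_vN_algebra_def)
qed

lemma lop_surj: assumes "T \<in> carrier (group_vN_algebra G)" obtains A where "A \<in> vn G" "T = lop G A"
proof -
  from assms have T: "T \<in> ell2 G \<rightarrow>\<^sub>E ell2 G"
    and add: "\<And>f h. f \<in> ell2 G \<Longrightarrow> h \<in> ell2 G \<Longrightarrow> T (\<lambda>x. f x + h x) = (\<lambda>x. T f x + T h x)"
    and mult: "\<And>c f. f \<in> ell2 G \<Longrightarrow> T (\<lambda>x. c * f x) = (\<lambda>x. c * T f x)"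
    and "\<exists>C. \<forall>f\<in>ell2 G. ell2_norm G (T f) \<le> C * ell2_norm G f"
    and tr: "\<And>g f. g \<in> carrier G \<Longrightarrow> f \<in> ell2 G \<Longrightarrow> T (right_translation G g f) = right_translation G g (T f)"
    by (auto simp: group_vN_algebra_def bounded_operators_def)
  then obtain C where C: "\<And>f. f \<in> ell2 G \<Longrightarrow> ell2_norm G (T f) \<le> C * ell2_norm G f" by blast
  have Tin: "T f \<in> ell2 G" if "f \<in> ell2 G" for f using T that by auto
  let ?r = "\<lambda>v. coord (restr (carrier G) v)"
  \<comment> \<open>\<open>T\<close> knows only functions supported on the carrier, so the rest of
    \<open>l2\<close> is cut off first.\<close>
  define A where "A v = Abs_l2 (T (?r v))" for v
  have cA: "coord (A v) = T (?r v)" for v unfolding A_def by (rule ell2D(2)[OF Tin[OF coord_restr_ell2]])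
  have "A \<in> vn G"
  proof (rule vnI)
    have 1: "A (v + w) = A v + A w" for v w
    proof (rule l2_eqI)
      fix x
      have "?r (v + w) = (\<lambda>x. ?r v x + ?r w x)" by (auto simp: coord_ops)
      then show "coord (A (v + w)) x = coord (A v + A w) x"
        by (simp only: cA coord_add add[OF coord_restr_ell2 coord_restr_ell2])
    qed
    have 2: "A (r *\<^sub>R v) = r *\<^sub>R A v" for r v
    proof (rule l2_eqI)
      fix x
      have "?r (r *\<^sub>R v) = (\<lambda>x. of_real r * ?r v x)" by (auto simp: coord_ops)
      then show "coord (A (r *\<^sub>R v)) x = coord (r *\<^sub>R A v) x"
        by (simp only: cA coord_scaleR mult[OF coord_restr_ell2])
    qed
    show "bounded_linear A"
    proof (rule bounded_linear_intro[of _ "\<bar>C\<bar>", OF 1 2])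
      fix v
      have "norm (A v) = ell2_norm G (T (?r v))" unfolding A_def by (rule ell2D(4)[OF Tin[OF coord_restr_ell2]])
      also have "\<dots> \<le> C * norm (restr (carrier G) v)"
        using C[OF coord_restr_ell2[of v]] ell2D(4)[OF coord_restr_ell2[of v]] by simp
      also have "\<dots> \<le> \<bar>C\<bar> * norm v" by (intro mult_mono norm_restr) auto
      finally show "norm (A v) \<le> norm v * \<bar>C\<bar>" by (simp add: mult.commute)
    qed
    show "A (imul v) = imul (A v)" for v
    proof (rule l2_eqI)
      fix x
      have "?r (imul v) = (\<lambda>x. \<i> * ?r v x)" by (auto simp: coord_ops)
      then show "coord (A (imul v)) x = coord (imul (A v)) x"
        by (simp only: cA coord_imul mult[OF coord_restr_ell2])
    qed
    show "A (restr (carrier G) v) = restr (carrier G) (A v)" for v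
    proof -
      have "restr (carrier G) (restr (carrier G) v) = restr (carrier G) v" by (rule l2_eqI) (simp add: coord_ops)
      then have "A (restr (carrier G) v) = A v" by (simp add: A_def)
      also have "\<dots> = restr (carrier G) (A v)"
        unfolding A_def by (rule ell2D(3)[OF Tin[OF coord_restr_ell2], symmetric])
      finally show ?thesis .
    qed
    show "A (rho G g v) = rho G g (A v)" if g: "g \<in> carrier G" for g v
    proof -
      have "?r (rho G g v) = right_translation G (inv g) (?r v)"
        using coord_rho_right[OF inv_closed[OF g] coord_restr_ell2[of v]] g by (simp add: rho_restr)
      then have "A (rho G g v) = Abs_l2 (right_translation G (inv g) (T (?r v)))"
        using g by (simp add: A_def tr coord_restr_ell2)
      also have "right_translation G (inv g) (T (?r v)) = coord (rho G g (A v))"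
        using coord_rho_right[OF inv_closed[OF g] Tin[OF coord_restr_ell2[of v]]] g by (simp add: A_def)
      finally show ?thesis by simp
    qed
  qed
  moreover have "T = lop G A"
  proof (rule extensionalityI[of _ "ell2 G"])
    show "T \<in> extensional (ell2 G)" using T by (simp add: PiE_def)
    show "lop G A \<in> extensional (ell2 G)" by (simp add: lop_def)
    fix f assume f: "f \<in> ell2 G"
    then show "T f = lop G A f" by (simp add: lop_def cA ell2D(2,3))
  qed
  ultimately show ?thesis using that by blast
qed

lemma lop_add: assumes "A \<in> vn G" "B \<in> vn G" shows "lop G A \<oplus>\<^bsub>group_vN_algebra G\<^esub> lop G B = lop G (\<lambda>v. A v + B v)"
  unfolding group_vN_algebra_def lop_def by (auto simp: coord_ops intro!: restrict_ext)

lemma lop_mult: assumes "A \<in> vn G" "B \<in> vn G" shows "lop G A \<otimes>\<^bsub>group_vN_algebra G\<^esub> lop G B = lop G (\<lambda>v. A (B v))"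
  unfolding group_vN_algebra_def using lop_ell2[OF assms(2)] by (auto simp: lop_def compose_def intro!: restrict_ext)

lemma lop_zero: "\<zero>\<^bsub>group_vN_algebra G\<^esub> = lop G (\<lambda>_. 0)"
  unfolding group_vN_algebra_def lop_def by (auto simp: coord_ops intro!: restrict_ext)

lemma lop_one: "\<one>\<^bsub>group_vN_algebra G\<^esub> = lop G (\<lambda>v. v)"
  unfolding group_vN_algebra_def lop_def by (auto simp: ell2D(2) intro!: restrict_ext)

lemma lop_lam: "g \<in> carrier G \<Longrightarrow> group_element_operator G g = lop G (lam G g)"
  unfolding group_element_operator_def lop_def
  by (rule restrict_ext, rule ext) (auto simp: left_translation_def coord_lam ell2D(2) dest: ell2D(1))

abbreviation "LG \<equiv> group_vN_algebra G"

lemma symb_in: "T \<in> carrier LG \<Longrightarrow> symb G T \<in> vnvec G"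
  by (erule lop_surj) (simp add: symb_lop vnvecI)

lemma symb_inj: "S \<in> carrier LG \<Longrightarrow> T \<in> carrier LG \<Longrightarrow> symb G S = symb G T \<Longrightarrow> S = T"
  by (elim lop_surj) (auto simp: symb_lop intro: lop_cong)

lemma symb_surj: "v \<in> vnvec G \<Longrightarrow> \<exists>T\<in>carrier LG. symb G T = v"
  using lop_in symb_lop by (fastforce simp: vnvec_def)

lemma symb_add: "S \<in> carrier LG \<Longrightarrow> T \<in> carrier LG \<Longrightarrow> symb G (S \<oplus>\<^bsub>LG\<^esub> T) = symb G S + symb G T"
  by (elim lop_surj) (simp add: lop_add symb_lop vn_add)

lemma symb_zero: "symb G \<zero>\<^bsub>LG\<^esub> = 0"
  by (simp add: lop_zero symb_lop vn_zero)

lemma symb_lop_mult: "A \<in> vn G \<Longrightarrow> T \<in> carrier LG \<Longrightarrow> symb G (lop G A \<otimes>\<^bsub>LG\<^esub> T) = A (symb G T)"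
  by (elim lop_surj) (simp add: lop_mult symb_lop vn_compose)

lemma symb_act: "g \<in> carrier G \<Longrightarrow> T \<in> carrier LG \<Longrightarrow> symb G (T \<otimes>\<^bsub>LG\<^esub> group_element_operator G g) = rho G g (symb G T)"
proof (erule lop_surj)
  fix A assume g: "g \<in> carrier G" and A: "A \<in> vn G" "T = lop G A"
  have "lam G g (e0 G) = rho G g (e0 G)" using g by (simp add: rho_e0) (simp add: e0_def lam_basis)
  then show ?thesis using g A by (simp add: lop_lam lop_mult symb_lop vn_compose vn_lam vnD(4))
qed

lemma LG_zero: "\<zero>\<^bsub>LG\<^esub> \<in> carrier LG" by (simp add: lop_zero lop_in vn_zero)
lemma LG_add: "S \<in> carrier LG \<Longrightarrow> T \<in> carrier LG \<Longrightarrow> S \<oplus>\<^bsub>LG\<^esub> T \<in> carrier LG"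
  by (elim lop_surj) (simp add: lop_add lop_in vn_add)
lemma LG_mult: "S \<in> carrier LG \<Longrightarrow> T \<in> carrier LG \<Longrightarrow> S \<otimes>\<^bsub>LG\<^esub> T \<in> carrier LG"
  by (elim lop_surj) (simp add: lop_mult lop_in vn_compose)
lemma LG_one: "\<one>\<^bsub>LG\<^esub> \<in> carrier LG" by (simp add: lop_one lop_in vn_id)
lemma LG_act: "g \<in> carrier G \<Longrightarrow> T \<in> carrier LG \<Longrightarrow> T \<otimes>\<^bsub>LG\<^esub> group_element_operator G g \<in> carrier LG"
  by (intro LG_mult) (simp_all add: lop_lam lop_in vn_lam)

lemma symb_zero_iff: "T \<in> carrier LG \<Longrightarrow> symb G T = 0 \<longleftrightarrow> T = \<zero>\<^bsub>LG\<^esub>"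
  using symb_inj[OF _ LG_zero] symb_zero by auto

lemma LG_neg: "T \<in> carrier LG \<Longrightarrow> \<exists>S\<in>carrier LG. S \<oplus>\<^bsub>LG\<^esub> T = \<zero>\<^bsub>LG\<^esub>"
proof -
  assume T: "T \<in> carrier LG"
  obtain S where S: "S \<in> carrier LG" "symb G S = - symb G T"
    using symb_surj[OF vnvec_uminus[OF symb_in[OF T]]] by blast
  then have "S \<oplus>\<^bsub>LG\<^esub> T = \<zero>\<^bsub>LG\<^esub>"
    by (intro symb_inj) (simp_all add: T LG_add LG_zero symb_add symb_zero)
  then show ?thesis using S by blast
qed

context
  fixes M :: "(('a \<Rightarrow> complex) \<Rightarrow> 'a \<Rightarrow> complex, 'm) ring_scheme" (structure)
  assumes M: "carrier M = carrier LG" "add M = add LG" "zero M = zero LG"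
begin

text \<open>\<open>M\<close> is any record sharing the additive part of the algebra, to cover both
  the algebra and its regular module. The axioms are pulled back along the injective
  \<open>symb\<close>.\<close>

lemma M_abelian: "abelian_group M"
proof (rule abelian_groupI)
  fix x y z assume *: "x \<in> carrier M" "y \<in> carrier M" "z \<in> carrier M"
  then show "x \<oplus>\<^bsub>M\<^esub> y \<in> carrier M" by (simp add: M LG_add)
  show "x \<oplus>\<^bsub>M\<^esub> y \<oplus>\<^bsub>M\<^esub> z = x \<oplus>\<^bsub>M\<^esub> (y \<oplus>\<^bsub>M\<^esub> z)" "x \<oplus>\<^bsub>M\<^esub> y = y \<oplus>\<^bsub>M\<^esub> x"
    using * unfolding M by (auto intro!: symb_inj LG_add simp: symb_add LG_add add.assoc add.commute)
next
  fix x assume x: "x \<in> carrier M"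
  then show "\<zero>\<^bsub>M\<^esub> \<oplus>\<^bsub>M\<^esub> x = x" unfolding M by (auto intro!: symb_inj LG_add LG_zero simp: symb_add LG_zero symb_zero)
  show "\<exists>y\<in>carrier M. y \<oplus>\<^bsub>M\<^esub> x = \<zero>\<^bsub>M\<^esub>" using x LG_neg by (simp add: M)
qed (simp add: M LG_zero)

lemma M_finsum:
  "finite I \<Longrightarrow> (\<And>i. i \<in> I \<Longrightarrow> f i \<in> carrier LG) \<Longrightarrow>
    finsum M f I \<in> carrier LG \<and> symb G (finsum M f I) = (\<Sum>i\<in>I. symb G (f i))"
proof (induction I rule: finite_induct)
  interpret M: abelian_group M by (rule M_abelian)
  {
    case empty
    then show ?case using M.finsum_empty by (simp add: M LG_zero symb_zero)
  next
    case (insert i I)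
    then have "finsum M f (insert i I) = f i \<oplus>\<^bsub>M\<^esub> finsum M f I"
      by (intro M.finsum_insert) (auto simp: M)
    then show ?case using insert by (simp add: M LG_add symb_add)
  }
qed

lemma M_uminus: "x \<in> carrier LG \<Longrightarrow> \<ominus>\<^bsub>M\<^esub> x \<in> carrier LG \<and> symb G (\<ominus>\<^bsub>M\<^esub> x) = - symb G x"
proof -
  interpret M: abelian_group M by (rule M_abelian)
  assume x: "x \<in> carrier LG"
  then have c: "\<ominus>\<^bsub>M\<^esub> x \<in> carrier LG" using M.a_inv_closed by (simp add: M)
  have "symb G (\<ominus>\<^bsub>M\<^esub> x \<oplus>\<^bsub>M\<^esub> x) = 0" using M.l_neg x by (simp add: M symb_zero)
  then show ?thesis using c x by (simp add: M symb_add eq_neg_iff_add_eq_0)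
qed

end

end

section \<open>From homogeneous chains to the bar complex\<close>

text \<open>
  \<open>to_bar\<close> sends \<open>v \<otimes> (h\<^sub>0, \<dots>, h\<^sub>n)\<close> to \<open>v h\<^sub>0 [h\<^sub>0\<^sup>-\<^sup>1 h\<^sub>1 | \<dots> | h\<^sub>n\<^sub>-\<^sub>1\<^sup>-\<^sup>1 h\<^sub>n]\<close>, and \<open>of_bar\<close> sends \<open>v [g\<^sub>1 | \<dots> | g\<^sub>n]\<close>
  to \<open>v \<otimes> (1, g\<^sub>1, g\<^sub>1 g\<^sub>2, \<dots>)\<close>.
\<close>

definition sg :: "nat \<Rightarrow> 'm::ab_group_add \<Rightarrow> 'm" where "sg j x = (if even j then x else - x)"

definition del :: "nat \<Rightarrow> 'a list \<Rightarrow> 'a list" where "del j l = take j l @ drop (Suc j) l"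

lemma del_simps [simp]: "del 0 (x # l) = l" "del (Suc j) (x # l) = x # del j l"
  by (simp_all add: del_def)

lemma sg_Suc: "sg (Suc j) x = - sg j x" by (simp add: sg_def)

lemma bds_eq_sum: "bds l f = (\<Sum>j<length l. sg j (f (del j l)))"
proof (induction l arbitrary: f)
  case (Cons x l)
  have "(\<Sum>j<length (x # l). sg j (f (del j (x # l)))) = f l + (\<Sum>j<length l. - sg j (f (x # del j l)))"
    unfolding length_Cons sum.lessThan_Suc_shift by (simp add: sg_Suc) (simp add: sg_def)
  then show ?case using Cons.IH[of "\<lambda>l. f (x # l)"] by (simp add: sum_negf)
qed simp

text \<open>Unlike \<open>rho G g\<close>, this is additive for every \<open>g\<close>.\<close>

definition rr :: "('g, 'x) monoid_scheme \<Rightarrow> 'g \<Rightarrow> 'g l2 \<Rightarrow> 'g l2" where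
  "rr G g v = (if g \<in> carrier G then rho G g v else v)"

definition BC :: "('g, 'x) monoid_scheme \<Rightarrow> nat \<Rightarrow> ('g list \<Rightarrow>\<^sub>0 'g l2) set" where
  "BC G n = {d. (\<forall>s\<in>keys d. length s = n \<and> set s \<subseteq> carrier G) \<and> (\<forall>s. lookup d s \<in> vnvec G)}"

definition bd_bar :: "('g, 'x) monoid_scheme \<Rightarrow> nat \<Rightarrow> ('g list \<Rightarrow>\<^sub>0 'g l2) \<Rightarrow> ('g list \<Rightarrow>\<^sub>0 'g l2)" where
  "bd_bar G n = pext (\<lambda>s v. \<Sum>j\<in>{0..n}. sg j (single (bar_face G j s) (if j = 0 then rr G (hd s) v else v)))"

definition cfb :: "('g l2 \<Rightarrow> 'g l2) \<Rightarrow> ('g list \<Rightarrow>\<^sub>0 'g l2) \<Rightarrow> ('g list \<Rightarrow>\<^sub>0 'g l2)" where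
  "cfb a = pext (\<lambda>s v. single s (a v))"

fun barl :: "('g, 'x) monoid_scheme \<Rightarrow> 'g list \<Rightarrow> 'g list" where
  "barl G (x # y # l) = (inv\<^bsub>G\<^esub> x \<otimes>\<^bsub>G\<^esub> y) # barl G (y # l)"
| "barl G l = []"

fun homl :: "('g, 'x) monoid_scheme \<Rightarrow> 'g \<Rightarrow> 'g list \<Rightarrow> 'g list" where
  "homl G k [] = [k]"
| "homl G k (g # s) = k # homl G (k \<otimes>\<^bsub>G\<^esub> g) s"

definition to_bar :: "('g, 'x) monoid_scheme \<Rightarrow> ('g, unit) chain \<Rightarrow> ('g list \<Rightarrow>\<^sub>0 'g l2)" where
  "to_bar G = pext (\<lambda>b v. single (barl G (fst b)) (rr G (hd (fst b)) v))"

definition of_bar :: "('g, 'x) monoid_scheme \<Rightarrow> ('g list \<Rightarrow>\<^sub>0 'g l2) \<Rightarrow> ('g, unit) chain" where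
  "of_bar G = pext (\<lambda>s v. single (homl G \<one>\<^bsub>G\<^esub> s, ()) v)"

context group
begin

lemma rr_additive: "additive (rr G g)"
  unfolding rr_def by (cases "g \<in> carrier G") (auto simp: rho_additive intro: additive.intro)

lemma rr_in: "g \<in> carrier G \<Longrightarrow> rr G g = rho G g" by (auto simp: rr_def)

lemma rr_vnvec: "v \<in> vnvec G \<Longrightarrow> rr G g v \<in> vnvec G" by (simp add: rr_def vnvec_rho)

lemma sg_add: "sg j (x + y) = sg j x + sg j y" for x :: "'m::ab_group_add" by (simp add: sg_def)

lemma bd_bar_fun_additive:
  "additive (\<lambda>v. \<Sum>j\<in>{0..n}. sg j (single (bar_face G j s) (if j = 0 then rr G (hd s) v else v)))"
proof (rule additive.intro)
  fix v w
  have "sg j (single (bar_face G j s) (if j = 0 then rr G (hd s) (v + w) else v + w))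
    = sg j (single (bar_face G j s) (if j = 0 then rr G (hd s) v else v))
    + sg j (single (bar_face G j s) (if j = 0 then rr G (hd s) w else w))" for j
    by (simp add: additive.add[OF rr_additive] single_add sg_add)
  then show "(\<Sum>j\<in>{0..n}. sg j (single (bar_face G j s) (if j = 0 then rr G (hd s) (v + w) else v + w)))
    = (\<Sum>j\<in>{0..n}. sg j (single (bar_face G j s) (if j = 0 then rr G (hd s) v else v)))
    + (\<Sum>j\<in>{0..n}. sg j (single (bar_face G j s) (if j = 0 then rr G (hd s) w else w)))"
    by (simp only: sum.distrib)
qed

lemma bd_bar_additive: "additive (bd_bar G n)"
  unfolding bd_bar_def by (rule pext_additive[OF bd_bar_fun_additive])

lemma bd_bar_single: "bd_bar G n (single s v)
    = (\<Sum>j\<in>{0..n}. sg j (single (bar_face G j s) (if j = 0 then rr G (hd s) v else v)))"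
  unfolding bd_bar_def by (subst pext_single, rule bd_bar_fun_additive) (rule refl)

lemma cfb_additive: "additive a \<Longrightarrow> additive (cfb a)"
  unfolding cfb_def by (rule pext_additive, rule additive_comp[OF additive_single])

lemma cfb_single: "additive a \<Longrightarrow> cfb a (single s v) = single s (a v)"
  unfolding cfb_def by (rule pext_single, rule additive_comp[OF additive_single])

lemma to_bar_additive: "additive (to_bar G)"
  unfolding to_bar_def by (rule pext_additive, rule additive_comp[OF additive_single rr_additive])

lemma to_bar_single: "to_bar G (single (l, u) v) = single (barl G l) (rr G (hd l) v)"
  unfolding to_bar_def by (subst pext_single, rule additive_comp[OF additive_single rr_additive]) simp

lemma of_bar_additive: "additive (of_bar G)"
  unfolding of_bar_def by (rule pext_additive, rule additive_single)

lemma of_bar_single: "of_bar G (single s v) = single (homl G \<one> s, ()) v"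
  unfolding of_bar_def by (rule pext_single, rule additive_single)

lemma homl_props: "k \<in> carrier G \<Longrightarrow> set s \<subseteq> carrier G \<Longrightarrow>
    length (homl G k s) = Suc (length s) \<and> set (homl G k s) \<subseteq> carrier G \<and> hd (homl G k s) = k \<and> homl G k s \<noteq> []"
  by (induction s arbitrary: k) auto

lemma barl_homl: "k \<in> carrier G \<Longrightarrow> set s \<subseteq> carrier G \<Longrightarrow> barl G (homl G k s) = s"
proof (induction s arbitrary: k)
  case (Cons g s)
  then have kg: "k \<otimes> g \<in> carrier G" "set s \<subseteq> carrier G" by auto
  obtain t where t: "homl G (k \<otimes> g) s = (k \<otimes> g) # t"
    using homl_props[OF kg] by (metis list.collapse)
  have "inv k \<otimes> (k \<otimes> g) = g" using Cons.prems by (simp add: m_assoc[symmetric])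
  then show ?case using Cons.IH[OF kg] by (simp add: t)
qed simp

lemma barl_props: "set l \<subseteq> carrier G \<Longrightarrow> length (barl G l) = length l - 1 \<and> set (barl G l) \<subseteq> carrier G"
  by (induction l rule: induct_list012) auto

text \<open>The factor \<open>a\<close> is free for the induction; \<open>a = inv h\<close> gives
  the translate that \<open>nrm\<close> picks.\<close>

lemma homl_barl: "a \<in> carrier G \<Longrightarrow> set (h # l) \<subseteq> carrier G \<Longrightarrow> homl G (a \<otimes> h) (barl G (h # l)) = map (\<lambda>x. a \<otimes> x) (h # l)"
proof (induction l arbitrary: h)
  case (Cons y l)
  have "a \<otimes> h \<otimes> (inv h \<otimes> y) = a \<otimes> y"
  proof -
    have "h \<otimes> (inv h \<otimes> y) = y" using Cons.prems by (simp add: m_assoc[symmetric])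
    then show ?thesis using Cons.prems by (simp add: m_assoc)
  qed
  then show ?case using Cons by simp
qed simp

lemma bar_face_Cons: "1 \<le> j \<Longrightarrow> j \<le> length s \<Longrightarrow> bar_face G (Suc j) (a # s) = a # bar_face G j s"
  by (cases j) (auto simp: bar_face_def)

text \<open>Deleting an inner entry multiplies two neighbouring quotients,
  \<open>(x^{-1} y) (y^{-1} z) = x^{-1} z\<close>, and deleting the last entry drops one. The first
  entry is excluded, as its deletion also changes the coefficient.\<close>

lemma barl_del: "set l \<subseteq> carrier G \<Longrightarrow> 1 \<le> j \<Longrightarrow> Suc j \<le> length l \<Longrightarrow> barl G (del j l) = bar_face G j (barl G l)"
proof (induction l arbitrary: j)
  case (Cons x l)
  then obtain y r where l: "l = y # r" by (cases l) auto
  show ?case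
  proof (cases "j = 1")
    case True
    show ?thesis
    proof (cases r)
      case Nil
      then show ?thesis using True by (simp add: l bar_face_def del_def)
    next
      case (Cons z r')
      have "inv x \<otimes> y \<otimes> (inv y \<otimes> z) = inv x \<otimes> z"
      proof -
        have "y \<otimes> (inv y \<otimes> z) = z" using Cons.prems by (simp add: l Cons m_assoc[symmetric])
        then show ?thesis using Cons.prems by (simp add: l Cons m_assoc)
      qed
      then show ?thesis using True by (simp add: l Cons bar_face_def del_def)
    qed
  next
    case False
    then obtain i where j: "j = Suc i" "1 \<le> i" using Cons.prems by (cases j) auto
    have IH: "barl G (del i l) = bar_face G i (barl G l)"
      using Cons.IH[of i] Cons.prems j by simp
    obtain k where k: "i = Suc k" using j by (cases i) auto
    have dl: "del i l = y # del k r" by (simp add: l k)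
    have "length (barl G l) = length l - 1" using barl_props Cons.prems by auto
    then have "bar_face G j (barl G (x # l)) = (inv x \<otimes> y) # bar_face G i (barl G l)"
      using Cons.prems j bar_face_Cons[of i "barl G l"] by (simp add: l)
    then show ?thesis using IH by (simp add: j dl)
  qed
qed simp

lemma additive_BC_ext:
  assumes "additive F" "additive F'" "d \<in> BC G k"
    and "\<And>s v. length s = k \<Longrightarrow> set s \<subseteq> carrier G \<Longrightarrow> v \<in> vnvec G \<Longrightarrow> F (single s v) = F' (single s v)"
  shows "F d = F' d"
  by (rule additive_ext[OF assms(1,2)]) (use assms(3,4) in \<open>auto simp: BC_def\<close>)

lemma BC_0: "0 \<in> BC G k" by (simp add: BC_def vnvec_zero)

lemma BC_add: "c \<in> BC G k \<Longrightarrow> d \<in> BC G k \<Longrightarrow> c + d \<in> BC G k"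
  using Poly_Mapping.keys_add[of c d] by (fastforce simp: BC_def lookup_add vnvec_add)

lemma BC_uminus: "c \<in> BC G k \<Longrightarrow> - c \<in> BC G k"
  by (simp add: BC_def vnvec_uminus)

lemma BC_sum: "(\<And>i. i \<in> I \<Longrightarrow> f i \<in> BC G k) \<Longrightarrow> sum f I \<in> BC G k"
  by (induction I rule: infinite_finite_induct) (auto intro: BC_0 BC_add)

lemma BC_single: "length s = k \<Longrightarrow> set s \<subseteq> carrier G \<Longrightarrow> v \<in> vnvec G \<Longrightarrow> single s v \<in> BC G k"
  by (auto simp: BC_def lookup_single when_def vnvec_zero)

lemma to_bar_BC: assumes "c \<in> Ch G {()} (Suc k)" shows "to_bar G c \<in> BC G k"
  unfolding to_bar_def pext_def
proof (rule BC_sum)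
  fix b assume "b \<in> keys c"
  then have "length (fst b) = Suc k" "set (fst b) \<subseteq> carrier G"
    using ChD[OF assms, of "fst b" "()"] by (cases b; simp)+
  then show "single (barl G (fst b)) (rr G (hd (fst b)) (lookup c b)) \<in> BC G k"
    using barl_props[of "fst b"] by (intro BC_single rr_vnvec Ch_lookup[OF assms]) auto
qed

lemma of_bar_Ch: assumes "d \<in> BC G k" shows "of_bar G d \<in> Ch G {()} (Suc k)"
  unfolding of_bar_def pext_def
proof (rule Ch_sum)
  fix s assume "s \<in> keys d"
  then have "length s = k" "set s \<subseteq> carrier G" "lookup d s \<in> vnvec G" using assms by (auto simp: BC_def)
  then show "single (homl G \<one> s, ()) (lookup d s) \<in> Ch G {()} (Suc k)"
    using homl_props[of \<one> s] by (intro Ch_single) auto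
qed

lemma to_of_bar: assumes "d \<in> BC G k" shows "to_bar G (of_bar G d) = d"
proof (rule additive_BC_ext[OF additive_comp[OF to_bar_additive of_bar_additive] _ assms, where F'="\<lambda>d. d"])
  fix s v assume "set s \<subseteq> carrier G"
  then show "to_bar G (of_bar G (single s v)) = single s v"
    using homl_props[of \<one> s] by (simp add: of_bar_single to_bar_single barl_homl rr_in rho_one)
qed (rule additive.intro, simp)

lemma point_gset: "gset G (\<lambda>_ _. ()) {()}"
  by unfold_locales auto

lemma of_to_bar: assumes "c \<in> Ch G {()} (Suc k)" shows "of_bar G (to_bar G c) = nrm G (\<lambda>_ _. ()) c"
proof -
  interpret P: gset G "\<lambda>_ _. ()" "{()}" by (rule point_gset)
  show ?thesis
  proof (rule additive_Ch_ext[OF additive_comp[OF of_bar_additive to_bar_additive] P.nrm_additive assms])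
    fix l :: "'a list" and y :: unit and v :: "'a l2"
    assume "length l = Suc k" and l: "set l \<subseteq> carrier G"
    then obtain h m where hm: "l = h # m" by (cases l) auto
    then have "homl G (inv h \<otimes> h) (barl G l) = map (\<lambda>x. inv h \<otimes> x) l"
      using l homl_barl[of "inv h" h m] by simp
    then have "homl G \<one> (barl G l) = map (\<lambda>x. inv h \<otimes> x) l" using l hm by simp
    then show "of_bar G (to_bar G (single (l, y) v)) = nrm G (\<lambda>_ _. ()) (single (l, y) v)"
      using l hm by (simp add: to_bar_single of_bar_single P.nrm_single tr_single rr_in)
  qed
qed

lemma to_bar_bdG: assumes "c \<in> Ch G {()} (Suc n)" "n \<ge> 1"
  shows "to_bar G (bdG c) = bd_bar G n (to_bar G c)"
proof (rule additive_Ch_ext[OF additive_comp[OF to_bar_additive bdG_additive]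
      additive_comp[OF bd_bar_additive to_bar_additive] assms(1)])
  fix l :: "'a list" and y :: unit and v :: "'a l2"
  assume len: "length l = Suc n" and l: "set l \<subseteq> carrier G"
  then obtain h g m where hm: "l = h # g # m" using assms(2) by (cases l; cases "tl l") auto
  have hg: "h \<in> carrier G" "g \<in> carrier G" using l hm by auto
  have "to_bar G (bdG (single (l, y) v)) = (\<Sum>j<length l. sg j (single (barl G (del j l)) (rr G (hd (del j l)) v)))"
    by (simp add: bdG_single bds_hom[OF to_bar_additive] to_bar_single) (rule bds_eq_sum)
  also have "\<dots> = (\<Sum>j\<in>{0..n}. sg j (single (bar_face G j (barl G l)) (if j = 0 then rr G (hd (barl G l)) (rr G (hd l) v) else rr G (hd l) v)))"
  proof (rule sum.cong)
    show "{..<length l} = {0..n}" using len by auto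
    fix j assume j: "j \<in> {0..n}"
    show "sg j (single (barl G (del j l)) (rr G (hd (del j l)) v))
      = sg j (single (bar_face G j (barl G l)) (if j = 0 then rr G (hd (barl G l)) (rr G (hd l) v) else rr G (hd l) v))"
    proof (cases j)
      case 0
      \<comment> \<open>Deleting the first entry must turn the coefficient \<open>v h\<close> into
        \<open>v g\<close>; this is the action of the first bar entry
        \<open>h^{-1} g\<close>.\<close>
      have "h \<otimes> (inv h \<otimes> g) = g" using hg by (simp add: m_assoc[symmetric])
      then have "rr G (inv h \<otimes> g) (rr G h v) = rr G g v" using hg by (simp add: rr_in rho_rho)
      then show ?thesis by (simp add: 0 hm bar_face_def)
    next
      case (Suc i)
      have "hd (del j l) = h" by (simp add: Suc hm)
      moreover have "barl G (del j l) = bar_face G j (barl G l)" using barl_del[OF l, of j] j len Suc by simp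
      ultimately show ?thesis by (simp add: Suc hm)
    qed
  qed
  also have "\<dots> = bd_bar G n (to_bar G (single (l, y) v))"
    by (simp add: to_bar_single bd_bar_single)
  finally show "to_bar G (bdG (single (l, y) v)) = bd_bar G n (to_bar G (single (l, y) v))" .
qed

lemma to_bar_cf: assumes a: "a \<in> vn G" and c: "c \<in> Ch G {()} (Suc n)"
  shows "to_bar G (cf (\<lambda>_. a) c) = cfb a (to_bar G c)"
proof (rule additive_Ch_ext[OF additive_comp[OF to_bar_additive cf_additive[OF vn_additive[OF a]]]
      additive_comp[OF cfb_additive[OF vn_additive[OF a]] to_bar_additive] c])
  fix l :: "'a list" and y :: unit and v :: "'a l2"
  assume "length l = Suc n" "set l \<subseteq> carrier G"
  then have "hd l \<in> carrier G" by (cases l) auto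
  then show "to_bar G (cf (\<lambda>_. a) (single (l, y) v)) = cfb a (to_bar G (single (l, y) v))"
    by (simp add: cf_single[OF vn_additive[OF a]] to_bar_single cfb_single[OF vn_additive[OF a]] rr_in vnD(4)[OF a])
qed

text \<open>\<open>to_bar\<close> does not distinguish a chain from its normal form, so equations
  modulo the action become equations of bar chains.\<close>

lemma tors_bar:
  assumes T: "tors G (\<lambda>_ _. ()) {()} n" and d: "d \<in> BC G n" and cyc: "n = 0 \<or> bd_bar G n d = 0" and e: "e > 0"
  shows "\<exists>a\<in>near G e. \<exists>b\<in>BC G (Suc n). cfb a d = bd_bar G (Suc n) b"
proof -
  interpret P: gset G "\<lambda>_ _. ()" "{()}" by (rule point_gset)
  let ?c = "of_bar G d"
  have c: "?c \<in> Ch G {()} (Suc n)" by (rule of_bar_Ch[OF d])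
  have "n = 0 \<or> nrm G (\<lambda>_ _. ()) (bdG ?c) = 0"
  proof (cases n)
    case (Suc m)
    have "nrm G (\<lambda>_ _. ()) (bdG ?c) = of_bar G (to_bar G (bdG ?c))"
      using of_to_bar[of "bdG ?c" m] bdG_Ch[OF c] Suc by simp
    also have "to_bar G (bdG ?c) = 0"
      using to_bar_bdG[OF c] to_of_bar[OF d] cyc Suc by simp
    finally show ?thesis by (simp add: additive_at_0[OF of_bar_additive])
  qed simp
  then obtain a b where a: "a \<in> near G e" and b: "b \<in> Ch G {()} (Suc (Suc n))"
    and ab: "nrm G (\<lambda>_ _. ()) (cf (\<lambda>_. a) ?c) = nrm G (\<lambda>_ _. ()) (bdG b)"
    using T c e unfolding tors_def by blast
  have ac: "cf (\<lambda>_. a) ?c \<in> Ch G {()} (Suc n)"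
    using P.eqvD(2)[OF P.eqv_cf_vn[OF nearD(1)[OF a]] c] .
  have n: "to_bar G (nrm G (\<lambda>_ _. ()) x) = to_bar G x" if "x \<in> Ch G {()} (Suc n)" for x
    using to_of_bar[OF to_bar_BC[OF that]] by (simp add: of_to_bar[OF that])
  have "cfb a d = to_bar G (cf (\<lambda>_. a) ?c)"
    by (simp add: to_bar_cf[OF nearD(1)[OF a] c] to_of_bar[OF d])
  also have "\<dots> = to_bar G (bdG b)"
    using n[OF ac] n[OF bdG_Ch[OF b]] ab by simp
  also have "\<dots> = bd_bar G (Suc n) (to_bar G b)" by (rule to_bar_bdG[OF b]) simp
  finally show ?thesis using a to_bar_BC[OF b] by blast
qed

lemma bd_bar_BC: assumes "d \<in> BC G (Suc n)" shows "bd_bar G (Suc n) d \<in> BC G n"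
proof -
  have "bd_bar G (Suc n) d = to_bar G (bdG (of_bar G d))"
    using to_bar_bdG[OF of_bar_Ch[OF assms]] to_of_bar[OF assms] by simp
  then show ?thesis using to_bar_BC[OF bdG_Ch[OF of_bar_Ch[OF assms]]] by simp
qed

end

context group
begin

section \<open>Modules killed by almost-identities have dimension zero\<close>

lemma LG_finsum:
  "finite I \<Longrightarrow> (\<And>i. i \<in> I \<Longrightarrow> f i \<in> carrier LG) \<Longrightarrow>
    finsum LG f I \<in> carrier LG \<and> symb G (finsum LG f I) = (\<Sum>i\<in>I. symb G (f i))"
  by (rule M_finsum) auto

text \<open>In the free module each coordinate of an element is killed by almost-identities, hence 0
  by \<open>torsion_free\<close>. The equation \<open>z + z = z\<close> forces the coordinates of
  \<open>z\<close> to vanish, without module axioms for \<open>K\<close>.\<close>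

lemma fg_projective_torsion_zero:
  fixes K :: "(('a \<Rightarrow> complex) \<Rightarrow> 'a \<Rightarrow> complex, 'm, 'd) module_scheme"
  assumes fg: "fg_projective LG K" and z: "z \<in> carrier K" "z \<oplus>\<^bsub>K\<^esub> z = z"
    and t: "\<And>x e. x \<in> carrier K \<Longrightarrow> 0 < e \<Longrightarrow> \<exists>a\<in>near G e. lop G a \<odot>\<^bsub>K\<^esub> x = z"
  shows "carrier K = {z}"
proof -
  obtain k P f where P: "submodule P LG (free_module LG k)"
    and f: "f \<in> module_iso LG K ((free_module LG k)\<lparr>carrier := P\<rparr>)"
    using fg unfolding fg_projective_def module_isomorphic_def by blast
  have bij: "bij_betw f (carrier K) P"
    and add: "\<And>x y. x \<in> carrier K \<Longrightarrow> y \<in> carrier K \<Longrightarrow> f (x \<oplus>\<^bsub>K\<^esub> y) = (\<lambda>i\<in>{..<k}. f x i \<oplus>\<^bsub>LG\<^esub> f y i)"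
    and smult: "\<And>a x. a \<in> carrier LG \<Longrightarrow> x \<in> carrier K \<Longrightarrow> f (a \<odot>\<^bsub>K\<^esub> x) = (\<lambda>i\<in>{..<k}. a \<otimes>\<^bsub>LG\<^esub> f x i)"
    using f by (auto simp: module_iso_def free_module_def)
  have "P \<subseteq> carrier (free_module LG k)"
    using subgroup.subset[OF submodule.axioms(1)[OF P]] by simp
  then have fx: "f x \<in> {..<k} \<rightarrow>\<^sub>E carrier LG" if "x \<in> carrier K" for x
    using bij that by (auto simp: bij_betw_def free_module_def)
  have z0: "symb G (f z i) = 0" if i: "i < k" for i
  proof -
    have c: "f z i \<in> carrier LG" using fx[OF z(1)] i by auto
    have "f z i = f z i \<oplus>\<^bsub>LG\<^esub> f z i" using add[OF z(1) z(1)] z(2) i by (metis lessThan_iff restrict_apply)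
    then have "symb G (f z i) = symb G (f z i) + symb G (f z i)" using symb_add[OF c c] by metis
    then show ?thesis by simp
  qed
  have "x = z" if x: "x \<in> carrier K" for x
  proof -
    have "f x i = f z i" for i
    proof (cases "i < k")
      case True
      have c: "f x i \<in> carrier LG" "f z i \<in> carrier LG" using fx[OF x] fx[OF z(1)] True by auto
      have "symb G (f x i) = 0"
      proof (rule torsion_free)
        show "coord (symb G (f x i)) y = 0" if "y \<notin> carrier G" for y
          using symb_in[OF c(1)] vn_supp that by (auto simp: vnvec_def)
        fix e :: real assume "0 < e"
        then obtain a where a: "a \<in> near G e" "lop G a \<odot>\<^bsub>K\<^esub> x = z" using t[OF x] by blast
        have "lop G a \<otimes>\<^bsub>LG\<^esub> f x i = f z i"
          using smult[OF lop_in[OF nearD(1)[OF a(1)]] x] True by (simp add: a(2))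
        then have "a (symb G (f x i)) = 0"
          using symb_lop_mult[OF nearD(1)[OF a(1)] c(1)] z0[OF True] by simp
        then show "\<exists>a\<in>near G e. a (symb G (f x i)) = 0" using a(1) by blast
      qed
      then show ?thesis using symb_inj[OF c] z0[OF True] by simp
    next
      case False
      then show ?thesis using fx[OF x] fx[OF z(1)] by (metis PiE_arb lessThan_iff)
    qed
    then have "f x = f z" by auto
    then show ?thesis using bij x z(1) by (auto simp: bij_betw_def inj_on_def)
  qed
  then show ?thesis using z by blast
qed

lemma submodule_singleton:
  assumes "z \<in> carrier K" "z \<oplus>\<^bsub>K\<^esub> z = z" "zero K = z" "\<And>y. y \<in> carrier K \<Longrightarrow> z \<oplus>\<^bsub>K\<^esub> y = y"
    "\<And>a. a \<in> carrier R \<Longrightarrow> a \<odot>\<^bsub>K\<^esub> z = z"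
  shows "submodule {z} R K"
proof (rule submodule.intro)
  \<comment> \<open>\<open>m_inv\<close> is a definite description, so uniqueness of the inverse has
    to be shown as well.\<close>
  have "m_inv (add_monoid K) z = z"
    unfolding m_inv_def
  proof (rule the_equality)
    show "z \<in> carrier (add_monoid K) \<and> z \<otimes>\<^bsub>add_monoid K\<^esub> z = \<one>\<^bsub>add_monoid K\<^esub> \<and> z \<otimes>\<^bsub>add_monoid K\<^esub> z = \<one>\<^bsub>add_monoid K\<^esub>"
      using assms by simp
    show "y = z" if "y \<in> carrier (add_monoid K) \<and> z \<otimes>\<^bsub>add_monoid K\<^esub> y = \<one>\<^bsub>add_monoid K\<^esub> \<and> y \<otimes>\<^bsub>add_monoid K\<^esub> z = \<one>\<^bsub>add_monoid K\<^esub>" for y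
      using that assms(3,4) by auto
  qed
  then show "subgroup {z} (add_monoid K)"
    using assms by unfold_locales auto
  show "submodule_axioms {z} R K" using assms by unfold_locales auto
qed

text \<open>The only element of the free module of rank 0 is the extensional function on the empty
  set, \<open>undefined\<close> everywhere.\<close>

lemma zero_module_fg_projective:
  fixes K :: "(('a \<Rightarrow> complex) \<Rightarrow> 'a \<Rightarrow> complex, 'm, 'd) module_scheme"
  assumes K: "carrier K = {z}" "z \<oplus>\<^bsub>K\<^esub> z = z" "\<And>a. a \<in> carrier LG \<Longrightarrow> a \<odot>\<^bsub>K\<^esub> z = z"
  shows "fg_projective LG K"
proof -
  let ?F = "free_module LG 0" and ?u = "\<lambda>_::nat. undefined :: ('a \<Rightarrow> complex) \<Rightarrow> 'a \<Rightarrow> complex"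
  have s: "submodule {?u} LG ?F"
    by (rule submodule_singleton) (auto simp: free_module_def restrict_def)
  have "module_isomorphic LG K (?F\<lparr>carrier := {?u}\<rparr>)"
    unfolding module_isomorphic_def module_iso_def using K
    by (auto simp: free_module_def restrict_def bij_betw_def intro!: exI[of _ "\<lambda>_. ?u"])
  moreover have "{?u} \<inter> {?u} = {\<zero>\<^bsub>?F\<^esub>}" "{?u} <+>\<^bsub>?F\<^esub> {?u} = carrier ?F"
    by (auto simp: free_module_def restrict_def set_add_def set_mult_def)
  ultimately show ?thesis unfolding fg_projective_def using s by blast
qed

text \<open>The dimension is a definite description, so every admissible matrix must have trace 0:
  when the image has one element, a unit vector and 0 have the same image, hence the diagonal
  entries vanish.\<close>

lemma zero_module_dim:
  fixes K :: "(('a \<Rightarrow> complex) \<Rightarrow> 'a \<Rightarrow> complex, 'm, 'd) module_scheme"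
  assumes K: "carrier K = {z}" "z \<oplus>\<^bsub>K\<^esub> z = z" "\<And>a. a \<in> carrier LG \<Longrightarrow> a \<odot>\<^bsub>K\<^esub> z = z"
  shows "vN_dim_projective G K = 0"
  unfolding vN_dim_projective_def
proof (rule the_equality)
  let ?u = "\<lambda>_::nat. undefined :: ('a \<Rightarrow> complex) \<Rightarrow> 'a \<Rightarrow> complex"
  have "module_isomorphic LG K (matrix_image_module LG 0 undefined)"
    unfolding module_isomorphic_def module_iso_def using K
    by (auto simp: matrix_image_module_def row_times_matrix_def free_module_def restrict_def bij_betw_def
        intro!: exI[of _ "\<lambda>_. ?u"])
  then show "\<exists>k A. idempotent_matrix LG k A \<and> module_isomorphic LG K (matrix_image_module LG k A)
      \<and> (0::real) = Re (\<Sum>i<k. canonical_trace G (A i i))"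
    by (intro exI[of _ 0] exI[of _ undefined]) (simp add: idempotent_matrix_def)
next
  fix d
  assume "\<exists>k A. idempotent_matrix LG k A \<and> module_isomorphic LG K (matrix_image_module LG k A)
      \<and> d = Re (\<Sum>i<k. canonical_trace G (A i i))"
  then obtain k A f where A: "\<And>i j. i < k \<Longrightarrow> j < k \<Longrightarrow> A i j \<in> carrier LG"
    and f: "f \<in> module_iso LG K (matrix_image_module LG k A)"
    and d: "d = Re (\<Sum>i<k. canonical_trace G (A i i))"
    unfolding idempotent_matrix_def module_isomorphic_def by blast
  let ?I = "row_times_matrix LG k A ` ({..<k} \<rightarrow>\<^sub>E carrier LG)"
  have "?I = {f z}"
    using f K(1) by (auto simp: module_iso_def matrix_image_module_def free_module_def bij_betw_def)
  then have const: "row_times_matrix LG k A x = row_times_matrix LG k A y"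
    if "x \<in> {..<k} \<rightarrow>\<^sub>E carrier LG" "y \<in> {..<k} \<rightarrow>\<^sub>E carrier LG" for x y
    using that by (metis imageI singletonD)
  have "A i i = \<zero>\<^bsub>LG\<^esub>" if i: "i < k" for i
  proof -
    define x where "x = (\<lambda>l\<in>{..<k}. if l = i then \<one>\<^bsub>LG\<^esub> else \<zero>\<^bsub>LG\<^esub>)"
    define y where "y = (\<lambda>l\<in>{..<k}. \<zero>\<^bsub>LG\<^esub>)"
    have mem: "x \<in> {..<k} \<rightarrow>\<^sub>E carrier LG" "y \<in> {..<k} \<rightarrow>\<^sub>E carrier LG"
      by (auto simp: x_def y_def LG_zero LG_one)
    have row: "symb G (row_times_matrix LG k A v i) = (\<Sum>l<k. symb G (v l \<otimes>\<^bsub>LG\<^esub> A l i))"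
      if "v \<in> {..<k} \<rightarrow>\<^sub>E carrier LG" for v
    proof -
      have "v l \<otimes>\<^bsub>LG\<^esub> A l i \<in> carrier LG" if "l < k" for l
        using PiE_mem[OF \<open>v \<in> _\<close>, of l] A[OF that i] that by (intro LG_mult) auto
      then show ?thesis
        using i LG_finsum[of "{..<k}" "\<lambda>l. v l \<otimes>\<^bsub>LG\<^esub> A l i"] by (simp add: row_times_matrix_def)
    qed
    have 1: "symb G (x l \<otimes>\<^bsub>LG\<^esub> A l i) = (if l = i then symb G (A i i) else 0)"
      and 2: "symb G (y l \<otimes>\<^bsub>LG\<^esub> A l i) = 0" if l: "l < k" for l
      using l i A by (auto simp: x_def y_def lop_one lop_zero symb_lop_mult vn_id vn_zero)
    have "(\<Sum>l<k. symb G (x l \<otimes>\<^bsub>LG\<^esub> A l i)) = symb G (A i i)"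
      using i by (simp add: 1)
    moreover have "(\<Sum>l<k. symb G (y l \<otimes>\<^bsub>LG\<^esub> A l i)) = 0" by (simp add: 2)
    ultimately have "symb G (A i i) = 0" using row[OF mem(1)] row[OF mem(2)] const[OF mem] by simp
    then show ?thesis using symb_zero_iff A i by simp
  qed
  moreover have "canonical_trace G \<zero>\<^bsub>LG\<^esub> = 0"
  proof -
    have "(\<lambda>x. if x = \<one> then 1 else 0) = coord (e0 G)" by (auto simp: e0_def coord_basis)
    then have "\<zero>\<^bsub>LG\<^esub> (\<lambda>x. if x = \<one> then 1 else 0) = (\<lambda>_. 0)"
      using e0_ell2 by (simp add: group_vN_algebra_def)
    then show ?thesis by (simp add: canonical_trace_def ell2_inner_def)
  qed
  ultimately show "d = 0" by (simp add: d)
qed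

section \<open>The bar complex with coefficients in the group von Neumann algebra\<close>

abbreviation "MG \<equiv> regular_module LG"
abbreviation "act_LG \<equiv> \<lambda>T g. T \<otimes>\<^bsub>LG\<^esub> group_element_operator G g"
abbreviation "CG n \<equiv> carrier (bar_chains G MG n)"

lemma MG_simps: "carrier MG = carrier LG" "add MG = add LG" "zero MG = zero LG" "module.smult MG = mult LG"
  by (simp_all add: regular_module_def)

lemmas MG_finsum = M_finsum[OF MG_simps(1-3)]
lemmas MG_uminus = M_uminus[OF MG_simps(1-3)]

definition symb_chain :: "('a list \<Rightarrow> ('a \<Rightarrow> complex) \<Rightarrow> 'a \<Rightarrow> complex) \<Rightarrow> ('a list \<Rightarrow>\<^sub>0 'a l2)" where
  "symb_chain c = Abs_poly_mapping (\<lambda>s. symb G (c s))"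

lemma CG_iff: "c \<in> CG n \<longleftrightarrow> (\<forall>s. c s \<in> carrier LG)
    \<and> (\<forall>s. c s \<noteq> \<zero>\<^bsub>LG\<^esub> \<longrightarrow> length s = n \<and> set s \<subseteq> carrier G) \<and> finite {s. c s \<noteq> \<zero>\<^bsub>LG\<^esub>}"
  by (simp add: bar_chains_def MG_simps)

lemma symb_chain_lookup: "c \<in> CG n \<Longrightarrow> lookup (symb_chain c) s = symb G (c s)"
proof -
  assume c: "c \<in> CG n"
  then have "{s. symb G (c s) \<noteq> 0} = {s. c s \<noteq> \<zero>\<^bsub>LG\<^esub>}" by (auto simp: CG_iff symb_zero_iff)
  then show ?thesis using c by (simp add: symb_chain_def CG_iff)
qed

lemma CG_LG: "c \<in> CG n \<Longrightarrow> c s \<in> carrier LG" by (simp add: CG_iff)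

lemma symb_chain_keys: assumes "c \<in> CG n" shows "keys (symb_chain c) = {s. c s \<noteq> \<zero>\<^bsub>LG\<^esub>}"
  by (auto simp: in_keys_iff symb_chain_lookup[OF assms] symb_zero symb_zero_iff CG_LG[OF assms])

lemma symb_chain_BC: "c \<in> CG n \<Longrightarrow> symb_chain c \<in> BC G n"
  by (auto simp: BC_def symb_chain_keys symb_chain_lookup) (auto simp: CG_iff symb_in)

lemma symb_chain_inj: "c \<in> CG n \<Longrightarrow> d \<in> CG n \<Longrightarrow> symb_chain c = symb_chain d \<Longrightarrow> c = d"
  by (rule ext, rule symb_inj) (auto simp: CG_LG symb_chain_lookup[of _ n, symmetric])

lemma CG_I:
  assumes "\<And>s. c s \<in> carrier LG" "d \<in> BC G n" "\<And>s. symb G (c s) = lookup d s"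
  shows "c \<in> CG n" "symb_chain c = d"
proof -
  have "{s. c s \<noteq> \<zero>\<^bsub>LG\<^esub>} = keys d"
    using assms(1,3) by (auto simp: in_keys_iff simp flip: symb_zero_iff)
  then show "c \<in> CG n" using assms(1,2) by (auto simp: CG_iff BC_def)
  then show "symb_chain c = d" by (intro poly_mapping_eqI) (simp add: symb_chain_lookup assms(3))
qed

lemma symb_chain_surj: assumes "d \<in> BC G n" shows "\<exists>c\<in>CG n. symb_chain c = d"
proof -
  have "\<forall>s. \<exists>T. T \<in> carrier LG \<and> symb G T = lookup d s"
  proof
    fix s
    have "lookup d s \<in> vnvec G" using assms by (simp add: BC_def)
    from symb_surj[OF this] show "\<exists>T. T \<in> carrier LG \<and> symb G T = lookup d s" by blast
  qed
  then obtain c where "\<And>s. c s \<in> carrier LG" "\<And>s. symb G (c s) = lookup d s" by metis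
  then show ?thesis using CG_I[OF _ assms] by blast
qed

lemma CG_add: assumes "c \<in> CG n" "d \<in> CG n"
  shows "c \<oplus>\<^bsub>bar_chains G MG n\<^esub> d \<in> CG n" "symb_chain (c \<oplus>\<^bsub>bar_chains G MG n\<^esub> d) = symb_chain c + symb_chain d"
proof -
  let ?e = "c \<oplus>\<^bsub>bar_chains G MG n\<^esub> d"
  have e: "?e s = c s \<oplus>\<^bsub>LG\<^esub> d s" for s by (simp add: bar_chains_def MG_simps)
  have 1: "?e s \<in> carrier LG" for s using assms by (simp add: e CG_iff LG_add)
  have 2: "symb G (?e s) = lookup (symb_chain c + symb_chain d) s" for s
    using assms by (simp add: e lookup_add symb_chain_lookup) (simp add: CG_iff symb_add)
  show "?e \<in> CG n" "symb_chain ?e = symb_chain c + symb_chain d" using CG_I[OF 1 BC_add[OF symb_chain_BC[OF assms(1)] symb_chain_BC[OF assms(2)]] 2] .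
qed

lemma lookup_cfb: assumes "additive a" shows "lookup (cfb a d) s = a (lookup d s)"
proof (rule additive_ext[where c=d])
  show "additive (\<lambda>d. lookup (cfb a d) s)"
    by (rule additive.intro) (simp add: additive.add[OF cfb_additive[OF assms]] lookup_add)
  show "additive (\<lambda>d. a (lookup d s))"
    by (rule additive.intro) (simp add: additive.add[OF assms] lookup_add)
  show "lookup (cfb a (single b v)) s = a (lookup (single b v) s)" for b v
    by (simp add: cfb_single[OF assms] lookup_single when_def additive_at_0[OF assms])
qed

lemma cfb_BC: "a \<in> vn G \<Longrightarrow> d \<in> BC G n \<Longrightarrow> cfb a d \<in> BC G n"
  using additive_at_0[OF vn_additive] by (auto simp: BC_def in_keys_iff lookup_cfb[OF vn_additive] vnvec_apply)

lemma CG_smult: assumes "c \<in> CG n" "a \<in> vn G"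
  shows "lop G a \<odot>\<^bsub>bar_chains G MG n\<^esub> c \<in> CG n" "symb_chain (lop G a \<odot>\<^bsub>bar_chains G MG n\<^esub> c) = cfb a (symb_chain c)"
proof -
  let ?e = "lop G a \<odot>\<^bsub>bar_chains G MG n\<^esub> c"
  have e: "?e s = lop G a \<otimes>\<^bsub>LG\<^esub> c s" for s by (simp add: bar_chains_def MG_simps)
  have 1: "?e s \<in> carrier LG" for s using assms by (simp add: e CG_iff LG_mult lop_in)
  have 2: "symb G (?e s) = lookup (cfb a (symb_chain c)) s" for s
    using assms by (simp add: e lookup_cfb[OF vn_additive] symb_chain_lookup) (simp add: CG_iff symb_lop_mult)
  show "?e \<in> CG n" "symb_chain ?e = cfb a (symb_chain c)" using CG_I[OF 1 cfb_BC[OF assms(2) symb_chain_BC[OF assms(1)]] 2] .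
qed

text \<open>The nested finite sums in the regular module are carried by \<open>symb\<close> term by
  term to the linear extension \<open>bd_bar\<close>.\<close>

lemma CG_boundary: assumes c: "c \<in> CG (Suc n)"
  shows "bar_boundary G MG act_LG (Suc n) c \<in> CG n" "symb_chain (bar_boundary G MG act_LG (Suc n) c) = bd_bar G (Suc n) (symb_chain c)"
proof -
  let ?e = "bar_boundary G MG act_LG (Suc n) c"
  let ?S = "{s. c s \<noteq> \<zero>\<^bsub>LG\<^esub>}"
  have fin: "finite ?S" and cc: "c s \<in> carrier LG" for s using c by (auto simp: CG_iff)
  have hd: "hd s \<in> carrier G" if "s \<in> ?S" for s
  proof -
    have "length s = Suc n" "set s \<subseteq> carrier G" using c that by (auto simp: CG_iff)
    then show ?thesis by (cases s) auto
  qed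
  define m where "m s j = (if j = (0::nat) then act_LG (c s) (hd s) else c s)" for s j
  have m: "m s j \<in> carrier LG" "symb G (m s j) = (if j = 0 then rr G (hd s) (symb G (c s)) else symb G (c s))"
    if "s \<in> ?S" for s j
    using hd[OF that] cc by (auto simp: m_def LG_act symb_act rr_in)
  define F where "F t s j = (if bar_face G j s = t then (if even j then m s j else \<ominus>\<^bsub>MG\<^esub> (m s j)) else \<zero>\<^bsub>MG\<^esub>)" for t s j
  have F: "F t s j \<in> carrier LG" "symb G (F t s j) = (if bar_face G j s = t then sg j (symb G (m s j)) else 0)"
    if "s \<in> ?S" for t s j
    using m(1)[OF that] MG_uminus[OF m(1)[OF that]]
    by (auto simp: F_def MG_simps LG_zero symb_zero sg_def)
  have inner: "finsum MG (F t s) {0..Suc n} \<in> carrier LG \<and>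
      symb G (finsum MG (F t s) {0..Suc n}) = (\<Sum>j\<in>{0..Suc n}. symb G (F t s j))" if "s \<in> ?S" for t s
    by (rule MG_finsum) (use F[OF that] in auto)
  have e: "?e t = finsum MG (\<lambda>s. finsum MG (F t s) {0..Suc n}) ?S" for t
    unfolding bar_boundary_def F_def[abs_def] m_def[abs_def] MG_simps Let_def by (rule refl)
  have outer: "?e t \<in> carrier LG \<and> symb G (?e t) = (\<Sum>s\<in>?S. symb G (finsum MG (F t s) {0..Suc n}))" for t
    unfolding e by (rule MG_finsum[OF fin]) (use inner in auto)
  have "symb G (?e t) = lookup (bd_bar G (Suc n) (symb_chain c)) t" for t
  proof -
    have "symb G (?e t) = (\<Sum>s\<in>?S. \<Sum>j\<in>{0..Suc n}. symb G (F t s j))"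
      using outer inner by simp
    also have "\<dots> = (\<Sum>s\<in>?S. \<Sum>j\<in>{0..Suc n}. lookup (sg j (single (bar_face G j s)
        (if j = 0 then rr G (hd s) (symb G (c s)) else symb G (c s)))) t)"
      by (intro sum.cong refl) (simp add: F(2) m(2) sg_def lookup_single when_def)
    also have "\<dots> = lookup (bd_bar G (Suc n) (symb_chain c)) t"
      unfolding bd_bar_def pext_def symb_chain_keys[OF c] symb_chain_lookup[OF c] lookup_sum by (rule refl)
    finally show ?thesis .
  qed
  then show "?e \<in> CG n" "symb_chain ?e = bd_bar G (Suc n) (symb_chain c)"
    using CG_I[of ?e "bd_bar G (Suc n) (symb_chain c)" n] outer bd_bar_BC[OF symb_chain_BC[OF c]] by blast+
qed

theorem l2_betti_zero:
  assumes T: "tors G (\<lambda>_ _. ()) {()} n"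
  shows "l2_betti G n = 0"
proof -
  let ?C = "bar_chains G MG n"
  define Z where "Z = bar_cycles G MG act_LG n"
  define B where "B = bar_boundaries G MG act_LG n"
  let ?C' = "?C\<lparr>carrier := Z\<rparr>"
  define H where "H = quotient_module ?C' B"
  have ZC: "c \<in> CG n" if "c \<in> Z" for c using that by (simp add: Z_def bar_cycles_def)
  have B_iff: "b \<in> B \<longleftrightarrow> b \<in> CG n \<and> (\<exists>e\<in>BC G (Suc n). symb_chain b = bd_bar G (Suc n) e)" for b
  proof
    assume "b \<in> B"
    then obtain c where "c \<in> CG (Suc n)" "b = bar_boundary G MG act_LG (Suc n) c"
      by (auto simp: B_def bar_boundaries_def)
    then show "b \<in> CG n \<and> (\<exists>e\<in>BC G (Suc n). symb_chain b = bd_bar G (Suc n) e)"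
      using CG_boundary symb_chain_BC by blast
  next
    assume b: "b \<in> CG n \<and> (\<exists>e\<in>BC G (Suc n). symb_chain b = bd_bar G (Suc n) e)"
    then obtain c where c: "c \<in> CG (Suc n)" "symb_chain b = bd_bar G (Suc n) (symb_chain c)" using symb_chain_surj by metis
    then have "b = bar_boundary G MG act_LG (Suc n) c"
      using b CG_boundary[OF c(1)] by (intro symb_chain_inj[of b n]) auto
    then show "b \<in> B" using c by (auto simp: B_def bar_boundaries_def)
  qed
  have B_add: "b \<oplus>\<^bsub>?C\<^esub> b' \<in> B" if "b \<in> B" "b' \<in> B" for b b'
    using that CG_add BC_add additive.add[OF bd_bar_additive] unfolding B_iff by metis
  have B_diff: "\<exists>b''\<in>B. b = b'' \<oplus>\<^bsub>?C\<^esub> b'" if b: "b \<in> B" "b' \<in> B" for b b'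
  proof -
    obtain e e' where e: "e \<in> BC G (Suc n)" "e' \<in> BC G (Suc n)" "symb_chain b = bd_bar G (Suc n) e" "symb_chain b' = bd_bar G (Suc n) e'"
      using b unfolding B_iff by blast
    have d: "symb_chain b - symb_chain b' = bd_bar G (Suc n) (e - e')" by (simp add: e additive.diff[OF bd_bar_additive])
    have "e - e' \<in> BC G (Suc n)" using BC_add[OF e(1) BC_uminus[OF e(2)]] by simp
    then obtain b'' where b'': "b'' \<in> CG n" "symb_chain b'' = symb_chain b - symb_chain b'" "b'' \<in> B"
      using symb_chain_surj[OF bd_bar_BC, of "e - e'" n] d B_iff by metis
    have "b = b'' \<oplus>\<^bsub>?C\<^esub> b'"
      using b b'' CG_add[of b'' n b'] by (intro symb_chain_inj[of b n]) (auto simp: B_iff)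
    then show ?thesis using b'' by blast
  qed
  \<comment> \<open>Sums and multiples in the quotient are sets of sums with elements of
    \<open>B\<close>; any nonempty part of \<open>B\<close> is absorbed to exactly
    \<open>B\<close>.\<close>
  have BB: "{h \<oplus>\<^bsub>?C\<^esub> y |h y. h \<in> B \<and> y \<in> Y} = B" if "Y \<subseteq> B" "Y \<noteq> {}" for Y
    using that B_add B_diff by blast
  have add_H: "X \<oplus>\<^bsub>H\<^esub> Y = {h \<oplus>\<^bsub>?C\<^esub> y |h y. h \<in> X \<and> y \<in> Y}" for X Y
    by (auto simp: H_def quotient_module_def set_add_def set_mult_def)
  have zero_H: "zero H = B" by (simp add: H_def quotient_module_def)
  have smult_H: "a \<odot>\<^bsub>H\<^esub> X = {h \<oplus>\<^bsub>?C\<^esub> y |h y. h \<in> B \<and> y \<in> (\<lambda>x. a \<odot>\<^bsub>?C\<^esub> x) ` X}" for a X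
    by (auto simp: H_def quotient_module_def set_add_def set_mult_def)
  define cos where "cos c = {h \<oplus>\<^bsub>?C\<^esub> c |h. h \<in> B}" for c
  have carr_H: "carrier H = cos ` Z"
    by (auto simp: H_def quotient_module_def A_RCOSETS_def RCOSETS_def r_coset_def cos_def)
  obtain z where z: "z \<in> CG n" "symb_chain z = 0" using symb_chain_surj[OF BC_0] by blast
  have zB: "z \<in> B" unfolding B_iff using z BC_0 additive_at_0[OF bd_bar_additive] by metis
  have zl: "c \<oplus>\<^bsub>?C\<^esub> z = c" if "c \<in> CG n" for c
    using CG_add[OF that z(1)] z that by (intro symb_chain_inj[of _ n]) auto
  have hz: "h \<oplus>\<^bsub>?C\<^esub> z = h" if "h \<in> B" for h using zl that B_iff by blast
  have cosz: "cos z = B"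
  proof (intro equalityI subsetI)
    fix x assume "x \<in> cos z"
    then obtain h where "h \<in> B" "x = h \<oplus>\<^bsub>?C\<^esub> z" unfolding cos_def by blast
    then show "x \<in> B" using hz by simp
  next
    fix x assume x: "x \<in> B"
    then show "x \<in> cos z" unfolding cos_def using hz[OF x, symmetric] by blast
  qed
  have B0: "B \<noteq> {}" using zB by blast
  have BBB: "B \<oplus>\<^bsub>H\<^esub> B = B" unfolding add_H using BB[of B] B0 by simp
  have smult_B: "a \<odot>\<^bsub>?C\<^esub> b \<in> B" if a: "a \<in> carrier LG" and b: "b \<in> B" for a b
  proof -
    obtain A where A: "A \<in> vn G" "a = lop G A" using lop_surj[OF a] by blast
    obtain e where e: "e \<in> BC G (Suc n)" "symb_chain b = bd_bar G (Suc n) e" "b \<in> CG n" using b B_iff by blast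
    have "cfb A (bd_bar G (Suc n) e) = bd_bar G (Suc n) (cfb A e)"
    proof (rule additive_BC_ext[OF additive_comp[OF cfb_additive[OF vn_additive[OF A(1)]] bd_bar_additive]
          additive_comp[OF bd_bar_additive cfb_additive[OF vn_additive[OF A(1)]]] e(1)])
      fix s v
      have c1: "cfb A (sg j x) = sg j (cfb A x)" for j and x :: "'a list \<Rightarrow>\<^sub>0 'a l2"
        by (simp add: sg_def additive.minus[OF cfb_additive[OF vn_additive[OF A(1)]]])
      have c2: "A (rr G g v) = rr G g (A v)" for g by (simp add: rr_def vnD(4)[OF A(1)])
      have "cfb A (bd_bar G (Suc n) (single s v))
        = (\<Sum>j\<in>{0..Suc n}. sg j (single (bar_face G j s) (A (if j = 0 then rr G (hd s) v else v))))"
        unfolding bd_bar_single additive.sum[OF cfb_additive[OF vn_additive[OF A(1)]]] c1 cfb_single[OF vn_additive[OF A(1)]]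
        by (rule refl)
      also have "\<dots> = (\<Sum>j\<in>{0..Suc n}. sg j (single (bar_face G j s) (if j = 0 then rr G (hd s) (A v) else A v)))"
        by (intro sum.cong refl) (simp add: c2)
      finally show "cfb A (bd_bar G (Suc n) (single s v)) = bd_bar G (Suc n) (cfb A (single s v))"
        unfolding cfb_single[OF vn_additive[OF A(1)]] bd_bar_single .
    qed
    then show ?thesis
      unfolding B_iff A(2) using CG_smult[OF e(3) A(1)] cfb_BC[OF A(1) e(1)] e(2) by metis
  qed
  have BH: "B \<in> carrier H" if "z \<in> Z" using that cosz carr_H by blast
  have zZ: "z \<in> Z"
  proof (cases n)
    case 0
    then show ?thesis using z by (simp add: Z_def bar_cycles_def)
  next
    case (Suc m)
    have "symb_chain (bar_boundary G MG act_LG n z) = 0"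
      using CG_boundary(2)[of z m] z Suc by (simp add: additive_at_0[OF bd_bar_additive])
    moreover have "bar_boundary G MG act_LG n z \<in> CG m" using CG_boundary(1)[of z m] z Suc by simp
    ultimately have "symb G (bar_boundary G MG act_LG n z s) = 0" "bar_boundary G MG act_LG n z s \<in> carrier LG" for s
      using symb_chain_lookup[of "bar_boundary G MG act_LG n z" m s] by (auto simp: CG_iff)
    then have "bar_boundary G MG act_LG n z = (\<lambda>t. \<zero>\<^bsub>LG\<^esub>)" using symb_zero_iff by blast
    then show ?thesis using z by (simp add: Z_def bar_cycles_def MG_simps)
  qed
  have tor: "\<exists>a\<in>near G e. lop G a \<odot>\<^bsub>H\<^esub> X = B" if X: "X \<in> carrier H" and e: "0 < e" for X e
  proof -
    obtain c where c: "c \<in> Z" "X = cos c" using X unfolding carr_H by (rule imageE)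
    note cC = ZC[OF c(1)]
    have "n = 0 \<or> bd_bar G n (symb_chain c) = 0"
    proof (cases n)
      case (Suc m)
      have "bar_boundary G MG act_LG n c = (\<lambda>t. \<zero>\<^bsub>LG\<^esub>)" using c(1) Suc by (simp add: Z_def bar_cycles_def MG_simps)
      then have "symb_chain (bar_boundary G MG act_LG n c) = 0" by (simp add: symb_chain_def symb_zero)
      then show ?thesis using CG_boundary(2)[of c m] cC Suc by simp
    qed simp
    then obtain a b where a: "a \<in> near G e" and b: "b \<in> BC G (Suc n)" "cfb a (symb_chain c) = bd_bar G (Suc n) b"
      using tors_bar[OF T symb_chain_BC[OF cC] _ e] by blast
    have ac: "lop G a \<odot>\<^bsub>?C\<^esub> c \<in> B"
      unfolding B_iff using CG_smult[OF cC nearD(1)[OF a]] b by metis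
    have aL: "lop G a \<in> carrier LG" by (rule lop_in[OF nearD(1)[OF a]])
    \<comment> \<open>The multiplier acts on the whole coset \<open>B + c\<close>, so each
      representative \<open>h + c\<close> has to land in \<open>B\<close>.\<close>
    have "lop G a \<odot>\<^bsub>?C\<^esub> (h \<oplus>\<^bsub>?C\<^esub> c) \<in> B" if h: "h \<in> B" for h
    proof -
      have hC: "h \<in> CG n" using h B_iff by blast
      note s = CG_smult[OF _ nearD(1)[OF a]]
      have "lop G a \<odot>\<^bsub>?C\<^esub> (h \<oplus>\<^bsub>?C\<^esub> c) = (lop G a \<odot>\<^bsub>?C\<^esub> h) \<oplus>\<^bsub>?C\<^esub> (lop G a \<odot>\<^bsub>?C\<^esub> c)"
        using s[OF hC] s[OF cC] s[OF CG_add(1)[OF hC cC]] CG_add[OF hC cC] CG_add[OF s(1)[OF hC] s(1)[OF cC]]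
        by (intro symb_chain_inj[of _ n]) (simp_all add: additive.add[OF cfb_additive[OF vn_additive[OF nearD(1)[OF a]]]])
      then show ?thesis using B_add smult_B[OF aL h] ac by simp
    qed
    then have "(\<lambda>x. lop G a \<odot>\<^bsub>?C\<^esub> x) ` X \<subseteq> B" "(\<lambda>x. lop G a \<odot>\<^bsub>?C\<^esub> x) ` X \<noteq> {}"
      using B0 by (auto simp: c(2) cos_def)
    then have "lop G a \<odot>\<^bsub>H\<^esub> X = B" unfolding smult_H by (rule BB)
    then show ?thesis using a by blast
  qed
  have smult_HB: "a \<odot>\<^bsub>H\<^esub> B = B" if "a \<in> carrier LG" for a
    unfolding smult_H
  proof (rule BB)
    show "(\<lambda>x. a \<odot>\<^bsub>?C\<^esub> x) ` B \<subseteq> B" by (rule image_subsetI) (rule smult_B[OF that])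
    show "(\<lambda>x. a \<odot>\<^bsub>?C\<^esub> x) ` B \<noteq> {}" using B0 by blast
  qed
  have add_HB: "B \<oplus>\<^bsub>H\<^esub> X = X" if X: "X \<in> carrier H" for X
  proof -
    obtain c where c: "c \<in> Z" "X = cos c" using X unfolding carr_H by (rule imageE)
    have as: "h \<oplus>\<^bsub>?C\<^esub> (h' \<oplus>\<^bsub>?C\<^esub> c) = (h \<oplus>\<^bsub>?C\<^esub> h') \<oplus>\<^bsub>?C\<^esub> c" if "h \<in> B" "h' \<in> B" for h h'
    proof -
      have m: "h \<in> CG n" "h' \<in> CG n" "c \<in> CG n" using that B_iff ZC[OF c(1)] by auto
      show ?thesis
        using CG_add[OF m(2,3)] CG_add[OF m(1,2)] CG_add[OF m(1) CG_add(1)[OF m(2,3)]] CG_add[OF CG_add(1)[OF m(1,2)] m(3)]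
        by (intro symb_chain_inj[of _ n]) (simp_all add: add.assoc)
    qed
    show ?thesis
    proof (intro equalityI subsetI)
      fix x assume "x \<in> B \<oplus>\<^bsub>H\<^esub> X"
      then obtain h h' where h: "h \<in> B" "h' \<in> B" "x = h \<oplus>\<^bsub>?C\<^esub> (h' \<oplus>\<^bsub>?C\<^esub> c)"
        unfolding add_H c(2) cos_def by blast
      then have "x = (h \<oplus>\<^bsub>?C\<^esub> h') \<oplus>\<^bsub>?C\<^esub> c" using as by simp
      then show "x \<in> X" unfolding c(2) cos_def using B_add[OF h(1,2)] by blast
    next
      fix x assume "x \<in> X"
      then obtain h where h: "h \<in> B" "x = h \<oplus>\<^bsub>?C\<^esub> c" unfolding c(2) cos_def by blast
      then have "x = h \<oplus>\<^bsub>?C\<^esub> (z \<oplus>\<^bsub>?C\<^esub> c)" using as[OF h(1) zB] hz[OF h(1)] by simp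
      then show "x \<in> B \<oplus>\<^bsub>H\<^esub> X" unfolding add_H c(2) cos_def using h(1) zB by blast
    qed
  qed
  have subB: "submodule {B} LG H"
    by (rule submodule_singleton) (use BH[OF zZ] BBB zero_H add_HB smult_HB in auto)
  have KB: "carrier (H\<lparr>carrier := {B}\<rparr>) = {B}" "B \<oplus>\<^bsub>H\<lparr>carrier := {B}\<rparr>\<^esub> B = B"
    "\<And>a. a \<in> carrier LG \<Longrightarrow> a \<odot>\<^bsub>H\<lparr>carrier := {B}\<rparr>\<^esub> B = B"
    using BBB smult_HB by simp_all
  \<comment> \<open>The zero submodule must be exhibited too: over an empty set the supremum in the
    extended reals would be \<open>- \<infinity>\<close>, not 0.\<close>
  have "{P. submodule P LG H \<and> fg_projective LG (H\<lparr>carrier := P\<rparr>)} = {{B}}"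
  proof (intro equalityI subsetI)
    fix P assume "P \<in> {P. submodule P LG H \<and> fg_projective LG (H\<lparr>carrier := P\<rparr>)}"
    then have P: "submodule P LG H" "fg_projective LG (H\<lparr>carrier := P\<rparr>)" by auto
    have PB: "B \<in> P" and PH: "P \<subseteq> carrier H"
      using subgroup.one_closed[OF submodule.axioms(1)[OF P(1)]] subgroup.subset[OF submodule.axioms(1)[OF P(1)]]
      by (simp_all add: zero_H)
    have "carrier (H\<lparr>carrier := P\<rparr>) = {B}"
      by (rule fg_projective_torsion_zero[OF P(2)]) (use PB PH BBB tor in auto)
    then show "P \<in> {{B}}" by simp
  next
    fix P assume "P \<in> {{B}}"
    then show "P \<in> {P. submodule P LG H \<and> fg_projective LG (H\<lparr>carrier := P\<rparr>)}"
      using subB zero_module_fg_projective[OF KB] by auto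
  qed
  then have "vN_dim G H = 0"
    unfolding vN_dim_def using zero_module_dim[OF KB] by simp
  then show ?thesis by (simp add: l2_betti_def group_homology_def H_def B_def Z_def)
qed

end

section \<open>The action of the special linear group on nonzero vectors\<close>

theorem theorem1p6:
  fixes n :: nat
  assumes "infinite (UNIV :: 'a::idom set)"
    and "countable (UNIV :: 'a set)"
    and "n \<ge> 2"
  shows "\<forall>i\<in>{0..n - 2}. l2_betti (SL n :: 'a mat monoid) i = 0"
proof
  fix i assume i: "i \<in> {0..n - 2}"
  let ?G = "SL n :: 'a mat monoid"
  interpret S: group ?G by (rule SL_group)
  interpret X: gset ?G "(*\<^sub>v)" "SL_X n"
    by unfold_locales (erule (1) SL_act_closed, auto simp: SL_act_mult SL_X_def SL_simps(3))
  have vec: "set xs \<subseteq> SL_X n \<Longrightarrow> set xs \<subseteq> carrier_vec n" for xs :: "'a vec list"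
    by (auto simp: SL_X_def)
  have "tors ?G (\<lambda>_ _. ()) {()} i"
  \<comment> \<open>\<open>m = n - 2\<close> admits tuples of up to \<open>n - 1\<close> vectors,
    the largest length covered by \<open>SL_U_infinite\<close>.\<close>
  proof (rule X.tors_point[where A="SL_U n" and m="n - 2"])
    have "unit_vec n 0 \<in> (SL_X n :: 'a vec set)" using assms(3) by (auto simp: SL_X_def)
    then show "SL_X n \<noteq> ({} :: 'a vec set)" by blast
    show "subgroup (SL_U n xs) ?G" if "set xs \<subseteq> SL_X n" for xs
      by (rule SL_U_subgroup[OF vec[OF that]])
    show "g *\<^sub>v x = x" if "g \<in> SL_U n xs" "x \<in> set xs" for g :: "'a mat" and xs x
      using that by (simp add: SL_U_def)
    show "g \<otimes>\<^bsub>?G\<^esub> h = h \<otimes>\<^bsub>?G\<^esub> g" if "set xs \<subseteq> SL_X n" "g \<in> SL_U n xs" "h \<in> SL_U n xs" for g h xs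
      by (rule SL_U_comm[OF vec[OF that(1)] that(2,3)])
    show "infinite (SL_U n xs)"
      if "set xs \<subseteq> SL_X n" "1 \<le> length xs" "length xs \<le> Suc (n - 2)" for xs :: "'a vec list"
      by (rule SL_U_infinite[OF assms(1) that(1,2)]) (use that assms(3) in simp)
    show "g \<otimes>\<^bsub>?G\<^esub> a \<otimes>\<^bsub>?G\<^esub> inv\<^bsub>?G\<^esub> g \<in> SL_U n (map ((*\<^sub>v) g) xs)"
      if "g \<in> carrier ?G" "set xs \<subseteq> SL_X n" "a \<in> SL_U n xs" for g a xs
      by (rule SL_U_conj[OF that(1) vec[OF that(2)] that(3)])
    show "i \<le> n - 2" using i by simp
  qed
  then show "l2_betti ?G i = 0" by (rule S.l2_betti_zero)
qed

end
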